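(* Let $\mathscr T=(V,\mathcal E)$ be the directed Cartesian product of locally finite rooted directed trees $\mathscr T_1,\dots,\mathscr T_d$ and let $S_{\boldsymbol\lambda}=(S_1,\dots,S_d)$ be a commuting toral left invertible multishift on $\mathscr T$ with joint kernel $E=\bigcap_j\ker S_j^*$. Assume the toral Cauchy dual $S^{\mathfrak t}_{\boldsymbol\lambda}=(S^{\mathfrak t}_1,\dots,S^{\mathfrak t}_d)$ is commuting, and let $r=(r(S^{\mathfrak t}_1)^{-1},\dots,r(S^{\mathfrak t}_d)^{-1})$, $r(T)$ denoting spectral radius. If $S_{\boldsymbol\lambda}$ satisfies the kernel condition $(\mathfrak K)$, then there exist a reproducing kernel Hilbert space $\mathscr H$ of $E$-valued holomorphic functions on the polydisc $\mathbb D^d_r=\{z:|z_j|<r_j\}$ and a unitary $U:l^2(V)\to\mathscr H$ with $US_j=\mathscr M_{z_j}U$ for $j=1,\dots,d$ ($\mathscr M_{z_j}$ multiplication by $z_j$). If in addition each $\mathscr T_j$ has finite branching index $k_{\mathscr T_j}$, then the reproducing kernel of $\mathscr H$ is $$\kappa(z,w)=\sum_{\alpha,\beta\in\mathbb N^d,\ |\alpha_j-\beta_j|\le k_{\mathscr T_j}\ (j=1,\dots,d)}P_E\,(S^{\mathfrak t}_{\boldsymbol\lambda})^{*\alpha}(S^{\mathfrak t}_{\boldsymbol\lambda})^{\beta}|_E\,z^\alpha\overline w^\beta\qquad(z,w\in\mathbb D^d_r).$$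
   Context: Directed trees: no loops or circuits, connected ignoring orientation, unique parent for vertices with incoming edges; rooted: unique parentless vertex $\mathsf{root}$; $\mathsf{Chi}(u)=\{v:(u,v)\in\mathcal E\}$; locally finite: all $\mathsf{Chi}(u)$ finite; all leafless. Branching index $k_{\mathscr T_j}=1+\sup\{\text{depth}(w):\mathrm{card}\,\mathsf{Chi}(w)\ge2\}$ (or $0$ if no such $w$), depth of $u$ being $n$ with $u\in\mathsf{Chi}^n(\mathsf{root})$. Directed Cartesian product: $V=V_1\times\dots\times V_d$ (countably infinite), $(v,w)\in\mathcal E$ iff for some $k$, $(v_k,w_k)\in\mathcal E_k$ and $w_j=v_j$ ($j\ne k$). $\mathsf{Chi}_j(v)=\{w:w_j\in\mathsf{Chi}(v_j),w_k=v_k\ (k\ne j)\}$. Multishift: positive weights, $S_je_v=\sum_{w\in\mathsf{Chi}_j(v)}\lambda^{(j)}_we_w$, bounded on $l^2(V)$. Toral left invertible: each $S_j^*S_j$ invertible; toral Cauchy dual $S^{\mathfrak t}_j=S_j(S_j^*S_j)^{-1}$; $T^\alpha=T_1^{\alpha_1}\cdots T_d^{\alpha_d}$, $T^{*\alpha}=(T^\alpha)^*$. Kernel condition $(\mathfrak K)$: $E\subseteq\ker\big(S_j^*\prod_{i\ne j}(S^{\mathfrak t}_i)^{\alpha_i}\big)$ for all $j$ and all $\alpha\in\mathbb N^d$. $P_E$ is the orthogonal projection onto $E$. *)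

theory Defs
  imports "HOL-Analysis.Analysis" "HOL-Library.Extended_Nat"
begin

section \<open>Directed trees\<close>

definition directed_tree :: "'a set \<Rightarrow> ('a \<times> 'a) set \<Rightarrow> bool" where
  "directed_tree V E \<longleftrightarrow> V \<noteq> {} \<and> E \<subseteq> V \<times> V
     \<and> (\<forall>v. (v, v) \<notin> E)                       \<comment> \<open>no loops\<close>
     \<and> (\<forall>v. (v, v) \<notin> E\<^sup>+)                    \<comment> \<open>no circuits\<close>
     \<and> (\<forall>u\<in>V. \<forall>v\<in>V. (u, v) \<in> (E \<union> E\<inverse>)\<^sup>*)  \<comment> \<open>connected ignoring orientation\<close>
     \<and> (\<forall>u u' v. (u, v) \<in> E \<longrightarrow> (u', v) \<in> E \<longrightarrow> u = u')"  \<comment> \<open>unique parent\<close>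

definition rooted_tree :: "'a set \<Rightarrow> ('a \<times> 'a) set \<Rightarrow> bool" where
  "rooted_tree V E \<longleftrightarrow> directed_tree V E \<and> (\<exists>!r. r \<in> V \<and> (\<forall>u. (u, r) \<notin> E))"

definition tree_root :: "'a set \<Rightarrow> ('a \<times> 'a) set \<Rightarrow> 'a" where
  "tree_root V E = (THE r. r \<in> V \<and> (\<forall>u. (u, r) \<notin> E))"

definition Chi :: "('a \<times> 'a) set \<Rightarrow> 'a \<Rightarrow> 'a set" where
  "Chi E u = {v. (u, v) \<in> E}"

definition locally_finite_tree :: "'a set \<Rightarrow> ('a \<times> 'a) set \<Rightarrow> bool" where
  "locally_finite_tree V E \<longleftrightarrow> (\<forall>u\<in>V. finite (Chi E u))"

definition leafless :: "'a set \<Rightarrow> ('a \<times> 'a) set \<Rightarrow> bool" where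
  "leafless V E \<longleftrightarrow> (\<forall>u\<in>V. Chi E u \<noteq> {})"

definition tree_parent :: "('a \<times> 'a) set \<Rightarrow> 'a \<Rightarrow> 'a" where
  "tree_parent E v = (THE u. (u, v) \<in> E)"

text \<open>depth of u: the n with u in Chi^n(root)\<close>
definition tree_depth :: "'a set \<Rightarrow> ('a \<times> 'a) set \<Rightarrow> 'a \<Rightarrow> nat" where
  "tree_depth V E u = (THE n. (tree_root V E, u) \<in> E ^^ n)"

definition branching_vertices :: "'a set \<Rightarrow> ('a \<times> 'a) set \<Rightarrow> 'a set" where
  "branching_vertices V E = {w \<in> V. 2 \<le> card (Chi E w)}"

definition branching_index :: "'a set \<Rightarrow> ('a \<times> 'a) set \<Rightarrow> enat" where
  "branching_index V E =
     (if branching_vertices V E = {} then 0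
      else 1 + (SUP w\<in>branching_vertices V E. enat (tree_depth V E w)))"

section \<open>Directed Cartesian product and l^2\<close>

definition prodV :: "('d \<Rightarrow> 'a set) \<Rightarrow> ('d \<Rightarrow> 'a) set" where
  "prodV Vt = {v. \<forall>j. v j \<in> Vt j}"

definition l2 :: "'v set \<Rightarrow> ('v \<Rightarrow> complex) set" where
  "l2 V = {f. (\<forall>v. v \<notin> V \<longrightarrow> f v = 0) \<and> (\<lambda>v. (cmod (f v))\<^sup>2) summable_on V}"

definition l2inner :: "'v set \<Rightarrow> ('v \<Rightarrow> complex) \<Rightarrow> ('v \<Rightarrow> complex) \<Rightarrow> complex" where
  "l2inner V f g = infsum (\<lambda>v. f v * cnj (g v)) V"

definition l2norm :: "'v set \<Rightarrow> ('v \<Rightarrow> complex) \<Rightarrow> real" where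
  "l2norm V f = sqrt (infsum (\<lambda>v. (cmod (f v))\<^sup>2) V)"

section \<open>Bounded operators on l^2(V)\<close>

type_synonym 'v op = "('v \<Rightarrow> complex) \<Rightarrow> ('v \<Rightarrow> complex)"

definition bounded_op :: "'v set \<Rightarrow> 'v op \<Rightarrow> bool" where
  "bounded_op V T \<longleftrightarrow> (\<forall>f\<in>l2 V. T f \<in> l2 V)
     \<and> (\<forall>f\<in>l2 V. \<forall>g\<in>l2 V. \<forall>a b. T (\<lambda>v. a * f v + b * g v) = (\<lambda>v. a * T f v + b * T g v))
     \<and> (\<exists>C. \<forall>f\<in>l2 V. l2norm V (T f) \<le> C * l2norm V f)"

definition adjoint :: "'v set \<Rightarrow> 'v op \<Rightarrow> 'v op" where
  "adjoint V T = (SOME A. bounded_op V A \<and>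
      (\<forall>f\<in>l2 V. \<forall>g\<in>l2 V. l2inner V (T f) g = l2inner V f (A g)))"

definition invertible_op :: "'v set \<Rightarrow> 'v op \<Rightarrow> bool" where
  "invertible_op V T \<longleftrightarrow> bounded_op V T \<and>
     (\<exists>B. bounded_op V B \<and> (\<forall>f\<in>l2 V. B (T f) = f \<and> T (B f) = f))"

definition inverse_op :: "'v set \<Rightarrow> 'v op \<Rightarrow> 'v op" where
  "inverse_op V T = (SOME B. bounded_op V B \<and> (\<forall>f\<in>l2 V. B (T f) = f \<and> T (B f) = f))"

definition op_spectrum :: "'v set \<Rightarrow> 'v op \<Rightarrow> complex set" where
  "op_spectrum V T = {\<mu>. \<not> invertible_op V (\<lambda>f v. T f v - \<mu> * f v)}"

definition spectral_radius :: "'v set \<Rightarrow> 'v op \<Rightarrow> real" where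
  "spectral_radius V T = Sup (cmod ` op_spectrum V T)"

definition op_kernel :: "'v set \<Rightarrow> 'v op \<Rightarrow> ('v \<Rightarrow> complex) set" where
  "op_kernel V T = {f \<in> l2 V. T f = (\<lambda>v. 0)}"

definition commuting :: "'v set \<Rightarrow> ('d \<Rightarrow> 'v op) \<Rightarrow> bool" where
  "commuting V T \<longleftrightarrow> (\<forall>i j. \<forall>f\<in>l2 V. T i (T j f) = T j (T i f))"

text \<open>T^alpha = T_1^alpha_1 ... T_d^alpha_d (in the order of the index type)\<close>
definition mpow :: "('d::{finite,linorder} \<Rightarrow> 'v op) \<Rightarrow> ('d \<Rightarrow> nat) \<Rightarrow> 'v op" where
  "mpow T \<alpha> = foldr (\<lambda>j acc. (T j ^^ \<alpha> j) \<circ> acc) (sorted_list_of_set UNIV) id"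

text \<open>toral Cauchy dual S_j (S_j^* S_j)^{-1}\<close>
definition cauchy_dual :: "'v set \<Rightarrow> ('d \<Rightarrow> 'v op) \<Rightarrow> ('d \<Rightarrow> 'v op)" where
  "cauchy_dual V T = (\<lambda>j. T j \<circ> inverse_op V (adjoint V (T j) \<circ> T j))"

definition orth_proj :: "'v set \<Rightarrow> ('v \<Rightarrow> complex) set \<Rightarrow> 'v op" where
  "orth_proj V M f = (THE p. p \<in> M \<and> (\<forall>g\<in>M. l2inner V (\<lambda>v. f v - p v) g = 0))"

text \<open>unconditional summation in the l^2 norm\<close>
definition l2_has_sum :: "'v set \<Rightarrow> ('i \<Rightarrow> 'v \<Rightarrow> complex) \<Rightarrow> ('v \<Rightarrow> complex) \<Rightarrow> 'i set \<Rightarrow> bool" where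
  "l2_has_sum V g s A \<longleftrightarrow>
     ((\<lambda>F. l2norm V (\<lambda>v. (\<Sum>a\<in>F. g a v) - s v)) \<longlongrightarrow> 0) (finite_subsets_at_top A)"

section \<open>Multishift\<close>

text \<open>(S_j f)(w) = lambda^(j)_w f(par_j w) for w_j not the root, 0 otherwise;
  equivalently S_j e_v = sum over w in Chi_j(v) of lambda^(j)_w e_w\<close>
definition multishift :: "('d \<Rightarrow> 'a set) \<Rightarrow> ('d \<Rightarrow> ('a \<times> 'a) set) \<Rightarrow> ('d \<Rightarrow> ('d \<Rightarrow> 'a) \<Rightarrow> real)
     \<Rightarrow> 'd \<Rightarrow> ('d \<Rightarrow> 'a) op" where
  "multishift Vt Et lam j f = (\<lambda>w. if w \<in> prodV Vt \<and> w j \<noteq> tree_root (Vt j) (Et j)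
      then complex_of_real (lam j w) * f (w(j := tree_parent (Et j) (w j))) else 0)"

section \<open>Hilbert spaces of E-valued holomorphic functions\<close>

definition polydisc :: "('d::finite \<Rightarrow> real) \<Rightarrow> (complex^'d) set" where
  "polydisc r = {z. \<forall>j. cmod (z $ j) < r j}"

text \<open>Frechet complex differentiability in the l^2 norm\<close>
definition l2_holomorphic_on :: "'v set \<Rightarrow> ((complex^'d::finite) \<Rightarrow> 'v \<Rightarrow> complex) \<Rightarrow> (complex^'d) set \<Rightarrow> bool" where
  "l2_holomorphic_on V F \<Omega> \<longleftrightarrow> (\<forall>z0\<in>\<Omega>. \<exists>D. (\<forall>j. D j \<in> l2 V) \<and>
     ((\<lambda>z. l2norm V (\<lambda>v. F z v - F z0 v - (\<Sum>j\<in>UNIV. (z $ j - z0 $ j) * D j v)) / norm (z - z0))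
        \<longlongrightarrow> 0) (at z0 within \<Omega>))"

definition hnorm :: "(('z \<Rightarrow> 'v \<Rightarrow> complex) \<Rightarrow> ('z \<Rightarrow> 'v \<Rightarrow> complex) \<Rightarrow> complex) \<Rightarrow> ('z \<Rightarrow> 'v \<Rightarrow> complex) \<Rightarrow> real" where
  "hnorm ip F = sqrt (Re (ip F F))"

text \<open>H is a reproducing kernel Hilbert space of E-valued holomorphic functions on Omega
  (functions are extended by 0 outside Omega)\<close>
definition rkhs :: "'v set \<Rightarrow> ('v \<Rightarrow> complex) set \<Rightarrow> (complex^'d::finite) set
     \<Rightarrow> ((complex^'d) \<Rightarrow> 'v \<Rightarrow> complex) set
     \<Rightarrow> (((complex^'d) \<Rightarrow> 'v \<Rightarrow> complex) \<Rightarrow> ((complex^'d) \<Rightarrow> 'v \<Rightarrow> complex) \<Rightarrow> complex) \<Rightarrow> bool" where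
  "rkhs V E \<Omega> H ip \<longleftrightarrow>
     (\<forall>F\<in>H. (\<forall>z\<in>\<Omega>. F z \<in> E) \<and> (\<forall>z. z \<notin> \<Omega> \<longrightarrow> F z = (\<lambda>v. 0)) \<and> l2_holomorphic_on V F \<Omega>)
   \<and> (\<lambda>z v. 0) \<in> H
   \<and> (\<forall>F\<in>H. \<forall>G\<in>H. \<forall>a b. (\<lambda>z v. a * F z v + b * G z v) \<in> H)
   \<and> (\<forall>F\<in>H. \<forall>G\<in>H. \<forall>K\<in>H. \<forall>a b. ip (\<lambda>z v. a * F z v + b * G z v) K = a * ip F K + b * ip G K)
   \<and> (\<forall>F\<in>H. \<forall>G\<in>H. ip G F = cnj (ip F G))
   \<and> (\<forall>F\<in>H. 0 \<le> Re (ip F F) \<and> (ip F F = 0 \<longleftrightarrow> F = (\<lambda>z v. 0)))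
   \<and> (\<forall>X. (\<forall>n. X n \<in> H) \<and>
          (\<forall>\<epsilon>>0. \<exists>N::nat. \<forall>m\<ge>N. \<forall>n\<ge>N. hnorm ip (\<lambda>z v. X m z v - X n z v) < \<epsilon>)
        \<longrightarrow> (\<exists>L\<in>H. \<forall>\<epsilon>>0. \<exists>N::nat. \<forall>n\<ge>N. hnorm ip (\<lambda>z v. X n z v - L z v) < \<epsilon>))
   \<and> (\<forall>z\<in>\<Omega>. \<exists>C. \<forall>F\<in>H. l2norm V (F z) \<le> C * hnorm ip F)"

definition unitary_onto :: "'v set \<Rightarrow> (('v \<Rightarrow> complex) \<Rightarrow> ('z \<Rightarrow> 'v \<Rightarrow> complex))
     \<Rightarrow> ('z \<Rightarrow> 'v \<Rightarrow> complex) set \<Rightarrow> (('z \<Rightarrow> 'v \<Rightarrow> complex) \<Rightarrow> ('z \<Rightarrow> 'v \<Rightarrow> complex) \<Rightarrow> complex) \<Rightarrow> bool" where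
  "unitary_onto V U H ip \<longleftrightarrow> U ` l2 V = H
     \<and> (\<forall>f\<in>l2 V. \<forall>g\<in>l2 V. \<forall>a b. U (\<lambda>v. a * f v + b * g v) = (\<lambda>z v. a * U f z v + b * U g z v))
     \<and> (\<forall>f\<in>l2 V. \<forall>g\<in>l2 V. ip (U f) (U g) = l2inner V f g)"

text \<open>K z w e = kappa(z,w) e; kappa(.,w)e lies in H and <F, kappa(.,w)e>_H = <F(w), e>\<close>
definition reproducing_kernel :: "'v set \<Rightarrow> ('v \<Rightarrow> complex) set \<Rightarrow> 'z set \<Rightarrow> ('z \<Rightarrow> 'v \<Rightarrow> complex) set
     \<Rightarrow> (('z \<Rightarrow> 'v \<Rightarrow> complex) \<Rightarrow> ('z \<Rightarrow> 'v \<Rightarrow> complex) \<Rightarrow> complex)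
     \<Rightarrow> ('z \<Rightarrow> 'z \<Rightarrow> 'v op) \<Rightarrow> bool" where
  "reproducing_kernel V E \<Omega> H ip K \<longleftrightarrow> (\<forall>w\<in>\<Omega>. \<forall>e\<in>E.
      (\<lambda>z. if z \<in> \<Omega> then K z w e else (\<lambda>v. 0)) \<in> H \<and>
      (\<forall>F\<in>H. ip F (\<lambda>z. if z \<in> \<Omega> then K z w e else (\<lambda>v. 0)) = l2inner V (F w) e))"

end

(*
Write T for the toral Cauchy dual and L_j = T_j^*; then L_j S_j = I and ker L_j = ker S_j^*.
The model map is (U f)(z) = sum over alpha of z^alpha P_E (T^alpha)^* f.  It converges on the
polydisc because a resolvent bound and Cauchy's inequality give |T_j^n| <= M rho^(-n) whenever
rho is below the reciprocal of the spectral radius.  U S_j = z_j U holds since (T^alpha)^* S_j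
drops one factor T_j^* when alpha_j > 0, while the kernel condition makes P_E (T^alpha)^* S_j
vanish when alpha_j = 0.  If U f = 0, then f is orthogonal to every T^alpha E; induction on the
total depth shows that f vanishes on every level: its restriction g to a level is again orthogonal
to every T^alpha E, so is L_j g, which lives one level lower and hence is 0, so g lies in E and is
orthogonal to itself.

The kernel is the double series of z^alpha cnj(w)^beta P_E (T^alpha)^* T^beta.  Below the branching
index each vertex is an only child, so functions in E are supported at j-depth at most k_j and
T^beta E at j-depths in [beta_j, beta_j + k_j]; this kills all terms with |alpha_j - beta_j| > k_j.
*)
theory Submission
  imports Defs "HOL-Complex_Analysis.Cauchy_Integral_Formula"
begin

subsection \<open>The Hilbert space of square summable functions\<close>

text \<open>The trees enter only through depths, parents and only children; the rest is proved for
  an abstract left invertible tuple on \<open>l2 V\<close> with a grading \<open>lev\<close> of the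
  basis. The grading makes injectivity of the model map a well-founded induction, because the
  adjoint of each dual operator lowers the level by one. What has to be secured is that the level
  projections, which intertwine with \<open>S j\<close>, also intertwine with the inverse Gram
  operator and hence with the dual. Injectivity also makes the inner product of the model space well
  defined, as it is transported from \<open>l2 V\<close>; completeness is then that of
  \<open>l2 V\<close>. The radius r_j is the reciprocal of a supremum over the spectrum, so
  positivity of the spectral radius is needed before anything converges. It comes from the left
  inverse of the dual operator, which limits how fast its powers can decay. The kernel is found from
  the vector representing f -> <(U f)(w), e>, namely the sum of cnj(w)^\<beta> T^\<beta> e: applying
  U to it and expanding gives the double series.\<close>

lemma l2_D0: "f \<in> l2 V \<Longrightarrow> v \<notin> V \<Longrightarrow> f v = 0"
  by (simp add: l2_def)

lemma l2_summable: "f \<in> l2 V \<Longrightarrow> (\<lambda>v. (cmod (f v))\<^sup>2) summable_on V"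
  by (simp add: l2_def)

lemma l2norm_nonneg [simp]: "0 \<le> l2norm V f"
  by (simp add: l2norm_def infsum_nonneg)

lemma l2norm_power2: "(l2norm V f)\<^sup>2 = infsum (\<lambda>v. (cmod (f v))\<^sup>2) V"
  by (simp add: l2norm_def infsum_nonneg)

text \<open>Reduces membership and a norm bound to finite sets, where Minkowski's inequality for
  \<open>L2_set\<close> is available; sums, limits, adjoints and restrictions all enter
  \<open>l2\<close> this way.\<close>

lemma l2_boundI:
  assumes "\<And>v. v \<notin> V \<Longrightarrow> f v = 0" and "0 \<le> C"
    and bound: "\<And>F. finite F \<Longrightarrow> F \<subseteq> V \<Longrightarrow> L2_set (\<lambda>v. cmod (f v)) F \<le> C"
  shows "f \<in> l2 V" "l2norm V f \<le> C"
proof -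
  have sq: "(\<Sum>v\<in>F. (cmod (f v))\<^sup>2) \<le> C\<^sup>2" if "finite F" "F \<subseteq> V" for F
  proof -
    have "sqrt (\<Sum>v\<in>F. (cmod (f v))\<^sup>2) \<le> C"
      using bound[OF that] by (simp add: L2_set_def)
    then show ?thesis
      by (rule sqrt_le_D)
  qed
  have s: "(\<lambda>v. (cmod (f v))\<^sup>2) summable_on V"
    by (rule nonneg_bdd_above_summable_on) (auto intro!: bdd_aboveI[of _ "C\<^sup>2"] sq)
  with assms show "f \<in> l2 V"
    by (simp add: l2_def)
  have "infsum (\<lambda>v. (cmod (f v))\<^sup>2) V \<le> C\<^sup>2"
    by (rule infsum_le_finite_sums[OF s]) (auto intro: sq)
  then show "l2norm V f \<le> C"
    unfolding l2norm_def using \<open>0 \<le> C\<close> by (rule real_le_lsqrt[rotated])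
qed

lemma L2_set_le_l2norm:
  assumes "f \<in> l2 V" "finite F" "F \<subseteq> V"
  shows "L2_set (\<lambda>v. cmod (f v)) F \<le> l2norm V f"
  unfolding L2_set_def l2norm_def
  by (intro real_sqrt_le_mono finite_sum_le_infsum) (use assms l2_summable in auto)

lemma cmod_le_l2norm:
  assumes "f \<in> l2 V"
  shows "cmod (f v) \<le> l2norm V f"
proof (cases "v \<in> V")
  case True
  then show ?thesis
    using L2_set_le_l2norm[OF assms, of "{v}"] by simp
next
  case False
  then show ?thesis
    using l2_D0[OF assms] by simp
qed

lemma l2_zero [simp]: "(\<lambda>v. 0) \<in> l2 V" "l2norm V (\<lambda>v. 0) = 0"
  by (auto simp: l2_def l2norm_def)

lemma l2norm_eq_0_iff: "f \<in> l2 V \<Longrightarrow> l2norm V f = 0 \<longleftrightarrow> f = (\<lambda>v. 0)"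
  by (metis cmod_le_l2norm ext l2_zero(2) norm_le_zero_iff)

lemma
  assumes "f \<in> l2 V" "g \<in> l2 V"
  shows l2_add: "(\<lambda>v. f v + g v) \<in> l2 V"
    and l2norm_triangle: "l2norm V (\<lambda>v. f v + g v) \<le> l2norm V f + l2norm V g"
proof -
  have bd: "L2_set (\<lambda>v. cmod (f v + g v)) F \<le> l2norm V f + l2norm V g" if "finite F" "F \<subseteq> V" for F
  proof -
    have "L2_set (\<lambda>v. cmod (f v + g v)) F \<le> L2_set (\<lambda>v. cmod (f v) + cmod (g v)) F"
      by (intro L2_set_mono) (auto intro: norm_triangle_ineq)
    also have "\<dots> \<le> L2_set (\<lambda>v. cmod (f v)) F + L2_set (\<lambda>v. cmod (g v)) F"
      by (rule L2_set_triangle_ineq)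
    also have "\<dots> \<le> l2norm V f + l2norm V g"
      by (intro add_mono L2_set_le_l2norm assms that)
    finally show ?thesis .
  qed
  have z: "f v + g v = 0" if "v \<notin> V" for v
    using assms that by (simp add: l2_D0)
  show "(\<lambda>v. f v + g v) \<in> l2 V" "l2norm V (\<lambda>v. f v + g v) \<le> l2norm V f + l2norm V g"
    using l2_boundI[OF z _ bd] by auto
qed

lemma l2norm_scale: "l2norm V (\<lambda>v. c * f v) = cmod c * l2norm V f"
  by (simp add: l2norm_def norm_mult power_mult_distrib infsum_cmult_right' real_sqrt_mult)

lemma l2_scale: "f \<in> l2 V \<Longrightarrow> (\<lambda>v. c * f v) \<in> l2 V"
  by (auto simp: l2_def norm_mult power_mult_distrib intro!: summable_on_cmult_right)

lemma l2_uminus: "f \<in> l2 V \<Longrightarrow> (\<lambda>v. - f v) \<in> l2 V"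
  using l2_scale[of f V "-1"] by simp

lemma l2norm_uminus: "l2norm V (\<lambda>v. - f v) = l2norm V f"
  by (simp add: l2norm_def)

lemma l2_diff: "f \<in> l2 V \<Longrightarrow> g \<in> l2 V \<Longrightarrow> (\<lambda>v. f v - g v) \<in> l2 V"
  using l2_add[of f V "\<lambda>v. - g v"] by (simp add: l2_uminus)

lemma l2norm_triangle_diff:
  "f \<in> l2 V \<Longrightarrow> g \<in> l2 V \<Longrightarrow> l2norm V (\<lambda>v. f v - g v) \<le> l2norm V f + l2norm V g"
  using l2norm_triangle[of f V "\<lambda>v. - g v"] by (simp add: l2_uminus l2norm_uminus)

lemma l2norm_triangle_sub:
  assumes "f \<in> l2 V" "g \<in> l2 V"
  shows "l2norm V f \<le> l2norm V g + l2norm V (\<lambda>v. f v - g v)"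
  using l2norm_triangle[OF assms(2) l2_diff[OF assms]] by simp

lemma l2_lincomb: "f \<in> l2 V \<Longrightarrow> g \<in> l2 V \<Longrightarrow> (\<lambda>v. a * f v + b * g v) \<in> l2 V"
  by (intro l2_add l2_scale)

lemma l2_sum: "(\<And>a. a \<in> A \<Longrightarrow> g a \<in> l2 V) \<Longrightarrow> (\<lambda>v. \<Sum>a\<in>A. g a v) \<in> l2 V"
  by (induction A rule: infinite_finite_induct) (auto intro: l2_add)

lemma l2norm_sum_le:
  "(\<And>a. a \<in> A \<Longrightarrow> g a \<in> l2 V) \<Longrightarrow> l2norm V (\<lambda>v. \<Sum>a\<in>A. g a v) \<le> (\<Sum>a\<in>A. l2norm V (g a))"
proof (induction A rule: infinite_finite_induct)
  case (insert x F)
  have "l2norm V (\<lambda>v. g x v + (\<Sum>a\<in>F. g a v)) \<le> l2norm V (g x) + l2norm V (\<lambda>v. \<Sum>a\<in>F. g a v)"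
    by (intro l2norm_triangle l2_sum) (use insert in auto)
  with insert show ?case
    by force
qed auto

lemma
  assumes "f \<in> l2 V" "g \<in> l2 V"
  shows l2inner_summable: "(\<lambda>v. norm (f v * cnj (g v))) summable_on V"
    and l2_Cauchy_Schwarz: "cmod (l2inner V f g) \<le> l2norm V f * l2norm V g"
proof -
  have bd: "(\<Sum>v\<in>F. norm (f v * cnj (g v))) \<le> l2norm V f * l2norm V g" if "finite F" "F \<subseteq> V" for F
  proof -
    have "(\<Sum>v\<in>F. norm (f v * cnj (g v))) \<le> L2_set (\<lambda>v. cmod (f v)) F * L2_set (\<lambda>v. cmod (g v)) F"
      using L2_set_mult_ineq[of "\<lambda>v. cmod (f v)" "\<lambda>v. cmod (g v)" F] by (simp add: norm_mult)
    also have "\<dots> \<le> l2norm V f * l2norm V g"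
      by (intro mult_mono L2_set_le_l2norm assms that L2_set_nonneg) auto
    finally show ?thesis .
  qed
  show s: "(\<lambda>v. norm (f v * cnj (g v))) summable_on V"
    by (rule nonneg_bdd_above_summable_on) (auto intro!: bdd_aboveI[of _ "l2norm V f * l2norm V g"] bd)
  have "cmod (l2inner V f g) \<le> infsum (\<lambda>v. norm (f v * cnj (g v))) V"
    unfolding l2inner_def by (rule norm_infsum_bound[OF s])
  also have "\<dots> \<le> l2norm V f * l2norm V g"
    by (rule infsum_le_finite_sums[OF s]) (auto intro: bd)
  finally show "cmod (l2inner V f g) \<le> l2norm V f * l2norm V g" .
qed

lemma l2inner_add_left:
  assumes "f \<in> l2 V" "g \<in> l2 V" "h \<in> l2 V"
  shows "l2inner V (\<lambda>v. f v + g v) h = l2inner V f h + l2inner V g h"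
  unfolding l2inner_def ring_distribs
  using assms by (intro infsum_add) (rule abs_summable_summable[OF l2inner_summable]; assumption)+

lemma l2inner_scale_left: "l2inner V (\<lambda>v. c * f v) h = c * l2inner V f h"
  by (simp add: l2inner_def mult.assoc infsum_cmult_right')

lemma l2inner_cnj: "cnj (l2inner V f g) = l2inner V g f"
  by (simp add: l2inner_def mult.commute flip: infsum_cnj)

lemma l2inner_add_right:
  assumes "f \<in> l2 V" "g \<in> l2 V" "h \<in> l2 V"
  shows "l2inner V h (\<lambda>v. f v + g v) = l2inner V h f + l2inner V h g"
  using l2inner_add_left[OF assms] by (metis complex_cnj_add l2inner_cnj)

lemma l2inner_scale_right: "l2inner V h (\<lambda>v. c * f v) = cnj c * l2inner V h f"
  by (metis complex_cnj_mult l2inner_cnj l2inner_scale_left)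

lemma l2inner_diff_left:
  assumes "f \<in> l2 V" "g \<in> l2 V" "h \<in> l2 V"
  shows "l2inner V (\<lambda>v. f v - g v) h = l2inner V f h - l2inner V g h"
  using l2inner_add_left[OF assms(1) l2_scale[OF assms(2), of "-1"] assms(3)]
    l2inner_scale_left[of V "-1" g h] by simp

lemma l2inner_diff_right:
  assumes "f \<in> l2 V" "g \<in> l2 V" "h \<in> l2 V"
  shows "l2inner V h (\<lambda>v. f v - g v) = l2inner V h f - l2inner V h g"
  using l2inner_diff_left[OF assms] by (metis complex_cnj_diff l2inner_cnj)

lemma l2inner_zero [simp]: "l2inner V (\<lambda>v. 0) h = 0" "l2inner V h (\<lambda>v. 0) = 0"
  by (simp_all add: l2inner_def)

lemma l2inner_sum_left:
  "h \<in> l2 V \<Longrightarrow> (\<And>a. a \<in> A \<Longrightarrow> g a \<in> l2 V) \<Longrightarrow>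
    l2inner V (\<lambda>v. \<Sum>a\<in>A. g a v) h = (\<Sum>a\<in>A. l2inner V (g a) h)"
  by (induction A rule: infinite_finite_induct) (auto simp: l2inner_add_left l2_sum)

lemma l2inner_self:
  assumes "f \<in> l2 V"
  shows "l2inner V f f = complex_of_real ((l2norm V f)\<^sup>2)"
proof -
  have "l2inner V f f = infsum (\<lambda>v. complex_of_real ((cmod (f v))\<^sup>2)) V"
    unfolding l2inner_def by (intro infsum_cong) (metis complex_norm_square of_real_power)
  also have "\<dots> = complex_of_real (infsum (\<lambda>v. (cmod (f v))\<^sup>2) V)"
    by (intro infsumI has_sum_of_real has_sum_infsum l2_summable assms)
  finally show ?thesis
    by (simp add: l2norm_power2)
qed

lemma l2inner_self_eq_0_iff: "f \<in> l2 V \<Longrightarrow> l2inner V f f = 0 \<longleftrightarrow> f = (\<lambda>v. 0)"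
  by (simp add: l2inner_self l2norm_eq_0_iff)

lemma l2_eqI:
  assumes "f \<in> l2 V" "g \<in> l2 V" "\<And>h. h \<in> l2 V \<Longrightarrow> l2inner V f h = l2inner V g h"
  shows "f = g"
proof -
  have "l2inner V (\<lambda>v. f v - g v) (\<lambda>v. f v - g v) = 0"
    using assms by (simp add: l2inner_diff_left l2_diff)
  then have "(\<lambda>v. f v - g v) = (\<lambda>v. 0)"
    using l2inner_self_eq_0_iff[OF l2_diff[OF assms(1,2)]] by simp
  then show ?thesis
    by (simp add: fun_eq_iff)
qed

section \<open>Unit vectors, limits and norm-convergent series in l^2\<close>

definition unit_vec :: "'v \<Rightarrow> 'v \<Rightarrow> complex" where
  "unit_vec u = (\<lambda>v. if v = u then 1 else 0)"

lemma unit_vec_l2: "u \<in> V \<Longrightarrow> unit_vec u \<in> l2 V"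
  unfolding unit_vec_def l2_def
  by (auto intro!: finite_nonzero_values_imp_summable_on finite_subset[of _ "{u}"] split: if_splits)

lemma l2inner_unit_vec: "u \<in> V \<Longrightarrow> l2inner V f (unit_vec u) = f u"
proof -
  assume u: "u \<in> V"
  have "l2inner V f (unit_vec u) = infsum (\<lambda>v. f v * cnj (unit_vec u v)) {u}"
    unfolding l2inner_def by (rule infsum_cong_neutral) (use u in \<open>auto simp: unit_vec_def\<close>)
  then show ?thesis
    by (simp add: unit_vec_def)
qed

text \<open>A Fatou-type principle: every finite partial norm passes to the limit, so the norm is
  lower semicontinuous under pointwise convergence. The filter is arbitrary in order to cover
  sequences as well as nets of finite partial sums.\<close>

lemma l2_pointwise_limit:
  assumes "F \<noteq> bot" and X: "\<forall>\<^sub>F i in F. X i \<in> l2 V \<and> l2norm V (X i) \<le> C"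
    and lim: "\<And>v. ((\<lambda>i. X i v) \<longlongrightarrow> x v) F"
  shows "x \<in> l2 V" "l2norm V x \<le> C"
proof -
  have "0 \<le> C"
    using eventually_happens'[OF assms(1) X] l2norm_nonneg order_trans by blast
  have z: "x v = 0" if "v \<notin> V" for v
  proof -
    have "((\<lambda>i. X i v) \<longlongrightarrow> 0) F"
      by (rule tendsto_eventually, rule eventually_mono[OF X]) (use that in \<open>auto simp: l2_D0\<close>)
    then show ?thesis
      using lim[of v] assms(1) tendsto_unique by blast
  qed
  have bd: "L2_set (\<lambda>v. cmod (x v)) A \<le> C" if "finite A" "A \<subseteq> V" for A
  proof (rule tendsto_upperbound[OF _ _ assms(1)])
    show "((\<lambda>i. L2_set (\<lambda>v. cmod (X i v)) A) \<longlongrightarrow> L2_set (\<lambda>v. cmod (x v)) A) F"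
      unfolding L2_set_def by (intro tendsto_intros lim)
    show "\<forall>\<^sub>F i in F. L2_set (\<lambda>v. cmod (X i v)) A \<le> C"
      using X by eventually_elim (use that L2_set_le_l2norm order_trans in blast)
  qed
  show "x \<in> l2 V" "l2norm V x \<le> C"
    using l2_boundI[OF z \<open>0 \<le> C\<close> bd] by auto
qed

lemma l2_complete:
  assumes X: "\<And>n. X n \<in> l2 V"
    and Cauchy: "\<And>\<epsilon>. \<epsilon> > 0 \<Longrightarrow> \<exists>N::nat. \<forall>m\<ge>N. \<forall>n\<ge>N. l2norm V (\<lambda>v. X m v - X n v) < \<epsilon>"
  shows "\<exists>x\<in>l2 V. (\<lambda>n. l2norm V (\<lambda>v. X n v - x v)) \<longlonglongrightarrow> 0"
proof -
  have "convergent (\<lambda>n. X n v)" for v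
  proof (rule Cauchy_convergent, rule CauchyI)
    fix e :: real assume "0 < e"
    then obtain N where N: "\<forall>m\<ge>N. \<forall>n\<ge>N. l2norm V (\<lambda>v. X m v - X n v) < e"
      using Cauchy by blast
    then show "\<exists>N. \<forall>m\<ge>N. \<forall>n\<ge>N. norm (X m v - X n v) < e"
      using cmod_le_l2norm[OF l2_diff[OF X X]] by (meson le_less_trans)
  qed
  then obtain x where x: "\<And>v. (\<lambda>n. X n v) \<longlonglongrightarrow> x v"
    unfolding convergent_def by metis
  \<comment> \<open>With n fixed, m tends to infinity in the Cauchy estimate and the pointwise limit
    inherits the bound. Only a weak inequality survives, hence the later use of e / 2.\<close>
  have tail: "\<exists>N. \<forall>n\<ge>N. (\<lambda>v. X n v - x v) \<in> l2 V \<and> l2norm V (\<lambda>v. X n v - x v) \<le> \<epsilon>"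
    if eps: "\<epsilon> > 0" for \<epsilon>
  proof -
    obtain N where N: "\<forall>m\<ge>N. \<forall>n\<ge>N. l2norm V (\<lambda>v. X m v - X n v) < \<epsilon>"
      using Cauchy[OF eps] by blast
    have "(\<lambda>v. X n v - x v) \<in> l2 V \<and> l2norm V (\<lambda>v. X n v - x v) \<le> \<epsilon>" if "n \<ge> N" for n
    proof -
      have "\<forall>\<^sub>F m in sequentially. (\<lambda>v. X n v - X m v) \<in> l2 V \<and> l2norm V (\<lambda>v. X n v - X m v) \<le> \<epsilon>"
        unfolding eventually_sequentially using N that l2_diff[OF X X] less_imp_le by blast
      moreover have "(\<lambda>m. X n v - X m v) \<longlonglongrightarrow> X n v - x v" for v
        by (intro tendsto_intros x)
      ultimately show ?thesis
        using l2_pointwise_limit[of sequentially "\<lambda>m v. X n v - X m v" V \<epsilon> "\<lambda>v. X n v - x v"]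
        by simp
    qed
    then show ?thesis by blast
  qed
  obtain N where "(\<lambda>v. X N v - x v) \<in> l2 V"
    using tail[of 1] by auto
  then have "x \<in> l2 V"
    using l2_diff[OF X[of N]] by force
  moreover have "(\<lambda>n. l2norm V (\<lambda>v. X n v - x v)) \<longlonglongrightarrow> 0"
  proof (rule LIMSEQ_I)
    fix e :: real assume "0 < e"
    then obtain N where N: "\<forall>n\<ge>N. l2norm V (\<lambda>v. X n v - x v) \<le> e / 2"
      using tail[of "e/2"] by auto
    have "norm (l2norm V (\<lambda>v. X n v - x v) - 0) < e" if "n \<ge> N" for n
      using N that \<open>0 < e\<close> by fastforce
    then show "\<exists>N. \<forall>n\<ge>N. norm (l2norm V (\<lambda>v. X n v - x v) - 0) < e"
      by blast
  qed
  ultimately show ?thesis by blast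
qed

text \<open>The sum is formed coordinatewise, so it needs no topology on \<open>l2 V\<close>; when
  the norms are summable it is also the sum in norm.\<close>

definition l2_infsum :: "('i \<Rightarrow> 'v \<Rightarrow> complex) \<Rightarrow> 'i set \<Rightarrow> 'v \<Rightarrow> complex" where
  "l2_infsum g A = (\<lambda>v. infsum (\<lambda>a. g a v) A)"

lemma
  assumes g: "\<And>a. a \<in> A \<Longrightarrow> g a \<in> l2 V" and s: "(\<lambda>a. l2norm V (g a)) summable_on A"
  shows l2_infsum_in_l2: "l2_infsum g A \<in> l2 V"
    and l2norm_l2_infsum_le: "l2norm V (l2_infsum g A) \<le> infsum (\<lambda>a. l2norm V (g a)) A"
    and l2_has_sum_l2_infsum: "l2_has_sum V g (l2_infsum g A) A"
proof -
  let ?x = "l2_infsum g A"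
  let ?n = "\<lambda>a. l2norm V (g a)"
  have ps: "((\<lambda>a. g a v) has_sum ?x v) A" for v
  proof -
    have "(\<lambda>a. norm (g a v)) summable_on A"
      by (rule summable_on_comparison_test[OF s]) (auto intro: cmod_le_l2norm g)
    then show ?thesis
      unfolding l2_infsum_def by (intro has_sum_infsum) (rule abs_summable_summable)
  qed
  have lim: "((\<lambda>F. \<Sum>a\<in>F. g a v) \<longlongrightarrow> ?x v) (finite_subsets_at_top A)" for v
    using ps[of v] by (simp add: has_sum_def)
  have finA: "\<forall>\<^sub>F F in finite_subsets_at_top A. finite F \<and> F \<subseteq> A"
    by (rule eventually_finite_subsets_at_top_weakI) auto
  have X: "\<forall>\<^sub>F F in finite_subsets_at_top A. (\<lambda>v. \<Sum>a\<in>F. g a v) \<in> l2 V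
      \<and> l2norm V (\<lambda>v. \<Sum>a\<in>F. g a v) \<le> infsum ?n A"
    using finA
  proof eventually_elim
    case (elim F)
    have "l2norm V (\<lambda>v. \<Sum>a\<in>F. g a v) \<le> sum ?n F"
      by (rule l2norm_sum_le) (use elim g in auto)
    also have "\<dots> \<le> infsum ?n A"
      by (rule finite_sum_le_infsum[OF s]) (use elim in auto)
    finally show ?case
      using l2_sum[of F g V] elim g by blast
  qed
  show x: "?x \<in> l2 V" and "l2norm V ?x \<le> infsum ?n A"
    using l2_pointwise_limit[OF _ X lim] by auto
  \<comment> \<open>For finite G containing F the partial sums differ by the terms over G - F, whose
    norms add up to at most the remainder of the norm series; G then runs to the limit with F
    fixed.\<close>
  have tail: "l2norm V (\<lambda>v. (\<Sum>a\<in>F. g a v) - ?x v) \<le> infsum ?n A - sum ?n F" if F: "finite F" "F \<subseteq> A" for F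
  proof -
    have "\<forall>\<^sub>F G in finite_subsets_at_top A. finite G \<and> F \<subseteq> G \<and> G \<subseteq> A"
      unfolding eventually_finite_subsets_at_top using F by blast
    then have "\<forall>\<^sub>F G in finite_subsets_at_top A.
        (\<lambda>v. (\<Sum>a\<in>F. g a v) - (\<Sum>a\<in>G. g a v)) \<in> l2 V
        \<and> l2norm V (\<lambda>v. (\<Sum>a\<in>F. g a v) - (\<Sum>a\<in>G. g a v)) \<le> infsum ?n A - sum ?n F"
    proof eventually_elim
      case (elim G)
      have "(\<lambda>v. (\<Sum>a\<in>F. g a v) - (\<Sum>a\<in>G. g a v)) = (\<lambda>v. - (\<Sum>a\<in>G - F. g a v))"
        using elim by (simp add: sum_diff F)
      moreover have "l2norm V (\<lambda>v. - (\<Sum>a\<in>G - F. g a v)) \<le> sum ?n (G - F)"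
        unfolding l2norm_uminus by (rule l2norm_sum_le) (use elim g in auto)
      moreover have "sum ?n (G - F) = sum ?n G - sum ?n F"
        using elim F by (simp add: sum_diff)
      moreover have "sum ?n G \<le> infsum ?n A"
        by (rule finite_sum_le_infsum[OF s]) (use elim in auto)
      moreover have "(\<lambda>v. (\<Sum>a\<in>F. g a v) - (\<Sum>a\<in>G. g a v)) \<in> l2 V"
        by (intro l2_diff l2_sum) (use elim g in auto)
      ultimately show ?case by simp
    qed
    then show ?thesis
      by (rule l2_pointwise_limit(2)[rotated]) (auto intro!: tendsto_intros lim)
  qed
  show "l2_has_sum V g ?x A"
    unfolding l2_has_sum_def
  proof (rule Lim_null_comparison)
    have "((\<lambda>F. sum ?n F) \<longlongrightarrow> infsum ?n A) (finite_subsets_at_top A)"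
      using has_sum_infsum[OF s] by (simp add: has_sum_def)
    then show "((\<lambda>F. infsum ?n A - sum ?n F) \<longlongrightarrow> 0) (finite_subsets_at_top A)"
      using tendsto_diff[OF tendsto_const, of "sum ?n" "infsum ?n A" _ "infsum ?n A"] by simp
    show "\<forall>\<^sub>F F in finite_subsets_at_top A.
        norm (l2norm V (\<lambda>v. (\<Sum>a\<in>F. g a v) - ?x v)) \<le> infsum ?n A - sum ?n F"
      using finA by eventually_elim (simp add: tail)
  qed
qed

text \<open>Continuity of the inner product in its first argument. Identities between vector series
  are later verified through it, against an arbitrary test vector.\<close>

lemma l2_has_sum_inner:
  assumes sum: "l2_has_sum V g x A" and g: "\<And>a. a \<in> A \<Longrightarrow> g a \<in> l2 V" and x: "x \<in> l2 V" and h: "h \<in> l2 V"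
  shows "((\<lambda>a. l2inner V (g a) h) has_sum l2inner V x h) A"
  unfolding has_sum_def
proof (rule LIM_zero_cancel, rule Lim_null_comparison)
  show "((\<lambda>F. l2norm V (\<lambda>v. (\<Sum>a\<in>F. g a v) - x v) * l2norm V h) \<longlongrightarrow> 0) (finite_subsets_at_top A)"
    using sum unfolding l2_has_sum_def by (rule tendsto_mult_left_zero)
  show "\<forall>\<^sub>F F in finite_subsets_at_top A. norm ((\<Sum>a\<in>F. l2inner V (g a) h) - l2inner V x h)
      \<le> l2norm V (\<lambda>v. (\<Sum>a\<in>F. g a v) - x v) * l2norm V h"
  proof (rule eventually_finite_subsets_at_top_weakI)
    fix F assume F: "finite F" "F \<subseteq> A"
    then have "(\<lambda>v. \<Sum>a\<in>F. g a v) \<in> l2 V"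
      using g by (intro l2_sum) auto
    moreover have "(\<Sum>a\<in>F. l2inner V (g a) h) = l2inner V (\<lambda>v. \<Sum>a\<in>F. g a v) h"
      by (rule l2inner_sum_left[symmetric]) (use F g h in auto)
    ultimately show "norm ((\<Sum>a\<in>F. l2inner V (g a) h) - l2inner V x h)
        \<le> l2norm V (\<lambda>v. (\<Sum>a\<in>F. g a v) - x v) * l2norm V h"
      using l2_Cauchy_Schwarz[OF l2_diff h] x h by (simp flip: l2inner_diff_left)
  qed
qed

lemmas l2_infsum_inner = l2_has_sum_inner[OF l2_has_sum_l2_infsum _ l2_infsum_in_l2]

subsection \<open>Bounded operators\<close>

lemma bounded_op_l2: "bounded_op V T \<Longrightarrow> f \<in> l2 V \<Longrightarrow> T f \<in> l2 V"
  by (simp add: bounded_op_def)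

lemma bounded_op_lincomb:
  "bounded_op V T \<Longrightarrow> f \<in> l2 V \<Longrightarrow> g \<in> l2 V \<Longrightarrow> T (\<lambda>v. a * f v + b * g v) = (\<lambda>v. a * T f v + b * T g v)"
  unfolding bounded_op_def by blast

lemma bounded_op_add: "bounded_op V T \<Longrightarrow> f \<in> l2 V \<Longrightarrow> g \<in> l2 V \<Longrightarrow> T (\<lambda>v. f v + g v) = (\<lambda>v. T f v + T g v)"
  using bounded_op_lincomb[of V T f g 1 1] by simp

lemma bounded_op_diff: "bounded_op V T \<Longrightarrow> f \<in> l2 V \<Longrightarrow> g \<in> l2 V \<Longrightarrow> T (\<lambda>v. f v - g v) = (\<lambda>v. T f v - T g v)"
  using bounded_op_lincomb[of V T f g 1 "-1"] by simp

lemma bounded_op_scale: "bounded_op V T \<Longrightarrow> f \<in> l2 V \<Longrightarrow> T (\<lambda>v. a * f v) = (\<lambda>v. a * T f v)"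
  using bounded_op_lincomb[of V T f f a 0] by simp

lemma bounded_op_zero: "bounded_op V T \<Longrightarrow> T (\<lambda>v. 0) = (\<lambda>v. 0)"
  using bounded_op_scale[of V T "\<lambda>v. 0" 0] by simp

lemma bounded_op_sum:
  "bounded_op V T \<Longrightarrow> (\<And>a. a \<in> A \<Longrightarrow> g a \<in> l2 V) \<Longrightarrow> T (\<lambda>v. \<Sum>a\<in>A. g a v) = (\<lambda>v. \<Sum>a\<in>A. T (g a) v)"
proof (induction A rule: infinite_finite_induct)
  case (insert x F)
  have "T (\<lambda>v. g x v + (\<Sum>a\<in>F. g a v)) = (\<lambda>v. T (g x) v + T (\<lambda>v. \<Sum>a\<in>F. g a v) v)"
    by (rule bounded_op_add) (use insert in \<open>auto intro: l2_sum\<close>)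
  with insert show ?case
    by simp
qed (auto simp: bounded_op_zero)

lemma bounded_op_bound:
  assumes "bounded_op V T"
  obtains C where "C > 0" "\<And>f. f \<in> l2 V \<Longrightarrow> l2norm V (T f) \<le> C * l2norm V f"
proof -
  obtain C where C: "\<And>f. f \<in> l2 V \<Longrightarrow> l2norm V (T f) \<le> C * l2norm V f"
    using assms unfolding bounded_op_def by blast
  have "l2norm V (T f) \<le> max C 1 * l2norm V f" if "f \<in> l2 V" for f
    by (rule order_trans[OF C[OF that]]) (simp add: mult_right_mono)
  then show ?thesis
    by (intro that[of "max C 1"]) auto
qed

lemma bounded_opI:
  assumes "\<And>f. f \<in> l2 V \<Longrightarrow> T f \<in> l2 V"
    and "\<And>f g a b. f \<in> l2 V \<Longrightarrow> g \<in> l2 V \<Longrightarrow> T (\<lambda>v. a * f v + b * g v) = (\<lambda>v. a * T f v + b * T g v)"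
    and "\<And>f. f \<in> l2 V \<Longrightarrow> l2norm V (T f) \<le> C * l2norm V f"
  shows "bounded_op V T"
  using assms unfolding bounded_op_def by blast

lemma bounded_op_id: "bounded_op V (\<lambda>f. f)"
  by (rule bounded_opI[where C = 1]) auto

lemma bounded_op_comp:
  assumes S: "bounded_op V S" and T: "bounded_op V T"
  shows "bounded_op V (S \<circ> T)"
proof -
  obtain C where C: "C > 0" "\<And>f. f \<in> l2 V \<Longrightarrow> l2norm V (S f) \<le> C * l2norm V f"
    using bounded_op_bound[OF S] by blast
  obtain D where D: "D > 0" "\<And>f. f \<in> l2 V \<Longrightarrow> l2norm V (T f) \<le> D * l2norm V f"
    using bounded_op_bound[OF T] by blast
  have "l2norm V ((S \<circ> T) f) \<le> (C * D) * l2norm V f" if "f \<in> l2 V" for f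
  proof -
    have "l2norm V (S (T f)) \<le> C * l2norm V (T f)"
      by (intro C bounded_op_l2[OF T] that)
    also have "\<dots> \<le> C * (D * l2norm V f)"
      using C D that by (intro mult_left_mono) auto
    finally show ?thesis by simp
  qed
  then show ?thesis
    by (rule bounded_opI[rotated 2])
      (auto simp: bounded_op_l2[OF S] bounded_op_l2[OF T] bounded_op_lincomb[OF S] bounded_op_lincomb[OF T])
qed

lemma bounded_op_funpow: "bounded_op V T \<Longrightarrow> bounded_op V (T ^^ n)"
  by (induction n) (auto simp: id_def bounded_op_id intro: bounded_op_comp)

text \<open>Two scalars are kept because two cases are needed: c = 1 gives I - zT, and c = 0 gives
  scalar multiples of T.\<close>

lemma bounded_op_minus_scale:
  assumes T: "bounded_op V T"
  shows "bounded_op V (\<lambda>f v. c * f v - d * T f v)"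
proof -
  obtain C where C: "C > 0" "\<And>f. f \<in> l2 V \<Longrightarrow> l2norm V (T f) \<le> C * l2norm V f"
    using bounded_op_bound[OF T] by blast
  have "l2norm V (\<lambda>v. c * f v - d * T f v) \<le> (cmod c + cmod d * C) * l2norm V f" if "f \<in> l2 V" for f
  proof -
    have "l2norm V (\<lambda>v. c * f v - d * T f v) \<le> cmod c * l2norm V f + cmod d * l2norm V (T f)"
      using l2norm_triangle_diff[OF l2_scale l2_scale, OF that bounded_op_l2[OF T that]]
      by (simp add: l2norm_scale)
    also have "\<dots> \<le> cmod c * l2norm V f + cmod d * (C * l2norm V f)"
      by (intro add_left_mono mult_left_mono C that) auto
    finally show ?thesis
      by (simp add: algebra_simps)
  qed
  then show ?thesis
    by (rule bounded_opI[rotated 2])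
      (auto simp: bounded_op_l2[OF T] bounded_op_lincomb[OF T] l2_scale l2_diff algebra_simps)
qed

text \<open>The adjoint is written down by its matrix, (A g)(v) = <g, T e_v>. Its bound comes from
  duality on finite sets; the adjoint identity holds for finitely supported f and extends by
  boundedness of T.\<close>

lemma adjoint_exists:
  assumes T: "bounded_op V T"
  shows "\<exists>A. bounded_op V A \<and> (\<forall>f\<in>l2 V. \<forall>g\<in>l2 V. l2inner V (T f) g = l2inner V f (A g))"
proof -
  obtain C where C: "C > 0" "\<And>f. f \<in> l2 V \<Longrightarrow> l2norm V (T f) \<le> C * l2norm V f"
    using bounded_op_bound[OF T] by blast
  define A where "A = (\<lambda>g v. if v \<in> V then l2inner V g (T (unit_vec v)) else 0)"
  have Tu: "T (unit_vec v) \<in> l2 V" if "v \<in> V" for v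
    using that by (intro bounded_op_l2[OF T] unit_vec_l2)
  have fin: "l2inner V (T (\<lambda>v. \<Sum>u\<in>F. c u * unit_vec u v)) g = (\<Sum>u\<in>F. c u * cnj (A g u))"
    if "F \<subseteq> V" "g \<in> l2 V" for F c g
  proof -
    have "T (\<lambda>v. \<Sum>u\<in>F. c u * unit_vec u v) = (\<lambda>v. \<Sum>u\<in>F. T (\<lambda>v. c u * unit_vec u v) v)"
      by (rule bounded_op_sum[OF T]) (use that in \<open>auto intro: l2_scale unit_vec_l2\<close>)
    also have "\<dots> = (\<lambda>v. \<Sum>u\<in>F. c u * T (unit_vec u) v)"
      using that by (intro ext sum.cong refl) (auto simp: bounded_op_scale[OF T] unit_vec_l2 subset_iff)
    finally show ?thesis
      using that Tu
      by (simp add: l2inner_sum_left l2inner_scale_left l2_scale subset_iff A_def l2inner_cnj)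
  qed
  have restr: "(\<Sum>u\<in>F. f u * unit_vec u v) = (if v \<in> F then f v else 0)" if "finite F" for F v and f :: "'a \<Rightarrow> complex"
    using that by (simp add: unit_vec_def if_distrib[of "\<lambda>x. f _ * x"] cong: if_cong)
  have Abd: "A g \<in> l2 V \<and> l2norm V (A g) \<le> C * l2norm V g" if g: "g \<in> l2 V" for g
  proof -
    have "L2_set (\<lambda>v. cmod (A g v)) F \<le> C * l2norm V g" if F: "finite F" "F \<subseteq> V" for F
    proof -
      \<comment> \<open>The test vector is A g cut down to F: pairing T ?h with g returns exactly
        ?N^2, while ?h has norm ?N, so one factor ?N cancels.\<close>
      let ?h = "\<lambda>v. \<Sum>u\<in>F. A g u * unit_vec u v"
      let ?N = "L2_set (\<lambda>v. cmod (A g v)) F"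
      have h: "?h \<in> l2 V"
        by (intro l2_sum l2_scale unit_vec_l2) (use F in auto)
      have N2: "?N\<^sup>2 = (\<Sum>u\<in>F. (cmod (A g u))\<^sup>2)"
        by (simp add: L2_set_def sum_nonneg)
      have "(l2norm V ?h)\<^sup>2 = infsum (\<lambda>v. (cmod (if v \<in> F then A g v else 0))\<^sup>2) V"
        by (simp add: l2norm_power2 restr F)
      also have "\<dots> = infsum (\<lambda>v. (cmod (A g v))\<^sup>2) F"
        by (rule infsum_cong_neutral) (use F in auto)
      finally have "(l2norm V ?h)\<^sup>2 = ?N\<^sup>2"
        using F N2 by simp
      then have hN: "l2norm V ?h = ?N"
        by (simp add: L2_set_nonneg)
      have "complex_of_real (?N\<^sup>2) = (\<Sum>u\<in>F. A g u * cnj (A g u))"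
        unfolding N2 of_real_sum by (intro sum.cong refl complex_norm_square)
      also have "\<dots> = l2inner V (T ?h) g"
        by (rule fin[symmetric]) (use F g in auto)
      finally have "?N\<^sup>2 = cmod (l2inner V (T ?h) g)"
        by (metis norm_of_real abs_of_nonneg zero_le_power2)
      also have "\<dots> \<le> l2norm V (T ?h) * l2norm V g"
        by (intro l2_Cauchy_Schwarz bounded_op_l2[OF T] h g)
      also have "\<dots> \<le> (C * ?N) * l2norm V g"
        using C(2)[OF h] hN by (intro mult_right_mono) auto
      finally have "?N * ?N \<le> ?N * (C * l2norm V g)"
        by (simp add: power2_eq_square mult_ac)
      then show ?thesis
        using C(1) L2_set_nonneg[of "\<lambda>v. cmod (A g v)" F]
        by (cases "?N = 0") (auto simp: mult_le_cancel_left)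
    qed
    then show ?thesis
      using l2_boundI[of V "A g" "C * l2norm V g"] C(1) by (simp add: A_def)
  qed
  have "bounded_op V A"
  proof (rule bounded_opI)
    fix f g a b assume "f \<in> l2 V" "g \<in> l2 V"
    then show "A (\<lambda>v. a * f v + b * g v) = (\<lambda>v. a * A f v + b * A g v)"
      by (auto simp: A_def fun_eq_iff l2inner_add_left l2_scale Tu l2inner_scale_left)
  qed (use Abd in auto)
  moreover have "l2inner V (T f) g = l2inner V f (A g)" if f: "f \<in> l2 V" and g: "g \<in> l2 V" for f g
  proof -
    let ?t = "\<lambda>F v. if v \<in> F then f v else 0"
    have "((\<lambda>F. \<Sum>u\<in>F. f u * cnj (A g u)) \<longlongrightarrow> l2inner V f (A g)) (finite_subsets_at_top V)"
      unfolding l2inner_def has_sum_def[symmetric]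
      by (intro has_sum_infsum abs_summable_summable[OF l2inner_summable] f) (use Abd g in auto)
    moreover have "((\<lambda>F. \<Sum>u\<in>F. f u * cnj (A g u)) \<longlongrightarrow> l2inner V (T f) g) (finite_subsets_at_top V)"
    proof (rule LIM_zero_cancel, rule Lim_null_comparison)
      \<comment> \<open>The norm of f off F is the square root of the remainder of its norm series;
        this is the quantity that controls the error of replacing f by its restriction to F.\<close>
      have "((\<lambda>F. \<Sum>v\<in>F. (cmod (f v))\<^sup>2) \<longlongrightarrow> (l2norm V f)\<^sup>2) (finite_subsets_at_top V)"
        unfolding l2norm_power2 has_sum_def[symmetric]
        by (rule has_sum_infsum[OF l2_summable[OF f]])
      from tendsto_diff[OF tendsto_const this, of "(l2norm V f)\<^sup>2"]
      have "((\<lambda>F. (l2norm V f)\<^sup>2 - (\<Sum>v\<in>F. (cmod (f v))\<^sup>2)) \<longlongrightarrow> 0) (finite_subsets_at_top V)"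
        by simp
      from tendsto_real_sqrt[OF this]
      have "((\<lambda>F. sqrt ((l2norm V f)\<^sup>2 - (\<Sum>v\<in>F. (cmod (f v))\<^sup>2))) \<longlongrightarrow> 0) (finite_subsets_at_top V)"
        by simp
      then show "((\<lambda>F. C * sqrt ((l2norm V f)\<^sup>2 - (\<Sum>v\<in>F. (cmod (f v))\<^sup>2)) * l2norm V g) \<longlongrightarrow> 0) (finite_subsets_at_top V)"
        by (intro tendsto_mult_left_zero tendsto_mult_right_zero)
      show "\<forall>\<^sub>F F in finite_subsets_at_top V. norm ((\<Sum>u\<in>F. f u * cnj (A g u)) - l2inner V (T f) g)
          \<le> C * sqrt ((l2norm V f)\<^sup>2 - (\<Sum>v\<in>F. (cmod (f v))\<^sup>2)) * l2norm V g"
      proof (rule eventually_finite_subsets_at_top_weakI)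
        fix F assume F: "finite F" "F \<subseteq> V"
        have t: "?t F = (\<lambda>v. \<Sum>u\<in>F. f u * unit_vec u v)"
          using F by (simp add: restr)
        have tl2: "?t F \<in> l2 V"
          unfolding t by (intro l2_sum l2_scale unit_vec_l2) (use F in auto)
        let ?r = "\<lambda>v. f v - ?t F v"
        have rl2: "?r \<in> l2 V"
          by (intro l2_diff f tl2)
        have "(l2norm V ?r)\<^sup>2 = infsum (\<lambda>v. (cmod (f v))\<^sup>2) (V - F)"
          unfolding l2norm_power2 by (rule infsum_cong_neutral) auto
        also have "\<dots> = infsum (\<lambda>v. (cmod (f v))\<^sup>2) V - infsum (\<lambda>v. (cmod (f v))\<^sup>2) F"
          by (rule infsum_Diff) (use F in \<open>auto simp: l2_summable f\<close>)
        finally have "(l2norm V ?r)\<^sup>2 = (l2norm V f)\<^sup>2 - (\<Sum>v\<in>F. (cmod (f v))\<^sup>2)"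
          by (simp add: l2norm_power2 F)
        then have r: "l2norm V ?r = sqrt ((l2norm V f)\<^sup>2 - (\<Sum>v\<in>F. (cmod (f v))\<^sup>2))"
          by (metis l2norm_nonneg real_sqrt_unique)
        have "(\<Sum>u\<in>F. f u * cnj (A g u)) = l2inner V (T (?t F)) g"
          unfolding t by (rule fin[symmetric]) (use F g in auto)
        then have "norm ((\<Sum>u\<in>F. f u * cnj (A g u)) - l2inner V (T f) g) = norm (l2inner V (T ?r) g)"
          using f g tl2 by (simp add: bounded_op_diff[OF T] l2inner_diff_left bounded_op_l2[OF T] norm_minus_commute)
        also have "\<dots> \<le> l2norm V (T ?r) * l2norm V g"
          by (intro l2_Cauchy_Schwarz bounded_op_l2[OF T] rl2 g)
        also have "\<dots> \<le> C * l2norm V ?r * l2norm V g"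
          by (intro mult_right_mono C rl2) auto
        finally show "norm ((\<Sum>u\<in>F. f u * cnj (A g u)) - l2inner V (T f) g)
          \<le> C * sqrt ((l2norm V f)\<^sup>2 - (\<Sum>v\<in>F. (cmod (f v))\<^sup>2)) * l2norm V g"
          unfolding r .
      qed
    qed
    ultimately show ?thesis
      using tendsto_unique[OF finite_subsets_at_top_neq_bot] by blast
  qed
  ultimately show ?thesis by blast
qed

lemma
  assumes "bounded_op V T"
  shows bounded_op_adjoint: "bounded_op V (adjoint V T)"
    and adjoint_inner: "f \<in> l2 V \<Longrightarrow> g \<in> l2 V \<Longrightarrow> l2inner V f (adjoint V T g) = l2inner V (T f) g"
  using someI_ex[OF adjoint_exists[OF assms]] unfolding adjoint_def by auto

lemma adjoint_inner':
  assumes "bounded_op V T" "f \<in> l2 V" "g \<in> l2 V"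
  shows "l2inner V (adjoint V T g) f = l2inner V g (T f)"
  using adjoint_inner[OF assms] by (metis l2inner_cnj)

lemma
  assumes "invertible_op V T"
  shows bounded_op_inverse: "bounded_op V (inverse_op V T)"
    and inverse_op_left: "f \<in> l2 V \<Longrightarrow> inverse_op V T (T f) = f"
    and inverse_op_right: "f \<in> l2 V \<Longrightarrow> T (inverse_op V T f) = f"
proof -
  have "\<exists>B. bounded_op V B \<and> (\<forall>f\<in>l2 V. B (T f) = f \<and> T (B f) = f)"
    using assms by (simp add: invertible_op_def)
  from someI_ex[OF this]
  show "bounded_op V (inverse_op V T)" "f \<in> l2 V \<Longrightarrow> inverse_op V T (T f) = f"
    "f \<in> l2 V \<Longrightarrow> T (inverse_op V T f) = f"
    unfolding inverse_op_def by auto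
qed

subsection \<open>Orthogonal projections\<close>

definition l2_subspace :: "'v set \<Rightarrow> ('v \<Rightarrow> complex) set \<Rightarrow> bool" where
  "l2_subspace V M \<longleftrightarrow> M \<subseteq> l2 V \<and> (\<lambda>v. 0) \<in> M
     \<and> (\<forall>f\<in>M. \<forall>g\<in>M. \<forall>a b. (\<lambda>v. a * f v + b * g v) \<in> M)
     \<and> (\<forall>X x. (\<forall>n::nat. X n \<in> M) \<longrightarrow> x \<in> l2 V \<longrightarrow> (\<lambda>n. l2norm V (\<lambda>v. X n v - x v)) \<longlonglongrightarrow> 0 \<longrightarrow> x \<in> M)"

lemma l2_parallelogram:
  assumes "f \<in> l2 V" "g \<in> l2 V"
  shows "(l2norm V (\<lambda>v. f v + g v))\<^sup>2 + (l2norm V (\<lambda>v. f v - g v))\<^sup>2 = 2 * (l2norm V f)\<^sup>2 + 2 * (l2norm V g)\<^sup>2"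
proof -
  have "complex_of_real ((l2norm V (\<lambda>v. f v + g v))\<^sup>2 + (l2norm V (\<lambda>v. f v - g v))\<^sup>2)
      = complex_of_real (2 * (l2norm V f)\<^sup>2 + 2 * (l2norm V g)\<^sup>2)"
    unfolding of_real_add of_real_mult l2inner_self[OF assms(1), symmetric] l2inner_self[OF assms(2), symmetric]
      l2inner_self[OF l2_add[OF assms], symmetric] l2inner_self[OF l2_diff[OF assms], symmetric]
    using assms by (simp add: l2inner_add_left l2inner_add_right l2inner_diff_left l2inner_diff_right l2_add l2_diff)
  then show ?thesis
    using of_real_eq_iff by blast
qed

lemma l2_orthogonalI:
  assumes q: "q \<in> l2 V" and g: "g \<in> l2 V"
    and min: "\<And>c. l2norm V q \<le> l2norm V (\<lambda>v. q v - c * g v)"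
  shows "l2inner V q g = 0"
proof (cases "l2norm V g = 0")
  case True
  then show ?thesis
    using l2_Cauchy_Schwarz[OF q g] by simp
next
  case False
  define n where "n = (l2norm V g)\<^sup>2"
  have n: "n > 0"
    using False by (simp add: n_def)
  define i where "i = l2inner V q g"
  \<comment> \<open>The coefficient of the projection of q onto g. Subtracting c g lowers the
    squared norm by |i|^2 / n, so minimality forces i = 0.\<close>
  define c where "c = i / n"
  have "(l2norm V q)\<^sup>2 \<le> (l2norm V (\<lambda>v. q v - c * g v))\<^sup>2"
    by (intro power_mono min) simp
  moreover have "complex_of_real ((l2norm V (\<lambda>v. q v - c * g v))\<^sup>2)
      = of_real ((l2norm V q)\<^sup>2) - cnj c * i - c * cnj i + c * cnj c * of_real n"
    unfolding n_def i_def l2inner_self[OF q, symmetric] l2inner_self[OF g, symmetric] l2inner_cnj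
      l2inner_self[OF l2_diff[OF q l2_scale[OF g]], symmetric]
    using q g by (simp add: l2inner_diff_left l2inner_diff_right l2_diff l2_scale l2inner_scale_left
        l2inner_scale_right algebra_simps)
  moreover have "cnj c * i = of_real ((cmod i)\<^sup>2 / n)" "c * cnj i = of_real ((cmod i)\<^sup>2 / n)"
      "c * cnj c * of_real n = of_real ((cmod i)\<^sup>2 / n)"
    using n by (simp_all add: c_def complex_norm_square power2_eq_square field_simps flip: of_real_mult)
      (simp_all add: complex_norm_square[symmetric] field_simps flip: power2_eq_square of_real_power)
  ultimately have "complex_of_real ((l2norm V (\<lambda>v. q v - c * g v))\<^sup>2) = of_real ((l2norm V q)\<^sup>2 - (cmod i)\<^sup>2 / n)"
    by simp
  then have "(l2norm V (\<lambda>v. q v - c * g v))\<^sup>2 = (l2norm V q)\<^sup>2 - (cmod i)\<^sup>2 / n"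
    using of_real_eq_iff by blast
  with \<open>(l2norm V q)\<^sup>2 \<le> _\<close> have "(cmod i)\<^sup>2 / n \<le> 0"
    by simp
  then have "i = 0"
    using n by (simp add: divide_le_0_iff)
  then show ?thesis
    by (simp add: i_def)
qed

text \<open>The classical minimizing sequence: the parallelogram law makes it Cauchy, completeness
  gives a limit and closedness of M keeps the limit in M.\<close>

lemma l2_projection_exists:
  assumes M: "l2_subspace V M" and f: "f \<in> l2 V"
  shows "\<exists>p\<in>M. \<forall>g\<in>M. l2inner V (\<lambda>v. f v - p v) g = 0"
proof -
  have Ml2: "\<And>g. g \<in> M \<Longrightarrow> g \<in> l2 V" and M0: "(\<lambda>v. 0) \<in> M"
    and Mlin: "\<And>f g a b. f \<in> M \<Longrightarrow> g \<in> M \<Longrightarrow> (\<lambda>v. a * f v + b * g v) \<in> M"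
    and Mcl: "\<And>X x. (\<And>n::nat. X n \<in> M) \<Longrightarrow> x \<in> l2 V \<Longrightarrow> (\<lambda>n. l2norm V (\<lambda>v. X n v - x v)) \<longlonglongrightarrow> 0 \<Longrightarrow> x \<in> M"
    using M unfolding l2_subspace_def by blast+
  let ?d = "\<lambda>g. l2norm V (\<lambda>v. f v - g v)"
  define \<delta> where "\<delta> = Inf (?d ` M)"
  have bb: "bdd_below (?d ` M)"
    by (auto intro: bdd_belowI[of _ 0])
  have \<delta>_le: "\<delta> \<le> ?d g" if "g \<in> M" for g
    unfolding \<delta>_def by (rule cINF_lower[OF bb that])
  have \<delta>0: "0 \<le> \<delta>"
    unfolding \<delta>_def by (rule cINF_greatest) (use M0 in auto)
  have "\<exists>g\<in>M. (?d g)\<^sup>2 < \<delta>\<^sup>2 + 1 / (real n + 1)" for n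
  proof -
    have "\<delta>\<^sup>2 < \<delta>\<^sup>2 + 1 / (real n + 1)"
      by simp
    then have "\<delta> < sqrt (\<delta>\<^sup>2 + 1 / (real n + 1))"
      using \<delta>0 real_less_rsqrt by blast
    then have "Inf (?d ` M) < sqrt (\<delta>\<^sup>2 + 1 / (real n + 1))"
      by (simp add: \<delta>_def)
    moreover have "?d ` M \<noteq> {}"
      using M0 by blast
    ultimately obtain g where "g \<in> M" "?d g < sqrt (\<delta>\<^sup>2 + 1 / (real n + 1))"
      using cInf_lessD[of "?d ` M" "sqrt (\<delta>\<^sup>2 + 1 / (real n + 1))"] by blast
    then have "(?d g)\<^sup>2 < (sqrt (\<delta>\<^sup>2 + 1 / (real n + 1)))\<^sup>2"
      by (intro power_strict_mono) auto
    with \<open>g \<in> M\<close> show ?thesis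
      by auto
  qed
  then obtain X where XM: "\<And>n. X n \<in> M" and X: "\<And>n. (?d (X n))\<^sup>2 < \<delta>\<^sup>2 + 1 / (real n + 1)"
    by metis
  have close: "(l2norm V (\<lambda>v. X m v - X n v))\<^sup>2 \<le> 2 / (real m + 1) + 2 / (real n + 1)" for m n
  proof -
    have fm: "(\<lambda>v. f v - X n v) \<in> l2 V" for n
      by (intro l2_diff f Ml2 XM)
    \<comment> \<open>The midpoint of X n and X m lies in M, so its distance from f is at least
      \<delta>. In the parallelogram law this leaves only the errors 1/(n+1) and 1/(m+1), each
      doubled.\<close>
    have mid: "(\<lambda>v. (1/2) * X n v + (1/2) * X m v) \<in> M"
      by (intro Mlin XM)
    have "(\<lambda>v. (f v - X n v) + (f v - X m v)) = (\<lambda>v. 2 * (f v - ((1/2) * X n v + (1/2) * X m v)))"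
      by (auto simp: algebra_simps)
    then have "l2norm V (\<lambda>v. (f v - X n v) + (f v - X m v)) = 2 * ?d (\<lambda>v. (1/2) * X n v + (1/2) * X m v)"
      by (simp only: l2norm_scale) simp
    moreover have "\<delta>\<^sup>2 \<le> (?d (\<lambda>v. (1/2) * X n v + (1/2) * X m v))\<^sup>2"
      by (intro power_mono \<delta>_le mid \<delta>0)
    ultimately have "4 * \<delta>\<^sup>2 \<le> (l2norm V (\<lambda>v. (f v - X n v) + (f v - X m v)))\<^sup>2"
      by (simp add: power_mult_distrib)
    moreover have "(\<lambda>v. (f v - X n v) - (f v - X m v)) = (\<lambda>v. X m v - X n v)"
      by auto
    ultimately show ?thesis
      using l2_parallelogram[OF fm[of n] fm[of m]] X[of n] X[of m] by simp
  qed
  have "\<exists>N. \<forall>m\<ge>N. \<forall>n\<ge>N. l2norm V (\<lambda>v. X m v - X n v) < \<epsilon>" if "\<epsilon> > 0" for \<epsilon>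
  proof -
    obtain N where N: "4 / \<epsilon>\<^sup>2 < real N"
      using reals_Archimedean2 by blast
    have "l2norm V (\<lambda>v. X m v - X n v) < \<epsilon>" if mn: "m \<ge> N" "n \<ge> N" for m n
    proof (rule power_less_imp_less_base)
      have "2 / (real m + 1) \<le> 2 / (real N + 1)" "2 / (real n + 1) \<le> 2 / (real N + 1)"
        using mn by (intro divide_left_mono; simp)+
      then have "2 / (real m + 1) + 2 / (real n + 1) \<le> 4 / (real N + 1)"
        by simp
      also have "4 < \<epsilon>\<^sup>2 * (real N + 1)"
        using N \<open>\<epsilon> > 0\<close> by (simp add: field_simps) (smt (verit) zero_less_power)
      then have "4 / (real N + 1) < \<epsilon>\<^sup>2"
        by (simp add: field_simps)
      finally show "(l2norm V (\<lambda>v. X m v - X n v))\<^sup>2 < \<epsilon>\<^sup>2"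
        using close[of m n] by linarith
    qed (use \<open>\<epsilon> > 0\<close> in auto)
    then show ?thesis by blast
  qed
  then obtain p where p: "p \<in> l2 V" and lim: "(\<lambda>n. l2norm V (\<lambda>v. X n v - p v)) \<longlonglongrightarrow> 0"
    using l2_complete[of X V] XM Ml2 by blast
  have pM: "p \<in> M"
    by (rule Mcl[OF XM p lim])
  have "?d p \<le> \<delta>"
  proof (rule LIMSEQ_le_const[of "\<lambda>n. sqrt (\<delta>\<^sup>2 + 1 / (real n + 1)) + l2norm V (\<lambda>v. X n v - p v)"])
    have "(\<lambda>n. 1 / (real n + 1)) \<longlonglongrightarrow> 0"
      using LIMSEQ_inverse_real_of_nat by (simp add: inverse_eq_divide add.commute)
    then have "(\<lambda>n. sqrt (\<delta>\<^sup>2 + 1 / (real n + 1)) + l2norm V (\<lambda>v. X n v - p v)) \<longlonglongrightarrow> sqrt (\<delta>\<^sup>2 + 0) + 0"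
      by (intro tendsto_intros lim)
    then show "(\<lambda>n. sqrt (\<delta>\<^sup>2 + 1 / (real n + 1)) + l2norm V (\<lambda>v. X n v - p v)) \<longlonglongrightarrow> \<delta>"
      using \<delta>0 by simp
    have "?d p \<le> sqrt (\<delta>\<^sup>2 + 1 / (real n + 1)) + l2norm V (\<lambda>v. X n v - p v)" for n
    proof -
      have "?d p \<le> ?d (X n) + l2norm V (\<lambda>v. X n v - p v)"
        using l2norm_triangle[OF l2_diff[OF f Ml2[OF XM[of n]]] l2_diff[OF Ml2[OF XM[of n]] p]] by simp
      moreover have "?d (X n) \<le> sqrt (\<delta>\<^sup>2 + 1 / (real n + 1))"
        using X[of n] by (intro real_le_rsqrt) simp
      ultimately show ?thesis by simp
    qed
    then show "\<exists>N. \<forall>n\<ge>N. ?d p \<le> sqrt (\<delta>\<^sup>2 + 1 / (real n + 1)) + l2norm V (\<lambda>v. X n v - p v)"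
      by blast
  qed
  have "l2inner V (\<lambda>v. f v - p v) g = 0" if g: "g \<in> M" for g
  proof (rule l2_orthogonalI)
    fix c
    have "(\<lambda>v. 1 * p v + c * g v) \<in> M"
      by (intro Mlin pM g)
    from \<delta>_le[OF this] \<open>?d p \<le> \<delta>\<close>
    show "?d p \<le> l2norm V (\<lambda>v. (f v - p v) - c * g v)"
      by (simp add: algebra_simps)
  qed (use f p g Ml2 l2_diff in auto)
  with pM show ?thesis by blast
qed

text \<open>\<open>orth_proj\<close> is a definite description, so uniqueness has to accompany
  existence: the difference of two candidates lies in M and is orthogonal to itself.\<close>

lemma
  assumes M: "l2_subspace V M" and f: "f \<in> l2 V"
  shows orth_proj_in: "orth_proj V M f \<in> M"
    and orth_proj_inner: "g \<in> M \<Longrightarrow> l2inner V (orth_proj V M f) g = l2inner V f g"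
proof -
  have Ml2: "\<And>g. g \<in> M \<Longrightarrow> g \<in> l2 V"
    and Mlin: "\<And>f g a b. f \<in> M \<Longrightarrow> g \<in> M \<Longrightarrow> (\<lambda>v. a * f v + b * g v) \<in> M"
    using M unfolding l2_subspace_def by blast+
  have "\<exists>!p. p \<in> M \<and> (\<forall>g\<in>M. l2inner V (\<lambda>v. f v - p v) g = 0)"
  proof (rule ex_ex1I)
    show "\<exists>p. p \<in> M \<and> (\<forall>g\<in>M. l2inner V (\<lambda>v. f v - p v) g = 0)"
      using l2_projection_exists[OF M f] by blast
    fix p q
    assume p: "p \<in> M \<and> (\<forall>g\<in>M. l2inner V (\<lambda>v. f v - p v) g = 0)"
      and q: "q \<in> M \<and> (\<forall>g\<in>M. l2inner V (\<lambda>v. f v - q v) g = 0)"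
    let ?r = "\<lambda>v. p v - q v"
    have r: "?r \<in> M"
      using Mlin[of p q 1 "-1"] p q by simp
    have "l2inner V ?r ?r = l2inner V (\<lambda>v. (f v - q v) - (f v - p v)) ?r"
      by simp
    also have "\<dots> = l2inner V (\<lambda>v. f v - q v) ?r - l2inner V (\<lambda>v. f v - p v) ?r"
      by (rule l2inner_diff_left) (use p q r f Ml2 l2_diff in blast)+
    also have "\<dots> = 0"
      using p q r by simp
    finally have "?r = (\<lambda>v. 0)"
      using l2inner_self_eq_0_iff[OF Ml2[OF r]] by blast
    then show "p = q"
      by (simp add: fun_eq_iff)
  qed
  from theI'[OF this] have P: "orth_proj V M f \<in> M"
    "\<And>g. g \<in> M \<Longrightarrow> l2inner V (\<lambda>v. f v - orth_proj V M f v) g = 0"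
    unfolding orth_proj_def by blast+
  show "orth_proj V M f \<in> M"
    by (rule P)
  show "l2inner V (orth_proj V M f) g = l2inner V f g" if "g \<in> M"
    using P(2)[OF that] by (simp add: l2inner_diff_left f Ml2 that P(1))
qed

lemma l2_subspace_op_kernel:
  assumes T: "bounded_op V T"
  shows "l2_subspace V (op_kernel V T)"
  unfolding l2_subspace_def
proof (intro conjI allI ballI impI)
  fix X x assume X: "\<forall>n::nat. X n \<in> op_kernel V T" and x: "x \<in> l2 V"
    and lim: "(\<lambda>n. l2norm V (\<lambda>v. X n v - x v)) \<longlonglongrightarrow> 0"
  obtain C where C: "C > 0" "\<And>f. f \<in> l2 V \<Longrightarrow> l2norm V (T f) \<le> C * l2norm V f"
    using bounded_op_bound[OF T] by blast
  have "l2norm V (T x) \<le> C * l2norm V (\<lambda>v. X n v - x v)" for n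
  proof -
    have Xn: "X n \<in> l2 V" "T (X n) = (\<lambda>v. 0)"
      using X by (auto simp: op_kernel_def)
    then have "l2norm V (T (\<lambda>v. X n v - x v)) = l2norm V (T x)"
      by (simp add: bounded_op_diff[OF T] x l2norm_uminus)
    then show ?thesis
      using C(2)[OF l2_diff[OF Xn(1) x]] by simp
  qed
  moreover have "(\<lambda>n. C * l2norm V (\<lambda>v. X n v - x v)) \<longlonglongrightarrow> C * 0"
    by (intro tendsto_intros lim)
  ultimately have "l2norm V (T x) \<le> 0"
    using LIMSEQ_le_const[of _ 0 "l2norm V (T x)"] by simp
  then have "T x = (\<lambda>v. 0)"
    using l2norm_eq_0_iff[OF bounded_op_l2[OF T x]] l2norm_nonneg[of V "T x"] by simp
  then show "x \<in> op_kernel V T"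
    using x by (simp add: op_kernel_def)
qed (auto simp: op_kernel_def bounded_op_zero[OF T] bounded_op_lincomb[OF T] l2_lincomb)

lemma l2_subspace_INT:
  assumes "\<And>j. l2_subspace V (M j)"
  shows "l2_subspace V (\<Inter>j. M j)"
proof -
  have M: "M j \<subseteq> l2 V" "(\<lambda>v. 0) \<in> M j"
    "\<And>f g a b. f \<in> M j \<Longrightarrow> g \<in> M j \<Longrightarrow> (\<lambda>v. a * f v + b * g v) \<in> M j"
    "\<And>X x. (\<And>n::nat. X n \<in> M j) \<Longrightarrow> x \<in> l2 V \<Longrightarrow> (\<lambda>n. l2norm V (\<lambda>v. X n v - x v)) \<longlonglongrightarrow> 0 \<Longrightarrow> x \<in> M j" for j
    using assms[of j] unfolding l2_subspace_def by blast+
  show ?thesis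
    unfolding l2_subspace_def
  proof (intro conjI allI ballI impI INT_I)
    show "(\<Inter>j. M j) \<subseteq> l2 V"
      using M(1) by blast
  next
    fix X x j assume "\<forall>n::nat. X n \<in> (\<Inter>j. M j)" "x \<in> l2 V" "(\<lambda>n. l2norm V (\<lambda>v. X n v - x v)) \<longlonglongrightarrow> 0"
    then show "x \<in> M j"
      by (rule_tac M(4)[of X]) auto
  qed (use M(2,3) in auto)
qed

text \<open>Tested against h, the adjoint moves T onto h, and continuity of the inner product
  finishes the exchange.\<close>

lemma bounded_op_l2_infsum:
  assumes T: "bounded_op V T" and g: "\<And>a. a \<in> A \<Longrightarrow> g a \<in> l2 V" and s: "(\<lambda>a. l2norm V (g a)) summable_on A"
  shows "(\<lambda>a. l2norm V (T (g a))) summable_on A" and "T (l2_infsum g A) = l2_infsum (\<lambda>a. T (g a)) A"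
proof -
  obtain C where C: "C > 0" "\<And>f. f \<in> l2 V \<Longrightarrow> l2norm V (T f) \<le> C * l2norm V f"
    using bounded_op_bound[OF T] by blast
  show s': "(\<lambda>a. l2norm V (T (g a))) summable_on A"
    by (rule summable_on_comparison_test[OF summable_on_cmult_right[OF s, of C]]) (auto intro: C g)
  have Tg: "\<And>a. a \<in> A \<Longrightarrow> T (g a) \<in> l2 V"
    by (intro bounded_op_l2[OF T] g)
  show "T (l2_infsum g A) = l2_infsum (\<lambda>a. T (g a)) A"
  proof (rule l2_eqI)
    fix h assume h: "h \<in> l2 V"
    have e: "l2inner V (l2_infsum g A) (adjoint V T h) = l2inner V (T (l2_infsum g A)) h"
      by (rule adjoint_inner[OF T _ h], rule l2_infsum_in_l2) (use g s in auto)
    have "((\<lambda>a. l2inner V (g a) (adjoint V T h)) has_sum l2inner V (l2_infsum g A) (adjoint V T h)) A"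
      by (rule l2_infsum_inner) (use g s h bounded_op_l2[OF bounded_op_adjoint[OF T]] in auto)
    also have "?this \<longleftrightarrow> ((\<lambda>a. l2inner V (T (g a)) h) has_sum l2inner V (T (l2_infsum g A)) h) A"
      unfolding e by (rule has_sum_cong) (rule adjoint_inner[OF T g h])
    finally have "((\<lambda>a. l2inner V (T (g a)) h) has_sum l2inner V (T (l2_infsum g A)) h) A" .
    moreover have "((\<lambda>a. l2inner V (T (g a)) h) has_sum l2inner V (l2_infsum (\<lambda>a. T (g a)) A) h) A"
      by (rule l2_infsum_inner) (use Tg s' h in auto)
    ultimately show "l2inner V (T (l2_infsum g A)) h = l2inner V (l2_infsum (\<lambda>a. T (g a)) A) h"
      by (rule has_sum_unique)
  qed (use l2_infsum_in_l2[OF Tg s'] l2_infsum_in_l2[OF g s] bounded_op_l2[OF T] in auto)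
qed

lemma l2_infsum_has_sum:
  assumes g: "\<And>a. a \<in> A \<Longrightarrow> g a \<in> l2 V" and s: "(\<lambda>a. l2norm V (g a)) summable_on A"
  shows "((\<lambda>a. g a v) has_sum l2_infsum g A v) A"
proof -
  have "(\<lambda>a. norm (g a v)) summable_on A"
    by (rule summable_on_comparison_test[OF s]) (auto intro: cmod_le_l2norm g)
  then show ?thesis
    unfolding l2_infsum_def by (intro has_sum_infsum) (rule abs_summable_summable)
qed

subsection \<open>The spectral radius\<close>

lemma funpow_norm_le:
  assumes T: "bounded_op V T" and C: "0 \<le> C" "\<And>f. f \<in> l2 V \<Longrightarrow> l2norm V (T f) \<le> C * l2norm V f" and f: "f \<in> l2 V"
  shows "l2norm V ((T ^^ n) f) \<le> C ^ n * l2norm V f"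
proof (induction n)
  case (Suc n)
  have "l2norm V (T ((T ^^ n) f)) \<le> C * l2norm V ((T ^^ n) f)"
    by (intro C bounded_op_l2[OF bounded_op_funpow[OF T]] f)
  also have "\<dots> \<le> C * (C ^ n * l2norm V f)"
    by (intro mult_left_mono Suc C)
  finally show ?case
    by simp
qed simp

text \<open>The inverse is the Neumann series B f, the sum of z^n T^n f. The lemma is needed to
  bound the spectrum, so that the supremum defining the spectral radius is a genuine upper
  bound.\<close>

lemma invertible_Neumann:
  assumes T: "bounded_op V T" and C: "0 < C" "\<And>f. f \<in> l2 V \<Longrightarrow> l2norm V (T f) \<le> C * l2norm V f"
    and z: "cmod z * C < 1"
  shows "invertible_op V (\<lambda>f v. f v - z * T f v)"
proof -
  define q where "q = cmod z * C"
  have q: "0 \<le> q" "q < 1"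
    using C z by (auto simp: q_def)
  define t where "t = (\<lambda>f n v. z ^ n * (T ^^ n) f v)"
  have t: "t f n \<in> l2 V" "l2norm V (t f n) \<le> l2norm V f * q ^ n" if "f \<in> l2 V" for f n
  proof -
    show "t f n \<in> l2 V"
      unfolding t_def by (intro l2_scale bounded_op_l2[OF bounded_op_funpow[OF T]] that)
    have "l2norm V (t f n) = cmod z ^ n * l2norm V ((T ^^ n) f)"
      by (simp add: t_def l2norm_scale norm_power)
    also have "\<dots> \<le> cmod z ^ n * (C ^ n * l2norm V f)"
      using C by (intro mult_left_mono funpow_norm_le[OF T]) (auto simp: that)
    finally show "l2norm V (t f n) \<le> l2norm V f * q ^ n"
      by (simp add: q_def power_mult_distrib mult_ac)
  qed
  have "(\<lambda>n. q ^ n) sums (1 / (1 - q))"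
    using q by (intro geometric_sums) auto
  then have geo: "((\<lambda>n. q ^ n) has_sum (1 / (1 - q))) UNIV"
    by (intro sums_nonneg_imp_has_sum) (use q in auto)
  then have geo': "((\<lambda>n. l2norm V f * q ^ n) has_sum (l2norm V f * (1 / (1 - q)))) UNIV" for f
    by (rule has_sum_cmult_right)
  have s: "(\<lambda>n. l2norm V (t f n)) summable_on UNIV" if "f \<in> l2 V" for f
    by (rule summable_on_comparison_test[OF has_sum_imp_summable[OF geo'[of f]]]) (use t that in auto)
  define B where "B = (\<lambda>f. l2_infsum (t f) UNIV)"
  have B: "B f \<in> l2 V" if "f \<in> l2 V" for f
    unfolding B_def by (rule l2_infsum_in_l2) (use t s that in auto)
  have Bsum: "((\<lambda>n. t f n v) has_sum B f v) UNIV" if "f \<in> l2 V" for f v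
    unfolding B_def by (rule l2_infsum_has_sum) (use t s that in auto)
  have Bb: "bounded_op V B"
  proof (rule bounded_opI)
    fix f g a b assume f: "f \<in> l2 V" and g: "g \<in> l2 V"
    have "((\<lambda>n. a * t f n v + b * t g n v) has_sum (a * B f v + b * B g v)) UNIV" for v
      by (intro has_sum_add has_sum_cmult_right Bsum f g)
    moreover have "a * t f n v + b * t g n v = t (\<lambda>v. a * f v + b * g v) n v" for n v
      by (simp add: t_def bounded_op_lincomb[OF bounded_op_funpow[OF T] f g] algebra_simps)
    ultimately show "B (\<lambda>v. a * f v + b * g v) = (\<lambda>v. a * B f v + b * B g v)"
      using has_sum_unique[OF Bsum[OF l2_lincomb[OF f g, of a b]]] by (simp add: fun_eq_iff)
  next
    fix f assume f: "f \<in> l2 V"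
    have "l2norm V (B f) \<le> infsum (\<lambda>n. l2norm V (t f n)) UNIV"
      unfolding B_def by (rule l2norm_l2_infsum_le) (use t s f in auto)
    also have "\<dots> \<le> infsum (\<lambda>n. l2norm V f * q ^ n) UNIV"
      by (rule infsum_mono) (use s f has_sum_imp_summable[OF geo'] t in auto)
    also have "\<dots> = 1 / (1 - q) * l2norm V f"
      using infsumI[OF geo'[of f]] by simp
    finally show "l2norm V (B f) \<le> 1 / (1 - q) * l2norm V f" .
  qed (rule B)
  \<comment> \<open>Splitting off the term n = 0 shifts the series. By linearity of B this is the
    left inverse identity, and T B = B T turns it into the right one.\<close>
  have rec: "B f v = f v + z * B (T f) v" if f: "f \<in> l2 V" for f v
  proof -
    have Tf: "T f \<in> l2 V"
      by (rule bounded_op_l2[OF T f])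
    have "(\<lambda>n. z * t (T f) n v) sums (z * B (T f) v)"
      by (intro sums_mult has_sum_imp_sums Bsum Tf)
    moreover have "z * t (T f) n v = t f (Suc n) v" for n
      by (simp add: t_def funpow_swap1)
    ultimately have "(\<lambda>n. t f (Suc n) v) sums (z * B (T f) v)"
      by simp
    then have "(\<lambda>n. t f n v) sums (z * B (T f) v + t f 0 v)"
      by (rule sums_Suc)
    then show ?thesis
      using sums_unique2[OF has_sum_imp_sums[OF Bsum[OF f, of v]]] by (simp add: t_def)
  qed
  have TB: "T (B f) = B (T f)" if f: "f \<in> l2 V" for f
  proof -
    have "T (B f) = l2_infsum (\<lambda>n. T (t f n)) UNIV"
      unfolding B_def by (rule bounded_op_l2_infsum[OF T]) (use t s f in auto)
    also have "(\<lambda>n. T (t f n)) = t (T f)"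
      by (auto simp: t_def bounded_op_scale[OF T] bounded_op_l2[OF bounded_op_funpow[OF T] f] funpow_swap1)
    finally show ?thesis
      by (simp add: B_def)
  qed
  have "B (\<lambda>v. f v - z * T f v) = f" if f: "f \<in> l2 V" for f
  proof -
    have "B (\<lambda>v. f v - z * T f v) = (\<lambda>v. B f v - z * B (T f) v)"
      using bounded_op_lincomb[OF Bb f bounded_op_l2[OF T f], of 1 "-z"] by simp
    then show ?thesis
      by (simp add: rec[OF f])
  qed
  moreover have "(\<lambda>v. B f v - z * T (B f) v) = f" if f: "f \<in> l2 V" for f
    by (simp add: TB[OF f] rec[OF f])
  moreover have "bounded_op V (\<lambda>f v. f v - z * T f v)"
    using bounded_op_minus_scale[OF T, of 1 z] by simp
  ultimately show ?thesis
    unfolding invertible_op_def using Bb by blast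
qed

lemma invertible_op_scale:
  assumes "invertible_op V A" "c \<noteq> 0"
  shows "invertible_op V (\<lambda>f v. c * A f v)"
proof -
  obtain B where B: "bounded_op V B" "\<And>f. f \<in> l2 V \<Longrightarrow> B (A f) = f" "\<And>f. f \<in> l2 V \<Longrightarrow> A (B f) = f"
    and A: "bounded_op V A"
    using assms(1) unfolding invertible_op_def by blast
  have "bounded_op V (\<lambda>f v. d * T f v)" if "bounded_op V T" for d T
    using bounded_op_minus_scale[OF that, of 0 "-d"] by simp
  then show ?thesis
    unfolding invertible_op_def using A B \<open>c \<noteq> 0\<close>
    by (intro conjI exI[of _ "\<lambda>f v. inverse c * B f v"])
      (auto simp: bounded_op_scale[OF A] bounded_op_scale[OF B(1)] bounded_op_l2[OF A] bounded_op_l2[OF B(1)])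
qed

text \<open>Leibniz rule at 0 with the factor z: z vanishes there, its first derivative is 1 and all
  higher ones are 0, so only the term i = 1 survives.\<close>

lemma higher_deriv_const_plus_times:
  assumes g: "g holomorphic_on ball 0 R" and R: "R > 0"
    and f: "\<And>z. z \<in> ball 0 R \<Longrightarrow> f z = c + z * g z"
  shows "(deriv ^^ Suc n) f (0::complex) = of_nat (Suc n) * (deriv ^^ n) g 0"
proof -
  have 0: "(0::complex) \<in> ball 0 R"
    using R by simp
  have "(deriv ^^ Suc n) f 0 = (deriv ^^ Suc n) (\<lambda>z. c + z * g z) 0"
    by (rule higher_deriv_cong_ev) (use f eventually_nhds_in_open[OF open_ball 0] in \<open>auto elim!: eventually_mono\<close>)
  also have "\<dots> = (deriv ^^ Suc n) (\<lambda>z. c) 0 + (deriv ^^ Suc n) (\<lambda>z. z * g z) 0"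
    by (rule higher_deriv_add[OF _ _ open_ball 0]) (intro holomorphic_intros g)+
  also have "(deriv ^^ Suc n) (\<lambda>z. c) 0 = 0"
    by (simp only: higher_deriv_const) simp
  also have "(deriv ^^ Suc n) (\<lambda>z. z * g z) 0 =
      (\<Sum>i = 0..Suc n. of_nat (Suc n choose i) * (deriv ^^ i) (\<lambda>z. z) 0 * (deriv ^^ (Suc n - i)) g 0)"
    by (rule higher_deriv_mult[OF _ g open_ball 0]) (intro holomorphic_intros)
  also have "\<dots> = (\<Sum>i\<in>{1}. of_nat (Suc n choose i) * (deriv ^^ i) (\<lambda>z. z) 0 * (deriv ^^ (Suc n - i)) g 0)"
    by (rule sum.mono_neutral_right) (auto simp: higher_deriv_ident)
  finally show ?thesis
    by (simp add: higher_deriv_ident)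
qed

text \<open>Scalar complex analysis suffices: <(I - zT)^(-1) f, g> is holomorphic for |z| < R with
  n-th Taylor coefficient <T^n f, g>. The work lies in a bound for the resolvent that is uniform on
  the closed disc of radius \<rho>.\<close>

lemma funpow_bound_if_resolvent_exists:
  assumes T: "bounded_op V T"
    and inv: "\<And>z. cmod z < R \<Longrightarrow> invertible_op V (\<lambda>f v. f v - z * T f v)"
    and \<rho>: "0 < \<rho>" "\<rho> < R"
  shows "\<exists>M\<ge>0. \<forall>n. \<forall>f\<in>l2 V. l2norm V ((T ^^ n) f) * \<rho> ^ n \<le> M * l2norm V f"
proof -
  define B where "B = (\<lambda>z. inverse_op V (\<lambda>f v. f v - z * T f v))"
  have Bb: "bounded_op V (B z)" if "cmod z < R" for z
    unfolding B_def by (rule bounded_op_inverse[OF inv[OF that]])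
  have B1: "B z (\<lambda>v. f v - z * T f v) = f" if "cmod z < R" "f \<in> l2 V" for z f
    unfolding B_def by (rule inverse_op_left[OF inv[OF that(1)] that(2)])
  have B2: "(\<lambda>v. B z f v - z * T (B z f) v) = f" if "cmod z < R" "f \<in> l2 V" for z f
    unfolding B_def by (rule inverse_op_right[OF inv[OF that(1)] that(2)])
  have Tl: "T f \<in> l2 V" if "f \<in> l2 V" for f
    by (rule bounded_op_l2[OF T that])
  have Bl: "B z f \<in> l2 V" if "cmod z < R" "f \<in> l2 V" for z f
    by (rule bounded_op_l2[OF Bb that(2)]) (rule that)
  have Brec: "B z f = (\<lambda>v. f v + z * B z (T f) v)" if z: "cmod z < R" and f: "f \<in> l2 V" for z f
  proof -
    have "(\<lambda>v. B z f v - z * B z (T f) v) = f"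
      using bounded_op_lincomb[OF Bb[OF z] f Tl[OF f], of 1 "-z"] B1[OF z f] by simp
    then show ?thesis
      by (metis (no_types, lifting) ext diff_add_cancel)
  qed
  \<comment> \<open>The resolvent identity, with B w T outermost: this operator belongs to the fixed
    centre w, so its bound estimates the difference for all z nearby.\<close>
  have res: "B z f v - B w f v = (z - w) * B w (T (B z f)) v"
    if z: "cmod z < R" and w: "cmod w < R" and f: "f \<in> l2 V" for z w f v
  proof -
    let ?x = "B z f"
    have "(\<lambda>v. ?x v - w * T ?x v) = (\<lambda>v. 1 * f v + (z - w) * T ?x v)"
      by (subst (2) B2[OF z f, symmetric]) (simp add: algebra_simps)
    then have "?x = B w (\<lambda>v. 1 * f v + (z - w) * T ?x v)"
      using B1[OF w Bl[OF z f]] by simp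
    also have "\<dots> = (\<lambda>v. 1 * B w f v + (z - w) * B w (T ?x) v)"
      by (rule bounded_op_lincomb[OF Bb[OF w] f Tl[OF Bl[OF z f]]])
    finally have "?x v = 1 * B w f v + (z - w) * B w (T ?x) v"
      by (rule fun_cong)
    then show ?thesis by simp
  qed
  have resT: "\<exists>C>0. \<forall>f\<in>l2 V. l2norm V (B w (T f)) \<le> C * l2norm V f" if "cmod w < R" for w
    using bounded_op_bound[OF bounded_op_comp[OF Bb[OF that] T]] by (metis comp_apply)
  then obtain C where C: "\<And>w. cmod w < R \<Longrightarrow> C w > 0"
    "\<And>w f. cmod w < R \<Longrightarrow> f \<in> l2 V \<Longrightarrow> l2norm V (B w (T f)) \<le> C w * l2norm V f"
    by metis
  have diff: "l2norm V (\<lambda>v. B z f v - B w f v) \<le> cmod (z - w) * (C w * l2norm V (B z f))"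
    if "cmod z < R" "cmod w < R" "f \<in> l2 V" for z w f
    unfolding res[OF that] l2norm_scale by (intro mult_left_mono C Bl that) auto
  have "\<exists>N>0. \<forall>f\<in>l2 V. l2norm V (B w f) \<le> N * l2norm V f" if "cmod w < R" for w
    using bounded_op_bound[OF Bb[OF that]] by metis
  then obtain N where N: "\<And>w. cmod w < R \<Longrightarrow> N w > 0"
    "\<And>w f. cmod w < R \<Longrightarrow> f \<in> l2 V \<Longrightarrow> l2norm V (B w f) \<le> N w * l2norm V f"
    by metis
  \<comment> \<open>Within distance 1/(2 C w) of w the difference is at most half the norm of B z f,
    which is absorbed on the left; this costs the factor 2.\<close>
  have loc: "l2norm V (B z f) \<le> 2 * N w * l2norm V f"
    if z: "cmod z < R" and w: "cmod w < R" and zw: "dist w z < 1 / (2 * C w)" and f: "f \<in> l2 V" for z w f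
  proof -
    have "cmod (z - w) * C w \<le> 1 / 2"
      using zw C(1)[OF w] by (simp add: dist_norm norm_minus_commute field_simps)
    then have "cmod (z - w) * C w * l2norm V (B z f) \<le> 1 / 2 * l2norm V (B z f)"
      by (rule mult_right_mono) simp
    with diff[OF z w f] have "l2norm V (\<lambda>v. B z f v - B w f v) \<le> 1 / 2 * l2norm V (B z f)"
      by simp
    with l2norm_triangle_sub[OF Bl[OF z f] Bl[OF w f]] N(2)[OF w f] show ?thesis
      by simp
  qed
  have "\<exists>M\<ge>0. \<forall>z\<in>cball 0 \<rho>. \<forall>f\<in>l2 V. l2norm V (B z f) \<le> M * l2norm V f"
  proof -
    have sub: "cmod z < R" if "z \<in> cball 0 \<rho>" for z
      using that \<rho> by simp
    \<comment> \<open>Local bounds become uniform by compactness; the sum of the finitely many local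
      constants dominates each of them.\<close>
    have "cball 0 \<rho> \<subseteq> (\<Union>w\<in>cball 0 \<rho>. ball w (1 / (2 * C w)))"
      using C(1) sub by force
    then obtain W where W: "W \<subseteq> cball 0 \<rho>" "finite W" "cball 0 \<rho> \<subseteq> (\<Union>w\<in>W. ball w (1 / (2 * C w)))"
      by (rule compactE_image[OF compact_cball, rotated]) auto
    have "l2norm V (B z f) \<le> (\<Sum>w\<in>W. 2 * N w) * l2norm V f" if z: "z \<in> cball 0 \<rho>" and f: "f \<in> l2 V" for z f
    proof -
      obtain w where w: "w \<in> W" "dist w z < 1 / (2 * C w)"
        using W(3) z by auto
      have "l2norm V (B z f) \<le> 2 * N w * l2norm V f"
        by (rule loc) (use w W z f sub in auto)
      also have "2 * N w \<le> (\<Sum>w\<in>W. 2 * N w)"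
        by (rule member_le_sum) (use w W sub N(1) in \<open>force+\<close>)
      finally show ?thesis
        by (simp add: mult_right_mono)
    qed
    moreover have "0 \<le> (\<Sum>w\<in>W. 2 * N w)"
      by (intro sum_nonneg) (use N(1) sub W in force)
    ultimately show ?thesis by blast
  qed
  then obtain M where M0: "M \<ge> 0" and M: "\<And>z f. z \<in> cball 0 \<rho> \<Longrightarrow> f \<in> l2 V \<Longrightarrow> l2norm V (B z f) \<le> M * l2norm V f"
    by blast
  define h where "h = (\<lambda>f g z. l2inner V (B z f) g)"
  have hol: "h f g holomorphic_on ball 0 R" if f: "f \<in> l2 V" and g: "g \<in> l2 V" for f g
  proof -
    have "(h f g has_field_derivative l2inner V (B w (T (B w f))) g) (at w)" if "w \<in> ball 0 R" for w
    proof -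
      have w: "cmod w < R"
        using that by simp
      \<comment> \<open>By the resolvent identity this is the difference quotient of h f g at z
        \<noteq> w, so its continuity at w is the complex differentiability of h f g there.\<close>
      let ?\<phi> = "\<lambda>z. l2inner V (B w (T (B z f))) g"
      let ?e = "min (R - cmod w) (1 / (2 * C w))"
      have near: "\<forall>\<^sub>F z in at w. cmod z < R \<and> dist w z < 1 / (2 * C w) \<and> z \<noteq> w"
      proof -
        have "?e > 0"
          using w C(1)[OF w] by simp
        then have "\<forall>\<^sub>F z in at w. z \<in> ball w ?e - {w}"
          by (intro eventually_at_in_open) auto
        then show ?thesis
        proof eventually_elim
          case (elim z)
          have "cmod z \<le> cmod w + dist w z"
            by (metis dist_0_norm dist_triangle)
          with elim show ?case by auto
        qed
      qed
      have "(?\<phi> \<longlongrightarrow> ?\<phi> w) (at w)"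
      proof (rule LIM_zero_cancel, rule Lim_null_comparison)
        show "\<forall>\<^sub>F z in at w. norm (?\<phi> z - ?\<phi> w)
            \<le> C w * (cmod (z - w) * (C w * (2 * N w * l2norm V f))) * l2norm V g"
          using near
        proof eventually_elim
          case (elim z)
          then have z: "cmod z < R"
            by simp
          have d: "(\<lambda>v. B z f v - B w f v) \<in> l2 V"
            by (intro l2_diff Bl z w f)
          have "?\<phi> z - ?\<phi> w = l2inner V (B w (T (\<lambda>v. B z f v - B w f v))) g"
            using z w f g by (simp add: bounded_op_diff[OF T] bounded_op_diff[OF Bb] l2inner_diff_left Bl Tl)
          also have "cmod \<dots> \<le> l2norm V (B w (T (\<lambda>v. B z f v - B w f v))) * l2norm V g"
            by (intro l2_Cauchy_Schwarz Bl Tl w d g)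
          also have "\<dots> \<le> C w * l2norm V (\<lambda>v. B z f v - B w f v) * l2norm V g"
            by (intro mult_right_mono C w d) auto
          also have "\<dots> \<le> C w * (cmod (z - w) * (C w * l2norm V (B z f))) * l2norm V g"
            by (intro mult_right_mono mult_left_mono diff z w f) (use C(1)[OF w] in auto)
          also have "\<dots> \<le> C w * (cmod (z - w) * (C w * (2 * N w * l2norm V f))) * l2norm V g"
            by (intro mult_right_mono mult_left_mono loc z w f) (use C(1)[OF w] elim in auto)
          finally show ?case .
        qed
        show "((\<lambda>z. C w * (cmod (z - w) * (C w * (2 * N w * l2norm V f))) * l2norm V g) \<longlongrightarrow> 0) (at w)"
          by (rule tendsto_eq_intros refl | simp)+
      qed
      then have "((\<lambda>z. (h f g z - h f g w) / (z - w)) \<longlongrightarrow> ?\<phi> w) (at w)"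
      proof (rule Lim_transform_eventually)
        show "\<forall>\<^sub>F z in at w. ?\<phi> z = (h f g z - h f g w) / (z - w)"
          using near
        proof eventually_elim
          case (elim z)
          have "h f g z - h f g w = l2inner V (\<lambda>v. B z f v - B w f v) g"
            unfolding h_def by (rule l2inner_diff_left[symmetric]) (use elim w f g Bl in auto)
          also have "\<dots> = (z - w) * ?\<phi> z"
            using elim w f by (simp add: res l2inner_scale_left)
          finally show ?case
            using elim by simp
        qed
      qed
      then show ?thesis
        by (simp add: has_field_derivative_iff)
    qed
    then show ?thesis
      by (meson holomorphic_onI field_differentiable_def has_field_derivative_at_within)
  qed
  \<comment> \<open>Induction through (I - zT)^(-1) f = f + z (I - zT)^(-1) T f; f is generalised
    because each step replaces f by T f.\<close>
  have coeff: "(deriv ^^ n) (h f g) 0 = fact n * l2inner V ((T ^^ n) f) g" if f: "f \<in> l2 V" and g: "g \<in> l2 V" for f g n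
    using f
  proof (induction n arbitrary: f)
    case 0
    have "B 0 f = f"
      using B1[of 0 f] \<rho> 0 by simp
    then show ?case
      by (simp add: h_def)
  next
    case (Suc n)
    have "h f g z = l2inner V f g + z * h (T f) g z" if "z \<in> ball 0 R" for z
    proof -
      have z: "cmod z < R"
        using that by simp
      have "h f g z = l2inner V (\<lambda>v. f v + z * B z (T f) v) g"
        unfolding h_def by (subst Brec[OF z Suc.prems]) (rule refl)
      then show ?thesis
        using Suc.prems g by (simp add: h_def l2inner_add_left l2inner_scale_left l2_scale Bl Tl z)
    qed
    then have "(deriv ^^ Suc n) (h f g) 0 = of_nat (Suc n) * (deriv ^^ n) (h (T f) g) 0"
      using \<rho> by (intro higher_deriv_const_plus_times[OF hol[OF Tl[OF Suc.prems] g]]) auto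
    also have "\<dots> = fact (Suc n) * l2inner V ((T ^^ n) (T f)) g"
      using Suc.IH[OF Tl[OF Suc.prems]] by (simp add: algebra_simps)
    finally show ?case
      by (simp add: funpow_swap1)
  qed
  have "l2norm V ((T ^^ n) f) * \<rho> ^ n \<le> M * l2norm V f" if f: "f \<in> l2 V" for f n
  proof -
    let ?t = "(T ^^ n) f"
    have t: "?t \<in> l2 V"
      by (rule bounded_op_l2[OF bounded_op_funpow[OF T] f])
    have sub: "cball 0 \<rho> \<subseteq> ball (0::complex) R"
      using \<rho> by auto
    \<comment> \<open>Choosing g = T^n f makes the coefficient the squared norm of T^n f, up to n!,
      so that one factor of the norm cancels.\<close>
    have "cmod ((deriv ^^ n) (h f ?t) 0) \<le> fact n * (M * l2norm V f * l2norm V ?t) / \<rho> ^ n"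
    proof (rule Cauchy_inequality)
      show "h f ?t holomorphic_on ball 0 \<rho>"
        using hol[OF f t] by (rule holomorphic_on_subset) (use sub in auto)
      show "continuous_on (cball 0 \<rho>) (h f ?t)"
        using holomorphic_on_imp_continuous_on[OF hol[OF f t]] by (rule continuous_on_subset) (use sub in auto)
      fix x assume "cmod (0 - x) = \<rho>"
      then have x: "x \<in> cball 0 \<rho>" "cmod x < R"
        using \<rho> by auto
      have "cmod (h f ?t x) \<le> l2norm V (B x f) * l2norm V ?t"
        unfolding h_def by (intro l2_Cauchy_Schwarz Bl x f t)
      also have "\<dots> \<le> M * l2norm V f * l2norm V ?t"
        by (intro mult_right_mono M x f) simp
      finally show "cmod (h f ?t x) \<le> M * l2norm V f * l2norm V ?t" .
    qed (rule \<rho>)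
    also have "cmod ((deriv ^^ n) (h f ?t) 0) = fact n * (l2norm V ?t)\<^sup>2"
      by (simp add: coeff[OF f t] l2inner_self[OF t] norm_mult norm_power)
    finally have "fact n * (l2norm V ?t)\<^sup>2 \<le> fact n * (M * l2norm V f * l2norm V ?t / \<rho> ^ n)"
      by simp
    then have "(l2norm V ?t)\<^sup>2 \<le> M * l2norm V f * l2norm V ?t / \<rho> ^ n"
      by (rule mult_left_le_imp_le) simp
    then have *: "l2norm V ?t * (l2norm V ?t * \<rho> ^ n) \<le> l2norm V ?t * (M * l2norm V f)"
      using \<rho> by (simp add: field_simps power2_eq_square)
    show ?thesis
    proof (cases "l2norm V ?t = 0")
      case True
      then show ?thesis
        using M0 by simp
    next
      case False
      with * show ?thesis
        by (simp add: mult_le_cancel_left order_less_le)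
    qed
  qed
  then show ?thesis
    using M0 by blast
qed

text \<open>If the spectral radius were not positive, every resolvent would exist and the powers of
  T would decay faster than any geometric sequence, whereas the left inverse permits decay at most
  like D^(-n), where D bounds L.\<close>

lemma
  assumes T: "bounded_op V T" and L: "bounded_op V L" "\<And>f. f \<in> l2 V \<Longrightarrow> L (T f) = f"
    and x: "x \<in> l2 V" "x \<noteq> (\<lambda>v. 0)"
  shows spectral_radius_pos: "spectral_radius V T > 0"
    and funpow_bound_spectral_radius: "0 < \<rho> \<Longrightarrow> \<rho> < inverse (spectral_radius V T) \<Longrightarrow>
      \<exists>M\<ge>0. \<forall>n. \<forall>f\<in>l2 V. l2norm V ((T ^^ n) f) * \<rho> ^ n \<le> M * l2norm V f"
proof -
  let ?r = "spectral_radius V T"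
  have "bdd_above (cmod ` op_spectrum V T)"
  proof -
    obtain C where C: "C > 0" "\<And>f. f \<in> l2 V \<Longrightarrow> l2norm V (T f) \<le> C * l2norm V f"
      using bounded_op_bound[OF T] by blast
    have "cmod \<mu> \<le> C" if "\<mu> \<in> op_spectrum V T" for \<mu>
    proof (rule ccontr)
      assume "\<not> cmod \<mu> \<le> C"
      then have \<mu>: "C < cmod \<mu>" "\<mu> \<noteq> 0"
        using C(1) by auto
      have "invertible_op V (\<lambda>f v. f v - (1 / \<mu>) * T f v)"
        by (rule invertible_Neumann[OF T C]) (use \<mu> in \<open>simp_all add: norm_divide\<close>)
      then have "invertible_op V (\<lambda>f v. (- \<mu>) * (f v - (1 / \<mu>) * T f v))"
        by (rule invertible_op_scale) (use \<mu> in simp)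
      moreover have "(\<lambda>f v. (- \<mu>) * (f v - (1 / \<mu>) * T f v)) = (\<lambda>f v. T f v - \<mu> * f v)"
        using \<mu> by (auto simp: algebra_simps)
      ultimately show False
        using that by (simp add: op_spectrum_def)
    qed
    then show ?thesis
      by (auto intro!: bdd_aboveI[of _ C])
  qed
  then have le: "cmod \<mu> \<le> ?r" if "\<mu> \<in> op_spectrum V T" for \<mu>
    unfolding spectral_radius_def by (rule cSup_upper[rotated]) (use that in auto)
  \<comment> \<open>Were 1/z in the spectrum, 1 \<le> |z| ?r would follow. The argument covers
    either sign of ?r and an empty spectrum, and can therefore serve the proof that ?r is
    positive.\<close>
  have inv: "invertible_op V (\<lambda>f v. f v - z * T f v)" if z: "cmod z * ?r < 1" for z
  proof (cases "z = 0")
    case True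
    then show ?thesis
      unfolding invertible_op_def by (auto simp: bounded_op_id intro!: exI[of _ "\<lambda>f. f"])
  next
    case False
    have "1 / z \<notin> op_spectrum V T"
      using le[of "1 / z"] z False by (auto simp: norm_divide field_simps)
    then have "invertible_op V (\<lambda>f v. (- z) * (T f v - (1 / z) * f v))"
      using False by (intro invertible_op_scale) (auto simp: op_spectrum_def)
    moreover have "(\<lambda>f v. (- z) * (T f v - (1 / z) * f v)) = (\<lambda>f v. f v - z * T f v)"
      using False by (auto simp: algebra_simps)
    ultimately show ?thesis by simp
  qed
  show pos: "?r > 0"
  proof (rule ccontr)
    assume "\<not> ?r > 0"
    then have "invertible_op V (\<lambda>f v. f v - z * T f v)" for z
      by (intro inv) (smt (verit) mult_nonneg_nonpos norm_ge_zero)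
    moreover obtain D where D: "D > 0" "\<And>f. f \<in> l2 V \<Longrightarrow> l2norm V (L f) \<le> D * l2norm V f"
      using bounded_op_bound[OF L(1)] by blast
    \<comment> \<open>The growth radius is twice the bound D of the left inverse: played against the
      lower bound D^(-n) for T^n x it leaves 2^n \<le> M. The value 4 D is just some larger
      R.\<close>
    ultimately obtain M where M: "\<And>n. l2norm V ((T ^^ n) x) * (2 * D) ^ n \<le> M * l2norm V x"
      using funpow_bound_if_resolvent_exists[OF T, of "4 * D" "2 * D"] x(1) by force
    have low: "l2norm V x \<le> D ^ n * l2norm V ((T ^^ n) x)" for n
    proof (induction n)
      case (Suc n)
      have "l2norm V ((T ^^ n) x) \<le> D * l2norm V (T ((T ^^ n) x))"
        using D(2)[OF bounded_op_l2[OF T]] L(2) bounded_op_l2[OF bounded_op_funpow[OF T] x(1)] by metis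
      then have "D ^ n * l2norm V ((T ^^ n) x) \<le> D ^ n * (D * l2norm V (T ((T ^^ n) x)))"
        using D(1) by (intro mult_left_mono) auto
      with Suc show ?case
        by (simp add: mult_ac)
    qed simp
    have x0: "l2norm V x > 0"
      using x l2norm_eq_0_iff[OF x(1)] l2norm_nonneg[of V x] by linarith
    have "2 ^ n \<le> M" for n :: nat
    proof -
      have "2 ^ n * l2norm V x \<le> 2 ^ n * (D ^ n * l2norm V ((T ^^ n) x))"
        by (intro mult_left_mono low) auto
      also have "\<dots> \<le> M * l2norm V x"
        using M[of n] by (simp add: power_mult_distrib mult_ac)
      finally show ?thesis
        using x0 by simp
    qed
    moreover obtain n :: nat where "M < 2 ^ n"
      using real_arch_pow[of 2 M] by auto
    ultimately show False
      by (meson not_less)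
  qed
  show "\<exists>M\<ge>0. \<forall>n. \<forall>f\<in>l2 V. l2norm V ((T ^^ n) f) * \<rho> ^ n \<le> M * l2norm V f"
    if "0 < \<rho>" "\<rho> < inverse ?r"
    by (rule funpow_bound_if_resolvent_exists[OF T inv that]) (use pos in \<open>simp add: field_simps\<close>)
qed

subsection \<open>Multi-indices and vector valued power series\<close>

text \<open>Raising one coordinate at a time matches the way a single factor is peeled off a
  multi-index power; the sum of the entries is the measure.\<close>

lemma multiindex_induct [case_names zero Suc]:
  fixes P :: "('d::finite \<Rightarrow> nat) \<Rightarrow> bool"
  assumes "P (\<lambda>_. 0)" and "\<And>\<alpha> j. P \<alpha> \<Longrightarrow> P (\<alpha>(j := Suc (\<alpha> j)))"
  shows "P \<alpha>"
proof (induction "\<Sum>j\<in>UNIV. \<alpha> j" arbitrary: \<alpha> rule: less_induct)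
  case less
  show ?case
  proof (cases "\<alpha> = (\<lambda>_. 0)")
    case False
    then obtain j where j: "\<alpha> j \<noteq> 0"
      by auto
    let ?\<beta> = "\<alpha>(j := \<alpha> j - 1)"
    have "sum ?\<beta> UNIV < sum \<alpha> UNIV"
      by (rule sum_strict_mono_ex1) (use j in auto)
    then have "P (?\<beta>(j := Suc (?\<beta> j)))"
      by (intro assms(2) less)
    moreover have "?\<beta>(j := Suc (?\<beta> j)) = \<alpha>"
      using j by auto
    ultimately show ?thesis by metis
  qed (use assms(1) in simp)
qed

text \<open>A finite set of multi-indices lies in the box of its coordinate projections, over which
  the sum of products factors into a product of sums.\<close>

lemma summable_on_prod_multiindex:
  fixes a :: "'d::finite \<Rightarrow> nat \<Rightarrow> real"
  assumes nn: "\<And>j n. 0 \<le> a j n" and s: "\<And>j. a j summable_on UNIV"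
  shows "(\<lambda>\<alpha>. \<Prod>j\<in>UNIV. a j (\<alpha> j)) summable_on UNIV"
proof (rule nonneg_bdd_above_summable_on)
  have "(\<Sum>\<alpha>\<in>F. \<Prod>j\<in>UNIV. a j (\<alpha> j)) \<le> (\<Prod>j\<in>UNIV. infsum (a j) UNIV)"
    if F: "finite F" for F :: "('d \<Rightarrow> nat) set"
  proof -
    let ?B = "\<lambda>j. (\<lambda>\<alpha>. \<alpha> j) ` F"
    have "(\<Sum>\<alpha>\<in>F. \<Prod>j\<in>UNIV. a j (\<alpha> j)) \<le> (\<Sum>\<alpha>\<in>PiE UNIV ?B. \<Prod>j\<in>UNIV. a j (\<alpha> j))"
      by (rule sum_mono2) (use F nn in \<open>auto intro!: finite_PiE prod_nonneg\<close>)
    also have "\<dots> = (\<Prod>j\<in>UNIV. \<Sum>n\<in>?B j. a j n)"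
      by (rule prod_sum_PiE[symmetric]) (use F in auto)
    also have "\<dots> \<le> (\<Prod>j\<in>UNIV. infsum (a j) UNIV)"
      by (rule prod_mono) (use F nn s in \<open>auto intro!: finite_sum_le_infsum sum_nonneg\<close>)
    finally show ?thesis .
  qed
  then show "bdd_above (sum (\<lambda>\<alpha>. \<Prod>j\<in>UNIV. a j (\<alpha> j)) ` {F. F \<subseteq> UNIV \<and> finite F})"
    by (auto intro!: bdd_aboveI)
qed (auto intro: prod_nonneg nn)

text \<open>The weights \<alpha>_j + 1 leave room for termwise differentiation, which produces
  factors \<alpha>_j.\<close>

lemma summable_on_prod_geometric:
  fixes q :: "'d::finite \<Rightarrow> real"
  assumes "\<And>j. 0 \<le> q j" "\<And>j. q j < 1"
  shows "(\<lambda>\<alpha>. \<Prod>j\<in>UNIV. real (Suc (\<alpha> j)) * q j ^ \<alpha> j) summable_on UNIV"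
    and "(\<lambda>\<alpha>. \<Prod>j\<in>UNIV. q j ^ \<alpha> j) summable_on UNIV"
proof -
  have "(\<lambda>n. real (Suc n) * q j ^ n) sums (1 / (1 - q j)\<^sup>2)" for j
    using assms[of j] geometric_deriv_sums[of "q j"] by simp
  then have "(\<lambda>n. real (Suc n) * q j ^ n) summable_on UNIV" for j
    using assms[of j] by (intro has_sum_imp_summable[OF sums_nonneg_imp_has_sum]) auto
  then show 1: "(\<lambda>\<alpha>. \<Prod>j\<in>UNIV. real (Suc (\<alpha> j)) * q j ^ \<alpha> j) summable_on UNIV"
    using assms by (intro summable_on_prod_multiindex) auto
  show "(\<lambda>\<alpha>. \<Prod>j\<in>UNIV. q j ^ \<alpha> j) summable_on UNIV"
  proof (rule summable_on_comparison_test[OF 1])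
    show "(\<Prod>j\<in>UNIV. q j ^ \<alpha> j) \<le> (\<Prod>j\<in>UNIV. real (Suc (\<alpha> j)) * q j ^ \<alpha> j)" for \<alpha>
      using assms by (intro prod_mono) (auto simp: algebra_simps)
  qed (use assms in \<open>auto intro!: prod_nonneg\<close>)
qed

section \<open>Monomials, their partial derivatives, and dominated convergence\<close>

definition monom_at :: "complex^'d \<Rightarrow> ('d::finite \<Rightarrow> nat) \<Rightarrow> complex" where
  "monom_at z \<alpha> = (\<Prod>j\<in>UNIV. z $ j ^ \<alpha> j)"

text \<open>The partial derivative of the monomial in the j-th variable; for \<alpha> j = 0 the
  truncated exponent is harmless because the leading factor is 0.\<close>

definition dmonom_at :: "complex^'d \<Rightarrow> 'd \<Rightarrow> ('d::finite \<Rightarrow> nat) \<Rightarrow> complex" where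
  "dmonom_at z j \<alpha> = of_nat (\<alpha> j) * z $ j ^ (\<alpha> j - 1) * (\<Prod>i\<in>UNIV - {j}. z $ i ^ \<alpha> i)"

lemma norm_monom_at: "cmod (monom_at z \<alpha>) = (\<Prod>j\<in>UNIV. cmod (z $ j) ^ \<alpha> j)"
  by (simp add: monom_at_def prod_norm[symmetric] norm_power)

lemma monom_at_Suc: "monom_at z (\<alpha>(j := Suc (\<alpha> j))) = z $ j * monom_at z \<alpha>"
proof -
  have *: "monom_at z \<beta> = z $ j ^ \<beta> j * (\<Prod>i\<in>UNIV - {j}. z $ i ^ \<beta> i)" for \<beta>
    unfolding monom_at_def by (rule prod.remove) auto
  show ?thesis
    unfolding * by (simp add: mult.assoc)
qed

text \<open>By 0^0 = 1, setting z_j = 0 selects the terms free of z_j; that part of a power series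
  is thus its value at another point of the polydisc.\<close>

lemma monom_at_update_0:
  "monom_at (\<chi> i. if i = j then 0 else z $ i) \<alpha> = (if \<alpha> j = 0 then monom_at z \<alpha> else 0)"
proof -
  have *: "monom_at w \<alpha> = w $ j ^ \<alpha> j * (\<Prod>i\<in>UNIV - {j}. w $ i ^ \<alpha> i)" for w :: "complex^'a"
    unfolding monom_at_def by (rule prod.remove) auto
  have "(\<Prod>i\<in>UNIV - {j}. (\<chi> i. if i = j then 0 else z $ i) $ i ^ \<alpha> i) = (\<Prod>i\<in>UNIV - {j}. z $ i ^ \<alpha> i)"
    by (rule prod.cong) auto
  then show ?thesis
    unfolding * by simp
qed

lemma monom_at_0: "monom_at 0 \<alpha> = (if \<alpha> = (\<lambda>_. 0) then 1 else 0)"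
  by (auto simp: monom_at_def fun_eq_iff)

text \<open>Dividing each coordinate by \<sigma> j moves both points into the closed unit polydisc,
  where differences of products and of powers are bounded by sums of differences of the
  factors.\<close>

lemma monom_at_diff_bound:
  assumes \<sigma>: "\<And>j. \<sigma> j > 0" and z: "\<And>j. cmod (z $ j) \<le> \<sigma> j" and w: "\<And>j. cmod (w $ j) \<le> \<sigma> j"
  shows "cmod (monom_at z \<alpha> - monom_at w \<alpha>)
    \<le> (\<Prod>j\<in>UNIV. \<sigma> j ^ \<alpha> j) * (\<Sum>j\<in>UNIV. real (\<alpha> j) * (cmod (z $ j - w $ j) / \<sigma> j))"
proof -
  define x where "x = (\<lambda>(z::complex^'a) j. z $ j / complex_of_real (\<sigma> j))"
  have \<sigma>0: "complex_of_real (\<sigma> j) \<noteq> 0" for j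
    using \<sigma>[of j] by simp
  have m: "monom_at z \<alpha> = complex_of_real (\<Prod>j\<in>UNIV. \<sigma> j ^ \<alpha> j) * (\<Prod>j\<in>UNIV. x z j ^ \<alpha> j)" for z
    using \<sigma>0 by (simp add: monom_at_def x_def power_divide flip: prod.distrib)
  have x1: "cmod (x z j) \<le> 1" "cmod (x w j) \<le> 1" for j
    using \<sigma>[of j] z[of j] w[of j] by (auto simp: x_def norm_divide)
  have xd: "cmod (x z j - x w j) = cmod (z $ j - w $ j) / \<sigma> j" for j
    using \<sigma>[of j] by (simp add: x_def norm_divide flip: diff_divide_distrib)
  have "cmod (monom_at z \<alpha> - monom_at w \<alpha>)
      = (\<Prod>j\<in>UNIV. \<sigma> j ^ \<alpha> j) * cmod ((\<Prod>j\<in>UNIV. x z j ^ \<alpha> j) - (\<Prod>j\<in>UNIV. x w j ^ \<alpha> j))"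
    unfolding m using \<sigma> by (simp add: norm_mult prod_norm[symmetric] norm_power less_imp_le flip: right_diff_distrib)
  also have "\<dots> \<le> (\<Prod>j\<in>UNIV. \<sigma> j ^ \<alpha> j) * (\<Sum>j\<in>UNIV. cmod (x z j ^ \<alpha> j - x w j ^ \<alpha> j))"
    using \<sigma> x1 by (intro mult_left_mono norm_prod_diff prod_nonneg) (auto simp: norm_power power_le_one less_imp_le)
  also have "\<dots> \<le> (\<Prod>j\<in>UNIV. \<sigma> j ^ \<alpha> j) * (\<Sum>j\<in>UNIV. real (\<alpha> j) * cmod (x z j - x w j))"
    using \<sigma> x1 by (intro mult_left_mono sum_mono norm_power_diff prod_nonneg) (auto simp: less_imp_le)
  finally show ?thesis
    unfolding xd .
qed

lemma dmonom_at_bound: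
  assumes \<sigma>: "\<And>j. \<sigma> j > 0" and z: "\<And>j. cmod (z $ j) \<le> \<sigma> j"
  shows "cmod (dmonom_at z j \<alpha>) \<le> (\<Prod>j\<in>UNIV. \<sigma> j ^ \<alpha> j) * (real (\<alpha> j) / \<sigma> j)"
proof -
  have "cmod (dmonom_at z j \<alpha>) = real (\<alpha> j) * cmod (z $ j) ^ (\<alpha> j - 1) * (\<Prod>i\<in>UNIV - {j}. cmod (z $ i) ^ \<alpha> i)"
    by (simp add: dmonom_at_def norm_mult prod_norm[symmetric] norm_power)
  also have "\<dots> \<le> real (\<alpha> j) * \<sigma> j ^ (\<alpha> j - 1) * (\<Prod>i\<in>UNIV - {j}. \<sigma> i ^ \<alpha> i)"
    using z \<sigma> by (intro mult_mono prod_mono) (auto intro!: prod_nonneg power_mono simp: less_imp_le)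
  also have "real (\<alpha> j) * \<sigma> j ^ (\<alpha> j - 1) = \<sigma> j ^ \<alpha> j * (real (\<alpha> j) / \<sigma> j)"
    using \<sigma>[of j] by (cases "\<alpha> j") auto
  also have "\<dots> * (\<Prod>i\<in>UNIV - {j}. \<sigma> i ^ \<alpha> i) = (\<sigma> j ^ \<alpha> j * (\<Prod>i\<in>UNIV - {j}. \<sigma> i ^ \<alpha> i)) * (real (\<alpha> j) / \<sigma> j)"
    by (simp add: mult_ac)
  also have "\<sigma> j ^ \<alpha> j * (\<Prod>i\<in>UNIV - {j}. \<sigma> i ^ \<alpha> i) = (\<Prod>j\<in>UNIV. \<sigma> j ^ \<alpha> j)"
    by (rule prod.remove[symmetric]) auto
  finally show ?thesis .
qed

lemma monom_at_derivative:
  "((\<lambda>z. cmod (monom_at z \<alpha> - monom_at w \<alpha> - (\<Sum>j\<in>UNIV. (z $ j - w $ j) * dmonom_at w j \<alpha>)) / norm (z - w)) \<longlongrightarrow> 0) (at w)"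
proof -
  have "((\<lambda>z::complex^'a. \<Prod>j\<in>UNIV. z $ j ^ \<alpha> j) has_derivative
      (\<lambda>y. \<Sum>j\<in>UNIV. (of_nat (\<alpha> j) * y $ j * w $ j ^ (\<alpha> j - 1)) * (\<Prod>i\<in>UNIV - {j}. w $ i ^ \<alpha> i))) (at w)"
    by (intro has_derivative_prod has_derivative_power bounded_linear.has_derivative[OF bounded_linear_vec_nth] has_derivative_ident)
  then have "((\<lambda>z. monom_at z \<alpha>) has_derivative (\<lambda>y. \<Sum>j\<in>UNIV. y $ j * dmonom_at w j \<alpha>)) (at w)"
    by (simp add: monom_at_def[abs_def] dmonom_at_def mult_ac)
  then have "((\<lambda>z. (monom_at z \<alpha> - monom_at w \<alpha> - (\<Sum>j\<in>UNIV. (z - w) $ j * dmonom_at w j \<alpha>)) /\<^sub>R norm (z - w)) \<longlongrightarrow> 0) (at w)"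
    unfolding has_derivative_at_within by blast
  from tendsto_norm_zero[OF this] show ?thesis
    by (simp add: divide_inverse mult.commute)
qed

text \<open>Dominated convergence for unordered sums along an arbitrary filter: outside a finite set
  the majorant contributes less than e / 2, and the finite part tends to 0 termwise.\<close>

lemma infsum_dominated_tendsto_0:
  fixes f :: "'i \<Rightarrow> 'b \<Rightarrow> real"
  assumes lim: "\<And>a. a \<in> A \<Longrightarrow> (f a \<longlongrightarrow> 0) F" and dom: "\<forall>\<^sub>F z in F. \<forall>a\<in>A. 0 \<le> f a z \<and> f a z \<le> G a"
    and G: "G summable_on A" "\<And>a. a \<in> A \<Longrightarrow> 0 \<le> G a"
  shows "((\<lambda>z. infsum (\<lambda>a. f a z) A) \<longlongrightarrow> 0) F"
proof (rule tendstoI)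
  fix e :: real assume "e > 0"
  have "\<forall>\<^sub>F S in finite_subsets_at_top A. dist (sum G S) (infsum G A) < e / 2"
    using has_sum_infsum[OF G(1)] \<open>e > 0\<close> unfolding has_sum_def by (intro tendstoD) auto
  then obtain S where S: "finite S" "S \<subseteq> A" "dist (sum G S) (infsum G A) < e / 2"
    unfolding eventually_finite_subsets_at_top by blast
  have tail: "infsum G (A - S) < e / 2"
  proof -
    have "infsum G (A - S) = infsum G A - infsum G S"
      by (rule infsum_Diff) (use S G in auto)
    then show ?thesis
      using S by (auto simp: dist_real_def abs_if split: if_splits)
  qed
  have "((\<lambda>z. \<Sum>a\<in>S. f a z) \<longlongrightarrow> (\<Sum>a\<in>S. 0)) F"
    by (rule tendsto_sum) (use lim S in auto)
  then have "\<forall>\<^sub>F z in F. (\<Sum>a\<in>S. f a z) < e / 2"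
    using \<open>e > 0\<close> by (intro order_tendstoD) auto
  with dom show "\<forall>\<^sub>F z in F. dist (infsum (\<lambda>a. f a z) A) 0 < e"
  proof eventually_elim
    case (elim z)
    have s: "(\<lambda>a. f a z) summable_on A"
      by (rule summable_on_comparison_test[OF G(1)]) (use elim in auto)
    have s': "(\<lambda>a. f a z) summable_on A - S" "G summable_on A - S"
      using s G(1) by (auto intro: summable_on_subset_banach)
    have "infsum (\<lambda>a. f a z) A = infsum (\<lambda>a. f a z) S + infsum (\<lambda>a. f a z) (A - S)"
      using infsum_Diff[OF s, of S] S by simp
    also have "infsum (\<lambda>a. f a z) (A - S) \<le> infsum G (A - S)"
      by (rule infsum_mono[OF s']) (use elim in auto)
    finally have "infsum (\<lambda>a. f a z) A < e"
      using tail elim S by simp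
    moreover have "0 \<le> infsum (\<lambda>a. f a z) A"
      by (rule infsum_nonneg) (use elim in auto)
    ultimately show ?case
      by simp
  qed
qed

text \<open>The Cauchy type estimates that make the power series with coefficients \<open>c\<close> converge on the polydisc.\<close>

definition polydisc_coeffs :: "'v set \<Rightarrow> ('d::finite \<Rightarrow> real) \<Rightarrow> (('d \<Rightarrow> nat) \<Rightarrow> 'v \<Rightarrow> complex) \<Rightarrow> bool" where
  "polydisc_coeffs V r c \<longleftrightarrow> (\<forall>\<alpha>. c \<alpha> \<in> l2 V) \<and>
     (\<forall>\<rho>. (\<forall>j. 0 < \<rho> j \<and> \<rho> j < r j) \<longrightarrow> (\<exists>M\<ge>0. \<forall>\<alpha>. l2norm V (c \<alpha>) * (\<Prod>j\<in>UNIV. \<rho> j ^ \<alpha> j) \<le> M))"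

lemma exists_radius_between:
  fixes r :: "'d \<Rightarrow> real"
  assumes "\<And>j. s j < r j" "\<And>j. 0 \<le> s j"
  obtains \<rho> where "\<And>j. s j < \<rho> j" "\<And>j. \<rho> j < r j" "\<And>j. 0 < \<rho> j"
proof (rule that[of "\<lambda>j. (s j + r j) / 2"])
  fix j
  show "s j < (s j + r j) / 2" "(s j + r j) / 2 < r j" "0 < (s j + r j) / 2"
    using assms[of j] by simp_all
qed

text \<open>A radius \<rho> is inserted strictly between \<sigma> and r. The coefficients are
  bounded at \<rho>, so the series at \<sigma> is dominated by a geometric one with ratios
  \<sigma>_j / \<rho>_j.\<close>

lemma summable_polydisc_coeffs:
  assumes c: "polydisc_coeffs V r c" and \<sigma>: "\<And>j. 0 \<le> \<sigma> j" "\<And>j. \<sigma> j < r j"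
  shows "(\<lambda>\<alpha>. (\<Prod>j\<in>UNIV. real (Suc (\<alpha> j)) * \<sigma> j ^ \<alpha> j) * l2norm V (c \<alpha>)) summable_on UNIV"
    and "(\<lambda>\<alpha>. (\<Prod>j\<in>UNIV. \<sigma> j ^ \<alpha> j) * l2norm V (c \<alpha>)) summable_on UNIV"
proof -
  obtain \<rho> where \<rho>: "\<And>j. \<sigma> j < \<rho> j" "\<And>j. \<rho> j < r j" "\<And>j. 0 < \<rho> j"
    using exists_radius_between[of \<sigma> r] \<sigma> by blast
  then obtain M where M: "M \<ge> 0" "\<And>\<alpha>. l2norm V (c \<alpha>) * (\<Prod>j\<in>UNIV. \<rho> j ^ \<alpha> j) \<le> M"
    using c unfolding polydisc_coeffs_def by meson
  define q where "q = (\<lambda>j. \<sigma> j / \<rho> j)"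
  have q: "0 \<le> q j" "q j < 1" for j
    using \<rho>[of j] \<sigma>[of j] by (auto simp: q_def)
  have split: "(\<Prod>j\<in>UNIV. k j * \<sigma> j ^ \<alpha> j) = (\<Prod>j\<in>UNIV. k j * q j ^ \<alpha> j) * (\<Prod>j\<in>UNIV. \<rho> j ^ \<alpha> j)" for \<alpha> k
    unfolding prod.distrib[symmetric]
    by (rule prod.cong) (use \<rho>(3) in \<open>auto simp: q_def power_divide less_imp_neq[THEN not_sym]\<close>)
  have le: "(\<Prod>j\<in>UNIV. k j * \<sigma> j ^ \<alpha> j) * l2norm V (c \<alpha>) \<le> M * (\<Prod>j\<in>UNIV. k j * q j ^ \<alpha> j)"
    if "\<And>j. k j \<ge> 0" for \<alpha> k
  proof -
    have "0 \<le> (\<Prod>j\<in>UNIV. k j * q j ^ \<alpha> j)"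
      using that q by (intro prod_nonneg) auto
    from mult_left_mono[OF M(2)[of \<alpha>] this] show ?thesis
      unfolding split by (simp add: mult_ac)
  qed
  show "(\<lambda>\<alpha>. (\<Prod>j\<in>UNIV. real (Suc (\<alpha> j)) * \<sigma> j ^ \<alpha> j) * l2norm V (c \<alpha>)) summable_on UNIV"
    by (rule summable_on_comparison_test[OF summable_on_cmult_right[OF summable_on_prod_geometric(1)[of q, OF q], of M]])
      (use le \<sigma> in \<open>auto intro!: mult_nonneg_nonneg prod_nonneg\<close>)
  show "(\<lambda>\<alpha>. (\<Prod>j\<in>UNIV. \<sigma> j ^ \<alpha> j) * l2norm V (c \<alpha>)) summable_on UNIV"
    by (rule summable_on_comparison_test[OF summable_on_cmult_right[OF summable_on_prod_geometric(2)[of q, OF q], of M]])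
      (use le[of "\<lambda>_. 1"] \<sigma> in \<open>auto intro!: mult_nonneg_nonneg prod_nonneg\<close>)
qed

lemma has_sum_diff:
  fixes f g :: "'i \<Rightarrow> complex"
  assumes "(f has_sum a) A" "(g has_sum b) A"
  shows "((\<lambda>i. f i - g i) has_sum (a - b)) A"
  using has_sum_add[OF assms(1) has_sum_cmult_right[OF assms(2), of "-1"]] by simp

lemma has_sum_sum:
  fixes f :: "'j \<Rightarrow> 'i \<Rightarrow> complex"
  assumes "finite J" "\<And>j. j \<in> J \<Longrightarrow> (f j has_sum a j) A"
  shows "((\<lambda>i. \<Sum>j\<in>J. f j i) has_sum (\<Sum>j\<in>J. a j)) A"
  using assms by (induction J rule: finite_induct) (auto intro!: has_sum_add)

definition power_series :: "(('d::finite \<Rightarrow> nat) \<Rightarrow> 'v \<Rightarrow> complex) \<Rightarrow> complex^'d \<Rightarrow> 'v \<Rightarrow> complex" where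
  "power_series c z = l2_infsum (\<lambda>\<alpha> v. monom_at z \<alpha> * c \<alpha> v) UNIV"

lemma power_series_terms:
  assumes c: "polydisc_coeffs V r c" and z: "z \<in> polydisc r"
  shows "(\<lambda>v. monom_at z \<alpha> * c \<alpha> v) \<in> l2 V"
    and "(\<lambda>\<alpha>. l2norm V (\<lambda>v. monom_at z \<alpha> * c \<alpha> v)) summable_on UNIV"
proof -
  show "(\<lambda>v. monom_at z \<alpha> * c \<alpha> v) \<in> l2 V"
    using c by (intro l2_scale) (simp add: polydisc_coeffs_def)
  show "(\<lambda>\<alpha>. l2norm V (\<lambda>v. monom_at z \<alpha> * c \<alpha> v)) summable_on UNIV"
    unfolding l2norm_scale norm_monom_at
    by (rule summable_polydisc_coeffs(2)[OF c]) (use z in \<open>auto simp: polydisc_def\<close>)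
qed

lemma
  assumes c: "polydisc_coeffs V r c" and z: "z \<in> polydisc r"
  shows power_series_in_l2: "power_series c z \<in> l2 V"
    and power_series_has_sum: "((\<lambda>\<alpha>. monom_at z \<alpha> * c \<alpha> v) has_sum power_series c z v) UNIV"
    and power_series_inner: "h \<in> l2 V \<Longrightarrow>
      ((\<lambda>\<alpha>. monom_at z \<alpha> * l2inner V (c \<alpha>) h) has_sum l2inner V (power_series c z) h) UNIV"
    and l2norm_power_series_le:
      "l2norm V (power_series c z) \<le> infsum (\<lambda>\<alpha>. cmod (monom_at z \<alpha>) * l2norm V (c \<alpha>)) UNIV"
proof -
  note t = power_series_terms[OF c z]
  show "power_series c z \<in> l2 V"
    unfolding power_series_def by (rule l2_infsum_in_l2[OF t])
  show "((\<lambda>\<alpha>. monom_at z \<alpha> * c \<alpha> v) has_sum power_series c z v) UNIV"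
    unfolding power_series_def by (rule l2_infsum_has_sum[OF t])
  show "l2norm V (power_series c z) \<le> infsum (\<lambda>\<alpha>. cmod (monom_at z \<alpha>) * l2norm V (c \<alpha>)) UNIV"
    unfolding power_series_def l2norm_scale[symmetric] by (rule l2norm_l2_infsum_le[OF t])
  show "((\<lambda>\<alpha>. monom_at z \<alpha> * l2inner V (c \<alpha>) h) has_sum l2inner V (power_series c z) h) UNIV" if "h \<in> l2 V"
    unfolding power_series_def l2inner_scale_left[symmetric] by (rule l2_infsum_inner[OF t t(1) t that])
qed

text \<open>The first-order Taylor remainders of the monomials, divided by |z - w|, tend to 0 one by
  one and have a summable majorant, so dominated convergence controls the remainder of the whole
  series.\<close>

lemma power_series_holomorphic:
  assumes c: "polydisc_coeffs V r c"
  shows "l2_holomorphic_on V (power_series c) (polydisc r)"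
  unfolding l2_holomorphic_on_def
proof
  fix w assume w: "w \<in> polydisc r"
  have cl2: "c \<alpha> \<in> l2 V" for \<alpha>
    using c by (simp add: polydisc_coeffs_def)
  obtain \<sigma> where \<sigma>: "\<And>j. cmod (w $ j) < \<sigma> j" "\<And>j. \<sigma> j < r j" "\<And>j. 0 < \<sigma> j"
    using exists_radius_between[of "\<lambda>j. cmod (w $ j)" r] w by (auto simp: polydisc_def)
  define K where "K = (\<Sum>j\<in>UNIV. 1 / \<sigma> j)"
  have K: "K \<ge> 0"
    unfolding K_def using \<sigma>(3) by (intro sum_nonneg) (simp add: less_imp_le)
  \<comment> \<open>One majorant has to bound \<alpha>_j \<sigma>^\<alpha> for every j at once; the
    product of all \<alpha>_j + 1 achieves this.\<close>
  define W where "W = (\<lambda>\<alpha>. \<Prod>j\<in>UNIV. real (Suc (\<alpha> j)) * \<sigma> j ^ \<alpha> j)"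
  have W0: "W \<alpha> \<ge> 0" for \<alpha>
    unfolding W_def using \<sigma>(3) by (intro prod_nonneg) (simp add: less_imp_le)
  have Wsum: "(\<lambda>\<alpha>. W \<alpha> * l2norm V (c \<alpha>)) summable_on UNIV"
    unfolding W_def by (rule summable_polydisc_coeffs(1)[OF c]) (use \<sigma> in \<open>auto intro: less_imp_le\<close>)
  have W: "(\<Prod>j\<in>UNIV. \<sigma> j ^ \<alpha> j) * real (\<alpha> j) \<le> W \<alpha>" for \<alpha> j
  proof -
    have "real (\<alpha> j) \<le> real (Suc (\<alpha> j)) * (\<Prod>i\<in>UNIV - {j}. 1)"
      by simp
    also have "\<dots> \<le> real (Suc (\<alpha> j)) * (\<Prod>i\<in>UNIV - {j}. real (Suc (\<alpha> i)))"
      by (intro mult_left_mono prod_mono) auto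
    also have "\<dots> = (\<Prod>i\<in>UNIV. real (Suc (\<alpha> i)))"
      by (rule prod.remove[symmetric]) auto
    finally have "real (\<alpha> j) \<le> (\<Prod>i\<in>UNIV. real (Suc (\<alpha> i)))" .
    moreover have "0 \<le> (\<Prod>j\<in>UNIV. \<sigma> j ^ \<alpha> j)"
      using \<sigma>(3) by (intro prod_nonneg) (simp add: less_imp_le)
    ultimately show ?thesis
      unfolding W_def prod.distrib by (subst (2) mult.commute) (rule mult_left_mono)
  qed
  have dm: "cmod (dmonom_at w j \<alpha>) \<le> (1 / \<sigma> j) * W \<alpha>" for j \<alpha>
  proof -
    have "cmod (dmonom_at w j \<alpha>) \<le> (\<Prod>j\<in>UNIV. \<sigma> j ^ \<alpha> j) * (real (\<alpha> j) / \<sigma> j)"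
      by (rule dmonom_at_bound) (use \<sigma> in \<open>auto intro: less_imp_le\<close>)
    also have "\<dots> = (1 / \<sigma> j) * ((\<Prod>j\<in>UNIV. \<sigma> j ^ \<alpha> j) * real (\<alpha> j))"
      by simp
    also have "\<dots> \<le> (1 / \<sigma> j) * W \<alpha>"
      using \<sigma>(3)[of j] by (intro mult_left_mono W) auto
    finally show ?thesis .
  qed
  define D where "D = (\<lambda>j. l2_infsum (\<lambda>\<alpha> v. dmonom_at w j \<alpha> * c \<alpha> v) UNIV)"
  have Dterm: "(\<lambda>v. dmonom_at w j \<alpha> * c \<alpha> v) \<in> l2 V" for j \<alpha>
    by (intro l2_scale cl2)
  have Dsum: "(\<lambda>\<alpha>. l2norm V (\<lambda>v. dmonom_at w j \<alpha> * c \<alpha> v)) summable_on UNIV" for j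
    unfolding l2norm_scale
  proof (rule summable_on_comparison_test[OF summable_on_cmult_right[OF Wsum, of "1 / \<sigma> j"]])
    show "cmod (dmonom_at w j \<alpha>) * l2norm V (c \<alpha>) \<le> 1 / \<sigma> j * (W \<alpha> * l2norm V (c \<alpha>))" for \<alpha>
      using mult_right_mono[OF dm[of j \<alpha>], of "l2norm V (c \<alpha>)"] by (simp add: mult_ac)
  qed auto
  define q where "q = (\<lambda>\<alpha> z. monom_at z \<alpha> - monom_at w \<alpha> - (\<Sum>j\<in>UNIV. (z $ j - w $ j) * dmonom_at w j \<alpha>))"
  have near: "\<forall>\<^sub>F z in at w. z \<in> polydisc r \<and> (\<forall>j. cmod (z $ j) \<le> \<sigma> j) \<and> z \<noteq> w"
  proof -
    have "\<forall>\<^sub>F z in at w. \<forall>j. cmod (z $ j) < \<sigma> j"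
      by (intro eventually_all_finite order_tendstoD(2)[OF _ \<sigma>(1)] tendsto_intros)
    then show ?thesis
      using eventually_neq_at_within[of w w UNIV]
      by eventually_elim (use \<sigma>(2) in \<open>auto simp: polydisc_def intro: less_imp_le less_trans\<close>)
  qed
  \<comment> \<open>The increment and its linear part are each at most K W(\<alpha>) |z - w|, hence
    the factor 2; K collects the divisors 1 / \<sigma>_j.\<close>
  have qb: "cmod (q \<alpha> z) / norm (z - w) \<le> 2 * K * W \<alpha>"
    if z: "\<And>j. cmod (z $ j) \<le> \<sigma> j" "z \<noteq> w" for z \<alpha>
  proof -
    have zj: "cmod (z $ j - w $ j) \<le> norm (z - w)" for j
      using Finite_Cartesian_Product.norm_nth_le[of "z - w" j] by simp
    have "cmod (monom_at z \<alpha> - monom_at w \<alpha>)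
        \<le> (\<Prod>j\<in>UNIV. \<sigma> j ^ \<alpha> j) * (\<Sum>j\<in>UNIV. real (\<alpha> j) * (cmod (z $ j - w $ j) / \<sigma> j))"
      by (rule monom_at_diff_bound) (use \<sigma> z in \<open>auto intro: less_imp_le\<close>)
    also have "\<dots> = (\<Sum>j\<in>UNIV. ((\<Prod>j\<in>UNIV. \<sigma> j ^ \<alpha> j) * real (\<alpha> j)) * (cmod (z $ j - w $ j) / \<sigma> j))"
      by (simp add: sum_distrib_left mult_ac)
    also have "\<dots> \<le> (\<Sum>j\<in>UNIV. W \<alpha> * (norm (z - w) / \<sigma> j))"
      using \<sigma>(3) W0 by (intro sum_mono mult_mono W divide_right_mono zj) (simp_all add: less_imp_le divide_nonneg_pos)
    also have "\<dots> = K * W \<alpha> * norm (z - w)"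
      by (simp add: K_def sum_distrib_left sum_distrib_right mult_ac)
    finally have 1: "cmod (monom_at z \<alpha> - monom_at w \<alpha>) \<le> K * W \<alpha> * norm (z - w)" .
    have "cmod (\<Sum>j\<in>UNIV. (z $ j - w $ j) * dmonom_at w j \<alpha>) \<le> (\<Sum>j\<in>UNIV. norm (z - w) * ((1 / \<sigma> j) * W \<alpha>))"
      by (intro sum_norm_le, unfold norm_mult, intro mult_mono zj dm) simp_all
    also have "\<dots> = K * W \<alpha> * norm (z - w)"
      by (simp add: K_def sum_distrib_left sum_distrib_right mult_ac)
    finally have 2: "cmod (\<Sum>j\<in>UNIV. (z $ j - w $ j) * dmonom_at w j \<alpha>) \<le> K * W \<alpha> * norm (z - w)" .
    have "cmod (q \<alpha> z) \<le> cmod (monom_at z \<alpha> - monom_at w \<alpha>)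
        + cmod (\<Sum>j\<in>UNIV. (z $ j - w $ j) * dmonom_at w j \<alpha>)"
      unfolding q_def by (rule norm_triangle_ineq4)
    also have "\<dots> \<le> K * W \<alpha> * norm (z - w) + K * W \<alpha> * norm (z - w)"
      by (intro add_mono 1 2)
    finally have "cmod (q \<alpha> z) \<le> 2 * K * W \<alpha> * norm (z - w)"
      by simp
    then show ?thesis
      using z(2) by (simp add: divide_le_eq)
  qed
  have lim: "((\<lambda>z. infsum (\<lambda>\<alpha>. cmod (q \<alpha> z) / norm (z - w) * l2norm V (c \<alpha>)) UNIV) \<longlongrightarrow> 0) (at w)"
  proof (rule infsum_dominated_tendsto_0)
    show "((\<lambda>z. cmod (q \<alpha> z) / norm (z - w) * l2norm V (c \<alpha>)) \<longlongrightarrow> 0) (at w)" for \<alpha>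
      unfolding q_def by (rule tendsto_mult_left_zero[OF monom_at_derivative])
    show "\<forall>\<^sub>F z in at w. \<forall>\<alpha>\<in>UNIV. 0 \<le> cmod (q \<alpha> z) / norm (z - w) * l2norm V (c \<alpha>)
        \<and> cmod (q \<alpha> z) / norm (z - w) * l2norm V (c \<alpha>) \<le> (2 * K) * (W \<alpha> * l2norm V (c \<alpha>))"
      using near
    proof eventually_elim
      case (elim z)
      then show ?case
        using mult_right_mono[OF qb[of z] l2norm_nonneg] by (auto simp: mult.assoc)
    qed
    show "(\<lambda>\<alpha>. (2 * K) * (W \<alpha> * l2norm V (c \<alpha>))) summable_on UNIV"
      by (rule summable_on_cmult_right[OF Wsum])
  qed (use K W0 in auto)
  have "((\<lambda>z. l2norm V (\<lambda>v. power_series c z v - power_series c w v - (\<Sum>j\<in>UNIV. (z $ j - w $ j) * D j v))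
      / norm (z - w)) \<longlongrightarrow> 0) (at w)"
  proof (rule Lim_null_comparison[OF _ lim])
    show "\<forall>\<^sub>F z in at w. norm (l2norm V (\<lambda>v. power_series c z v - power_series c w v
        - (\<Sum>j\<in>UNIV. (z $ j - w $ j) * D j v)) / norm (z - w))
        \<le> infsum (\<lambda>\<alpha>. cmod (q \<alpha> z) / norm (z - w) * l2norm V (c \<alpha>)) UNIV"
      using near
    proof eventually_elim
      case (elim z)
      then have z: "z \<in> polydisc r"
        by simp
      have qs: "(\<lambda>\<alpha>. cmod (q \<alpha> z) / norm (z - w) * l2norm V (c \<alpha>)) summable_on UNIV"
      proof (rule summable_on_comparison_test[OF summable_on_cmult_right[OF Wsum, of "2 * K"]])
        show "cmod (q \<alpha> z) / norm (z - w) * l2norm V (c \<alpha>) \<le> 2 * K * (W \<alpha> * l2norm V (c \<alpha>))" for \<alpha>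
          using mult_right_mono[OF qb[of z \<alpha>], of "l2norm V (c \<alpha>)"] elim by (simp add: mult_ac)
      qed auto
      have qs': "(\<lambda>\<alpha>. l2norm V (\<lambda>v. q \<alpha> z * c \<alpha> v)) summable_on UNIV"
        using summable_on_cmult_right[OF qs, of "norm (z - w)"] elim by (simp add: l2norm_scale)
      have "((\<lambda>\<alpha>. monom_at z \<alpha> * c \<alpha> v - monom_at w \<alpha> * c \<alpha> v - (\<Sum>j\<in>UNIV. (z $ j - w $ j) * (dmonom_at w j \<alpha> * c \<alpha> v)))
          has_sum (power_series c z v - power_series c w v - (\<Sum>j\<in>UNIV. (z $ j - w $ j) * D j v))) UNIV" for v
        unfolding D_def
        by (intro has_sum_diff has_sum_sum finite has_sum_cmult_right power_series_has_sum[OF c z] power_series_has_sum[OF c w]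
            l2_infsum_has_sum[OF Dterm Dsum])
      moreover have "monom_at z \<alpha> * c \<alpha> v - monom_at w \<alpha> * c \<alpha> v - (\<Sum>j\<in>UNIV. (z $ j - w $ j) * (dmonom_at w j \<alpha> * c \<alpha> v))
          = q \<alpha> z * c \<alpha> v" for v \<alpha>
        by (simp add: q_def left_diff_distrib sum_distrib_right mult.assoc)
      ultimately have "(\<lambda>v. power_series c z v - power_series c w v - (\<Sum>j\<in>UNIV. (z $ j - w $ j) * D j v))
          = l2_infsum (\<lambda>\<alpha> v. q \<alpha> z * c \<alpha> v) UNIV"
        unfolding l2_infsum_def by (intro ext infsumI[symmetric]) simp
      then have "l2norm V (\<lambda>v. power_series c z v - power_series c w v - (\<Sum>j\<in>UNIV. (z $ j - w $ j) * D j v))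
          \<le> infsum (\<lambda>\<alpha>. l2norm V (\<lambda>v. q \<alpha> z * c \<alpha> v)) UNIV"
        using l2norm_l2_infsum_le[OF l2_scale[OF cl2] qs'] by simp
      also have "\<dots> = infsum (\<lambda>\<alpha>. norm (z - w) * (cmod (q \<alpha> z) / norm (z - w) * l2norm V (c \<alpha>))) UNIV"
        by (rule infsum_cong) (use elim in \<open>simp add: l2norm_scale\<close>)
      also have "\<dots> = norm (z - w) * infsum (\<lambda>\<alpha>. cmod (q \<alpha> z) / norm (z - w) * l2norm V (c \<alpha>)) UNIV"
        by (rule infsum_cmult_right[OF qs])
      finally show ?case
        using elim by (simp add: divide_le_eq mult.commute)
    qed
  qed
  then have "((\<lambda>z. l2norm V (\<lambda>v. power_series c z v - power_series c w v - (\<Sum>j\<in>UNIV. (z $ j - w $ j) * D j v))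
      / norm (z - w)) \<longlongrightarrow> 0) (at w within polydisc r)"
    by (rule tendsto_mono[OF at_le, rotated]) simp
  moreover have "D j \<in> l2 V" for j
    unfolding D_def by (rule l2_infsum_in_l2[OF Dterm Dsum])
  ultimately show "\<exists>D. (\<forall>j. D j \<in> l2 V) \<and> ((\<lambda>z. l2norm V (\<lambda>v. power_series c z v - power_series c w v
      - (\<Sum>j\<in>UNIV. (z $ j - w $ j) * D j v)) / norm (z - w)) \<longlongrightarrow> 0) (at w within polydisc r)"
    by blast
qed

text \<open>Differentiability in norm gives continuity of each coordinate. This is what extends the
  vanishing of a model function across the hyperplane z_j = 0.\<close>

lemma l2_holomorphic_on_pointwise_continuous:
  fixes w :: "complex^'d::finite"
  assumes F: "l2_holomorphic_on V F \<Omega>" and Fl2: "\<And>z. z \<in> \<Omega> \<Longrightarrow> F z \<in> l2 V" and w: "w \<in> \<Omega>"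
  shows "((\<lambda>z. F z v) \<longlongrightarrow> F w v) (at w within \<Omega>)"
proof -
  obtain D where D: "\<And>j. D j \<in> l2 V"
    and lim: "((\<lambda>z. l2norm V (\<lambda>v. F z v - F w v - (\<Sum>j\<in>UNIV. (z $ j - w $ j) * D j v)) / norm (z - w)) \<longlongrightarrow> 0)
      (at w within \<Omega>)"
    using F w unfolding l2_holomorphic_on_def by blast
  have "((\<lambda>z. (F z v - F w v - (\<Sum>j\<in>UNIV. (z $ j - w $ j) * D j v))) \<longlongrightarrow> 0) (at w within \<Omega>)"
  proof (rule Lim_null_comparison)
    have "((\<lambda>z. norm (z - w)) \<longlongrightarrow> norm (w - w)) (at w within \<Omega>)"
      by (intro tendsto_intros)
    from tendsto_mult[OF lim this]
    show "((\<lambda>z. l2norm V (\<lambda>v. F z v - F w v - (\<Sum>j\<in>UNIV. (z $ j - w $ j) * D j v)) / norm (z - w) * norm (z - w))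
        \<longlongrightarrow> 0) (at w within \<Omega>)"
      by simp
    have "\<forall>\<^sub>F z in at w within \<Omega>. z \<in> \<Omega> \<and> z \<noteq> w"
      by (simp add: eventually_at_filter)
    then show "\<forall>\<^sub>F z in at w within \<Omega>. norm (F z v - F w v - (\<Sum>j\<in>UNIV. (z $ j - w $ j) * D j v))
        \<le> l2norm V (\<lambda>v. F z v - F w v - (\<Sum>j\<in>UNIV. (z $ j - w $ j) * D j v)) / norm (z - w) * norm (z - w)"
    proof eventually_elim
      case (elim z)
      have "(\<lambda>v. F z v - F w v - (\<Sum>j\<in>UNIV. (z $ j - w $ j) * D j v)) \<in> l2 V"
        by (intro l2_diff l2_sum l2_scale D Fl2) (use elim w in auto)
      from cmod_le_l2norm[OF this, of v] show ?case
        using elim by simp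
    qed
  qed
  moreover have "((\<lambda>z. F w v + (\<Sum>j\<in>UNIV. (z $ j - w $ j) * D j v)) \<longlongrightarrow> F w v + (\<Sum>j\<in>UNIV. (w $ j - w $ j) * D j v))
      (at w within \<Omega>)"
    by (intro tendsto_intros)
  ultimately have "((\<lambda>z. (F z v - F w v - (\<Sum>j\<in>UNIV. (z $ j - w $ j) * D j v))
      + (F w v + (\<Sum>j\<in>UNIV. (z $ j - w $ j) * D j v))) \<longlongrightarrow> 0 + (F w v + (\<Sum>j\<in>UNIV. (w $ j - w $ j) * D j v)))
      (at w within \<Omega>)"
    by (rule tendsto_add)
  then show ?thesis
    by simp
qed

subsection \<open>Multi-index powers of commuting operators\<close>

text \<open>The list of factors becomes a parameter, so that facts about \<open>mpow\<close> can be
  proved by induction on it.\<close>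

definition mpow_list :: "'d list \<Rightarrow> ('d \<Rightarrow> 'v op) \<Rightarrow> ('d \<Rightarrow> nat) \<Rightarrow> 'v op" where
  "mpow_list xs T \<alpha> = foldr (\<lambda>j acc. (T j ^^ \<alpha> j) \<circ> acc) xs id"

lemma mpow_list_simps:
  "mpow_list [] T \<alpha> f = f" "mpow_list (j # xs) T \<alpha> f = (T j ^^ \<alpha> j) (mpow_list xs T \<alpha> f)"
  by (simp_all add: mpow_list_def)

lemma mpow_eq_mpow_list: "mpow T = mpow_list (sorted_list_of_set UNIV) T"
  by (simp add: mpow_def mpow_list_def fun_eq_iff)

lemma bounded_op_mpow_list: "(\<And>j. bounded_op V (T j)) \<Longrightarrow> bounded_op V (mpow_list xs T \<alpha>)"
  by (induction xs) (simp_all add: mpow_list_def id_def bounded_op_id bounded_op_comp bounded_op_funpow)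

lemma bounded_op_mpow: "(\<And>j. bounded_op V (T j)) \<Longrightarrow> bounded_op V (mpow T \<alpha>)"
  unfolding mpow_eq_mpow_list by (rule bounded_op_mpow_list)

lemma funpow_commuting:
  assumes T: "\<And>j. bounded_op V (T j)" and comm: "commuting V T" and f: "f \<in> l2 V"
  shows "(T i ^^ n) (T j f) = T j ((T i ^^ n) f)"
proof (induction n)
  case (Suc n)
  have "T i (T j ((T i ^^ n) f)) = T j (T i ((T i ^^ n) f))"
    using comm bounded_op_l2[OF bounded_op_funpow[OF T] f] unfolding commuting_def by blast
  with Suc show ?case
    by simp
qed simp

text \<open>Commutativity carries the extra factor T j out past the factors with other indices;
  distinctness guarantees that raising \<alpha> j changes a single factor.\<close>

lemma mpow_list_Suc:
  assumes T: "\<And>j. bounded_op V (T j)" and comm: "commuting V T" and f: "f \<in> l2 V"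
    and "distinct xs" "j \<in> set xs"
  shows "mpow_list xs T (\<alpha>(j := Suc (\<alpha> j))) f = T j (mpow_list xs T \<alpha> f)"
  using assms(4,5)
proof (induction xs)
  case (Cons i xs)
  have l2: "mpow_list xs T \<alpha> f \<in> l2 V"
    by (rule bounded_op_l2[OF bounded_op_mpow_list[OF T] f])
  show ?case
  proof (cases "i = j")
    case True
    have "mpow_list ys T (\<alpha>(j := Suc (\<alpha> j))) f = mpow_list ys T \<alpha> f" if "j \<notin> set ys" for ys
      using that by (induction ys) (auto simp: mpow_list_simps)
    then have e: "mpow_list xs T (\<alpha>(j := Suc (\<alpha> j))) f = mpow_list xs T \<alpha> f"
      using True Cons.prems by simp
    show ?thesis
      unfolding True mpow_list_simps e by simp
  next
    case False
    with Cons show ?thesis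
      by (simp add: mpow_list_simps funpow_commuting[OF T comm l2])
  qed
qed simp

lemma mpow_Suc:
  assumes "\<And>j. bounded_op V (T j)" "commuting V T" "f \<in> l2 V"
  shows "mpow T (\<alpha>(j := Suc (\<alpha> j))) f = T j (mpow T \<alpha> f)"
  unfolding mpow_eq_mpow_list by (rule mpow_list_Suc[OF assms]) auto

lemma mpow_0: "mpow T (\<lambda>_. 0) f = f"
proof -
  have "mpow_list xs T (\<lambda>_. 0) f = f" for xs
    by (induction xs) (simp_all add: mpow_list_simps)
  then show ?thesis
    by (simp add: mpow_eq_mpow_list)
qed

lemma mpow_list_bound:
  assumes T: "\<And>j. bounded_op V (T j)" and \<rho>: "\<And>j. 0 < \<rho> j" and M: "\<And>j. 0 \<le> M j"
    and b: "\<And>j n f. f \<in> l2 V \<Longrightarrow> l2norm V ((T j ^^ n) f) * \<rho> j ^ n \<le> M j * l2norm V f"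
    and f: "f \<in> l2 V"
  shows "l2norm V (mpow_list xs T \<alpha> f) * (\<Prod>j\<leftarrow>xs. \<rho> j ^ \<alpha> j) \<le> (\<Prod>j\<leftarrow>xs. M j) * l2norm V f"
proof (induction xs)
  case (Cons i xs)
  let ?g = "mpow_list xs T \<alpha> f" and ?p = "\<Prod>j\<leftarrow>xs. \<rho> j ^ \<alpha> j"
  have p: "?p \<ge> 0"
    using \<rho> by (intro prod_list_nonneg) (auto simp: less_imp_le)
  have "l2norm V ((T i ^^ \<alpha> i) ?g) * \<rho> i ^ \<alpha> i * ?p \<le> M i * l2norm V ?g * ?p"
    by (intro mult_right_mono b bounded_op_l2[OF bounded_op_mpow_list[OF T] f] p)
  also have "\<dots> \<le> M i * ((\<Prod>j\<leftarrow>xs. M j) * l2norm V f)"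
    using mult_left_mono[OF Cons M[of i]] by (simp add: mult_ac)
  finally show ?case
    by (simp add: mpow_list_simps mult_ac)
qed (simp add: mpow_list_simps)

lemma mpow_bound:
  fixes T :: "'d::{finite,linorder} \<Rightarrow> 'v op"
  assumes "\<And>j. bounded_op V (T j)" "\<And>j. 0 < \<rho> j" "\<And>j. 0 \<le> M j"
    and "\<And>j n f. f \<in> l2 V \<Longrightarrow> l2norm V ((T j ^^ n) f) * \<rho> j ^ n \<le> M j * l2norm V f"
    and "f \<in> l2 V"
  shows "l2norm V (mpow T \<alpha> f) * (\<Prod>j\<in>UNIV. \<rho> j ^ \<alpha> j) \<le> (\<Prod>j\<in>UNIV. M j) * l2norm V f"
proof -
  have "(\<Prod>j\<leftarrow>sorted_list_of_set UNIV. h j) = (\<Prod>j\<in>UNIV. h j)" for h :: "'d \<Rightarrow> real"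
    by (subst prod.distinct_set_conv_list[symmetric]) auto
  then show ?thesis
    using mpow_list_bound[where xs = "sorted_list_of_set UNIV" and \<alpha> = \<alpha>, OF assms] by (simp add: mpow_eq_mpow_list)
qed

subsection \<open>Rooted trees and depth\<close>

lemma tree_root_props:
  assumes "rooted_tree V E"
  shows "tree_root V E \<in> V" and "(u, tree_root V E) \<notin> E"
    and "v \<in> V \<Longrightarrow> v \<noteq> tree_root V E \<Longrightarrow> \<exists>u. (u, v) \<in> E"
proof -
  have ex: "\<exists>!r. r \<in> V \<and> (\<forall>u. (u, r) \<notin> E)"
    using assms by (simp add: rooted_tree_def)
  from theI'[OF ex] show "tree_root V E \<in> V" "(u, tree_root V E) \<notin> E"
    by (auto simp: tree_root_def)
  show "\<exists>u. (u, v) \<in> E" if "v \<in> V" "v \<noteq> tree_root V E"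
    using the1_equality[OF ex, of v] that unfolding tree_root_def by blast
qed

lemma tree_edge_in: "rooted_tree V E \<Longrightarrow> (u, v) \<in> E \<Longrightarrow> u \<in> V \<and> v \<in> V"
  by (auto simp: rooted_tree_def directed_tree_def)

lemma tree_parent_unique: "rooted_tree V E \<Longrightarrow> (u, v) \<in> E \<Longrightarrow> (u', v) \<in> E \<Longrightarrow> u = u'"
  by (auto simp: rooted_tree_def directed_tree_def)

lemma tree_parent_eq: "rooted_tree V E \<Longrightarrow> (u, v) \<in> E \<Longrightarrow> tree_parent E v = u"
  unfolding tree_parent_def by (rule the_equality) (auto dest: tree_parent_unique)

lemma tree_parent_edge:
  assumes "rooted_tree V E" "v \<in> V" "v \<noteq> tree_root V E"
  shows "(tree_parent E v, v) \<in> E"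
  using tree_root_props(3)[OF assms] tree_parent_eq[OF assms(1)] by blast

text \<open>Follow an undirected path from the root. A forward edge prolongs the directed path; a
  backward edge leads to the unique parent, which is where the directed path was one step
  earlier.\<close>

lemma root_reaches:
  assumes t: "rooted_tree V E" and v: "v \<in> V"
  shows "(tree_root V E, v) \<in> E\<^sup>*"
proof -
  have "(tree_root V E, v) \<in> (E \<union> E\<inverse>)\<^sup>*"
    using t v tree_root_props(1)[OF t] by (auto simp: rooted_tree_def directed_tree_def)
  then show ?thesis
  proof (induction rule: rtrancl_induct)
    case (step u v)
    from step.hyps(2) show ?case
    proof
      assume "(u, v) \<in> E"
      with step.IH show ?thesis by auto
    next
      assume "(u, v) \<in> E\<inverse>"
      then have vu: "(v, u) \<in> E" by simp
      from step.IH show ?thesis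
      proof (cases rule: rtranclE)
        case base
        with vu tree_root_props(2)[OF t] show ?thesis by metis
      next
        case (step y)
        with vu tree_parent_unique[OF t] show ?thesis by blast
      qed
    qed
  qed simp
qed

text \<open>Two directed paths from the root to u agree when read backwards, since parents are
  unique, and they end together, since nothing enters the root.\<close>

lemma tree_depth_eqI:
  assumes t: "rooted_tree V E" and n: "(tree_root V E, u) \<in> E ^^ n"
  shows "tree_depth V E u = n"
proof -
  have uniq: "m = n" if "(tree_root V E, u) \<in> E ^^ n" "(tree_root V E, u) \<in> E ^^ m" for u m n
    using that
  proof (induction n arbitrary: u m)
    case 0
    then show ?case
      using tree_root_props(2)[OF t] by (cases m) auto
  next
    case (Suc n)
    then obtain y where y: "(tree_root V E, y) \<in> E ^^ n" "(y, u) \<in> E"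
      by auto
    then obtain k where k: "m = Suc k"
      using Suc.prems(2) tree_root_props(2)[OF t] by (cases m) auto
    then obtain y' where "(tree_root V E, y') \<in> E ^^ k" "(y', u) \<in> E"
      using Suc.prems(2) by auto
    with y Suc.IH k tree_parent_unique[OF t] show ?case
      by metis
  qed
  show ?thesis
    unfolding tree_depth_def by (rule the_equality) (use n uniq in blast)+
qed

lemma tree_depth_root: "rooted_tree V E \<Longrightarrow> tree_depth V E (tree_root V E) = 0"
  by (rule tree_depth_eqI) auto

lemma tree_depth_edge:
  assumes t: "rooted_tree V E" and e: "(u, v) \<in> E"
  shows "tree_depth V E v = Suc (tree_depth V E u)"
proof -
  obtain n where n: "(tree_root V E, u) \<in> E ^^ n"
    using root_reaches[OF t] tree_edge_in[OF t e] rtrancl_power by metis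
  then have "(tree_root V E, v) \<in> E ^^ Suc n"
    using e by auto
  with n show ?thesis
    using tree_depth_eqI[OF t] by metis
qed

text \<open>The index is at least one more than the depth of any branching vertex, so the parent of
  a vertex strictly deeper than the index cannot branch.\<close>

lemma only_child_below_branching_index:
  assumes t: "rooted_tree V E" and lf: "locally_finite_tree V E" and v: "v \<in> V"
    and deep: "branching_index V E < enat (tree_depth V E v)"
  shows "v \<noteq> tree_root V E" and "Chi E (tree_parent E v) = {v}"
proof -
  show root: "v \<noteq> tree_root V E"
    using deep tree_depth_root[OF t] by (auto simp: zero_enat_def[symmetric])
  let ?p = "tree_parent E v"
  have e: "(?p, v) \<in> E"
    by (rule tree_parent_edge[OF t v root])
  then have pV: "?p \<in> V"
    using tree_edge_in[OF t] by blast
  have "?p \<notin> branching_vertices V E"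
  proof
    assume p: "?p \<in> branching_vertices V E"
    have "enat (tree_depth V E v) = 1 + enat (tree_depth V E ?p)"
      by (simp add: tree_depth_edge[OF t e] one_enat_def)
    also have "\<dots> \<le> 1 + (SUP w\<in>branching_vertices V E. enat (tree_depth V E w))"
      by (intro add_left_mono SUP_upper p)
    also have "\<dots> = branching_index V E"
      using p by (auto simp: branching_index_def)
    finally show False
      using deep by simp
  qed
  then have "card (Chi E ?p) < 2"
    using pV by (simp add: branching_vertices_def)
  \<comment> \<open>Local finiteness rules out an infinite set of children, to which
    \<open>card\<close> would assign 0.\<close>
  moreover have "finite (Chi E ?p)" "v \<in> Chi E ?p"
    using lf pV e by (auto simp: locally_finite_tree_def Chi_def)
  ultimately have "card (Chi E ?p) = 1"
    using card_gt_0_iff[of "Chi E ?p"] by force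
  then show "Chi E ?p = {v}"
    using \<open>v \<in> Chi E ?p\<close> by (metis card_1_singletonE singletonD)
qed

subsection \<open>Restriction to sets of vertices\<close>

definition l2_restrict :: "'v set \<Rightarrow> ('v \<Rightarrow> complex) \<Rightarrow> 'v \<Rightarrow> complex" where
  "l2_restrict A f = (\<lambda>v. if v \<in> A then f v else 0)"

lemma bounded_op_restrict: "bounded_op V (l2_restrict A)"
proof (rule bounded_opI[where C = 1])
  fix f assume f: "f \<in> l2 V"
  have b: "L2_set (\<lambda>v. cmod (l2_restrict A f v)) F \<le> l2norm V f" if "finite F" "F \<subseteq> V" for F
  proof -
    have "L2_set (\<lambda>v. cmod (l2_restrict A f v)) F \<le> L2_set (\<lambda>v. cmod (f v)) F"
      by (intro L2_set_mono) (auto simp: l2_restrict_def)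
    also have "\<dots> \<le> l2norm V f"
      by (intro L2_set_le_l2norm f that)
    finally show ?thesis .
  qed
  have z: "l2_restrict A f v = 0" if "v \<notin> V" for v
    using l2_D0[OF f that] by (simp add: l2_restrict_def)
  show "l2_restrict A f \<in> l2 V" "l2norm V (l2_restrict A f) \<le> 1 * l2norm V f"
    using l2_boundI[OF z l2norm_nonneg b] by auto
qed (auto simp: l2_restrict_def)

lemma l2inner_restrict: "l2inner V (l2_restrict A f) g = l2inner V f (l2_restrict A g)"
  unfolding l2inner_def l2_restrict_def by (rule infsum_cong) auto

lemma l2inner_disjoint:
  assumes "\<And>v. v \<in> V \<Longrightarrow> f v = 0 \<or> g v = 0"
  shows "l2inner V f g = 0"
  unfolding l2inner_def by (rule infsum_0) (use assms in fastforce)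

subsection \<open>Left invertible tuples and their Cauchy duals\<close>

text \<open>Adding one to coordinate j is a bijection onto the multi-indices with \<alpha> j
  \<noteq> 0; the split isolates the part of a power series that is divisible by z_j.\<close>

lemma has_sum_multiindex_split:
  fixes g :: "('d \<Rightarrow> nat) \<Rightarrow> complex"
  assumes a: "((\<lambda>\<alpha>. g (\<alpha>(j := Suc (\<alpha> j)))) has_sum a) UNIV"
    and b: "((\<lambda>\<alpha>. if \<alpha> j = 0 then g \<alpha> else 0) has_sum b) UNIV"
  shows "(g has_sum (a + b)) UNIV"
proof -
  let ?h = "\<lambda>\<alpha>. \<alpha>(j := Suc (\<alpha> j)) :: 'd \<Rightarrow> nat"
  have inj: "inj ?h"
  proof (rule injI)
    fix \<alpha> \<beta> :: "'d \<Rightarrow> nat" assume e: "?h \<alpha> = ?h \<beta>"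
    show "\<alpha> = \<beta>"
    proof
      fix i show "\<alpha> i = \<beta> i"
        using fun_cong[OF e, of i] by (cases "i = j") auto
    qed
  qed
  have range: "range ?h = {\<alpha>. \<alpha> j \<noteq> 0}"
  proof (intro set_eqI iffI)
    fix \<alpha> :: "'d \<Rightarrow> nat" assume "\<alpha> \<in> {\<alpha>. \<alpha> j \<noteq> 0}"
    then have "\<alpha> = ?h (\<alpha>(j := \<alpha> j - 1))"
      by auto
    then show "\<alpha> \<in> range ?h"
      by blast
  qed auto
  have "(g has_sum a) {\<alpha>. \<alpha> j \<noteq> 0}"
    using a has_sum_reindex[OF inj, of g a] by (simp add: range comp_def)
  moreover have "(g has_sum b) {\<alpha>. \<alpha> j = 0}"
    using b by (subst has_sum_cong_neutral[where g = "\<lambda>\<alpha>. if \<alpha> j = 0 then g \<alpha> else 0" and T = UNIV]) auto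
  ultimately have "(g has_sum (a + b)) ({\<alpha>. \<alpha> j \<noteq> 0} \<union> {\<alpha>. \<alpha> j = 0})"
    by (rule has_sum_Un_disjoint) auto
  moreover have "{\<alpha>. \<alpha> j \<noteq> 0} \<union> {\<alpha>. \<alpha> j = 0} = (UNIV :: ('d \<Rightarrow> nat) set)"
    by auto
  ultimately show ?thesis
    by simp
qed

text \<open>The grading \<open>lev\<close> of the basis plays the role of the total depth: each \<open>S j\<close> raises it by one.\<close>

locale left_invertible_tuple =
  fixes V :: "'v set" and S :: "'d::{finite,linorder} \<Rightarrow> 'v op" and lev :: "'v \<Rightarrow> nat"
  assumes V_nonempty: "V \<noteq> {}"
    and S: "\<And>j. bounded_op V (S j)"
    and linv: "\<And>j. invertible_op V (adjoint V (S j) \<circ> S j)"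
    and dual_commuting: "commuting V (cauchy_dual V S)"
    and kernel_condition: "\<And>j \<alpha>. (\<Inter>j. op_kernel V (adjoint V (S j)))
          \<subseteq> op_kernel V (adjoint V (S j) \<circ> mpow (cauchy_dual V S) (\<alpha>(j := 0)))"
    and S_lev_0: "\<And>j f. f \<in> l2 V \<Longrightarrow> l2_restrict {v. lev v = 0} (S j f) = (\<lambda>v. 0)"
    and S_lev_Suc: "\<And>j f n. f \<in> l2 V \<Longrightarrow>
          l2_restrict {v. lev v = Suc n} (S j f) = S j (l2_restrict {v. lev v = n} f)"
begin

definition "T = cauchy_dual V S"
definition "E = (\<Inter>j. op_kernel V (adjoint V (S j)))"
definition "r j = inverse (spectral_radius V (T j))"
definition "gram_inv j = inverse_op V (adjoint V (S j) \<circ> S j)"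

abbreviation "restr \<equiv> l2_restrict :: 'v set \<Rightarrow> ('v \<Rightarrow> complex) \<Rightarrow> 'v \<Rightarrow> complex"
abbreviation "L j \<equiv> adjoint V (T j)"

lemma T_eq: "T j f = S j (gram_inv j f)"
  by (simp add: T_def cauchy_dual_def gram_inv_def)

lemma gram_inv: "bounded_op V (gram_inv j)"
  unfolding gram_inv_def by (rule bounded_op_inverse[OF linv])

lemma gram_inv_left: "f \<in> l2 V \<Longrightarrow> gram_inv j (adjoint V (S j) (S j f)) = f"
  using inverse_op_left[OF linv, of f j] by (simp add: gram_inv_def)

lemma gram_inv_right: "f \<in> l2 V \<Longrightarrow> adjoint V (S j) (S j (gram_inv j f)) = f"
  using inverse_op_right[OF linv, of f j] by (simp add: gram_inv_def)

lemma T: "bounded_op V (T j)"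
proof -
  have "T j = S j \<circ> gram_inv j"
    by (simp add: fun_eq_iff T_eq)
  then show ?thesis
    by (simp add: bounded_op_comp[OF S gram_inv])
qed

lemma mpow_T: "bounded_op V (mpow T \<alpha>)"
  by (rule bounded_op_mpow) (rule T)

lemmas adjS = bounded_op_adjoint[OF S]
lemmas adjT = bounded_op_adjoint[OF T]
lemmas in_l2 = bounded_op_l2[OF S] bounded_op_l2[OF T] bounded_op_l2[OF adjS] bounded_op_l2[OF adjT]
  bounded_op_l2[OF gram_inv] bounded_op_l2[OF mpow_T] bounded_op_l2[OF bounded_op_restrict]

lemma adjS_T: "f \<in> l2 V \<Longrightarrow> adjoint V (S j) (T j f) = f"
  by (simp add: T_eq gram_inv_right)

text \<open>The weak form of L_j S_j = I; it mirrors \<open>adjS_T\<close>, by which T j is a right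
  inverse of the adjoint of S j.\<close>

lemma S_inner_T:
  assumes f: "f \<in> l2 V" and g: "g \<in> l2 V"
  shows "l2inner V (S j f) (T j g) = l2inner V f g"
  using adjoint_inner[OF S f in_l2(2)[OF g], of j j] by (simp add: adjS_T[OF g])

text \<open>S j is T j composed with the Gram operator, so its range lies in that of T j, and
  orthogonality to the larger range implies orthogonality to the smaller.\<close>

lemma adjS_eq_0_if_adjT_eq_0:
  assumes g: "g \<in> l2 V" and 0: "L j g = (\<lambda>v. 0)"
  shows "adjoint V (S j) g = (\<lambda>v. 0)"
proof (rule l2_eqI)
  fix f assume f: "f \<in> l2 V"
  let ?h = "adjoint V (S j) (S j f)"
  have h: "?h \<in> l2 V"
    by (intro in_l2 f)
  have "l2inner V (adjoint V (S j) g) f = l2inner V g (S j f)"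
    by (rule adjoint_inner'[OF S f g])
  also have "S j f = T j ?h"
    by (simp add: T_eq gram_inv_left[OF f])
  also have "l2inner V g (T j ?h) = l2inner V (L j g) ?h"
    by (rule adjoint_inner'[OF T h g, symmetric])
  finally show "l2inner V (adjoint V (S j) g) f = l2inner V (\<lambda>v. 0) f"
    by (simp add: 0)
qed (use g in \<open>auto intro: in_l2\<close>)

lemma mpow_T_Suc: "f \<in> l2 V \<Longrightarrow> mpow T (\<alpha>(j := Suc (\<alpha> j))) f = T j (mpow T \<alpha> f)"
  by (rule mpow_Suc[OF T]) (simp_all add: T_def dual_commuting)

lemma E_subspace: "l2_subspace V E"
  unfolding E_def by (intro l2_subspace_INT l2_subspace_op_kernel adjS)

lemma E_l2: "e \<in> E \<Longrightarrow> e \<in> l2 V"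
  using E_subspace by (auto simp: l2_subspace_def)

lemma E_lincomb: "f \<in> E \<Longrightarrow> g \<in> E \<Longrightarrow> (\<lambda>v. a * f v + b * g v) \<in> E"
  using E_subspace by (auto simp: l2_subspace_def)

lemma zero_in_E: "(\<lambda>v. 0) \<in> E"
  using E_subspace by (auto simp: l2_subspace_def)

text \<open>E is the orthogonal complement of all ranges of the S j. In this form membership passes
  to sums of series and to restrictions.\<close>

lemma E_iff: "g \<in> E \<longleftrightarrow> g \<in> l2 V \<and> (\<forall>j. \<forall>f\<in>l2 V. l2inner V g (S j f) = 0)"
proof
  assume g: "g \<in> E"
  have "l2inner V g (S j f) = 0" if "f \<in> l2 V" for j f
    using adjoint_inner'[OF S[of j] that E_l2[OF g]] g by (auto simp: E_def op_kernel_def)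
  then show "g \<in> l2 V \<and> (\<forall>j. \<forall>f\<in>l2 V. l2inner V g (S j f) = 0)"
    using E_l2[OF g] by blast
next
  assume g: "g \<in> l2 V \<and> (\<forall>j. \<forall>f\<in>l2 V. l2inner V g (S j f) = 0)"
  have "adjoint V (S j) g = (\<lambda>v. 0)" for j
    by (rule l2_eqI) (use g in \<open>auto intro: in_l2 simp: adjoint_inner'[OF S]\<close>)
  then show "g \<in> E"
    using g by (auto simp: E_def op_kernel_def)
qed

lemma E_eqI:
  assumes p: "p \<in> E" and q: "q \<in> E" and eq: "\<And>e. e \<in> E \<Longrightarrow> l2inner V p e = l2inner V q e"
  shows "p = q"
proof -
  have d: "(\<lambda>v. p v - q v) \<in> E"
    using E_lincomb[OF p q, of 1 "-1"] by simp
  have "l2inner V (\<lambda>v. p v - q v) (\<lambda>v. p v - q v) = 0"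
    using eq[OF d] by (subst l2inner_diff_left) (auto intro: E_l2 p q d)
  then show ?thesis
    using l2inner_self_eq_0_iff[OF E_l2[OF d]] by (simp add: fun_eq_iff)
qed

text \<open>The product over i \<noteq> j in the kernel condition is encoded by
  \<open>\<alpha>(j := 0)\<close>, which here is \<alpha> itself. This is the form in which the
  condition acts on coefficients.\<close>

lemma S_orth_mpow_E:
  assumes "e \<in> E" "\<alpha> j = 0" "f \<in> l2 V"
  shows "l2inner V (S j f) (mpow T \<alpha> e) = 0"
proof -
  have "\<alpha>(j := 0) = \<alpha>"
    using assms(2) by auto
  then have "adjoint V (S j) (mpow T \<alpha> e) = (\<lambda>v. 0)"
    using kernel_condition[of j \<alpha>] assms(1) by (auto simp: E_def T_def op_kernel_def)
  then show ?thesis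
    using adjoint_inner[OF S[of j] assms(3) bounded_op_l2[OF mpow_T E_l2[OF assms(1)]], of \<alpha>]
    by (metis l2inner_zero(2))
qed

subsection \<open>Growth of the powers of the Cauchy dual\<close>

text \<open>The adjoint of S j is a left inverse of T j, and a unit vector at a point of V supplies
  the non-zero vector on which the positivity argument runs.\<close>

lemma
  shows r_pos: "r j > 0"
    and T_growth: "0 < \<rho> \<Longrightarrow> \<rho> < r j \<Longrightarrow> \<exists>M\<ge>0. \<forall>n. \<forall>f\<in>l2 V. l2norm V ((T j ^^ n) f) * \<rho> ^ n \<le> M * l2norm V f"
proof -
  obtain u where u: "u \<in> V"
    using V_nonempty by blast
  have "unit_vec u u = (1::complex)"
    by (simp add: unit_vec_def)
  then have x: "unit_vec u \<in> l2 V" "unit_vec u \<noteq> (\<lambda>v. 0)"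
    using unit_vec_l2[OF u] by auto
  note sr = T[of j] adjS[of j] adjS_T[of _ j] x
  show "r j > 0"
    unfolding r_def using spectral_radius_pos[OF sr] by simp
  show "\<exists>M\<ge>0. \<forall>n. \<forall>f\<in>l2 V. l2norm V ((T j ^^ n) f) * \<rho> ^ n \<le> M * l2norm V f" if "0 < \<rho>" "\<rho> < r j"
    using funpow_bound_spectral_radius[OF sr] that unfolding r_def by blast
qed

lemma mpow_growth:
  assumes \<rho>: "\<And>j. 0 < \<rho> j" "\<And>j. \<rho> j < r j"
  shows "\<exists>M\<ge>0. \<forall>\<alpha>. \<forall>f\<in>l2 V. l2norm V (mpow T \<alpha> f) * (\<Prod>j\<in>UNIV. \<rho> j ^ \<alpha> j) \<le> M * l2norm V f"
proof -
  have "\<forall>j. \<exists>M\<ge>0. \<forall>n. \<forall>f\<in>l2 V. l2norm V ((T j ^^ n) f) * \<rho> j ^ n \<le> M * l2norm V f"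
    using T_growth \<rho> by blast
  then obtain M where M: "\<And>j. 0 \<le> M j"
    "\<And>j n f. f \<in> l2 V \<Longrightarrow> l2norm V ((T j ^^ n) f) * \<rho> j ^ n \<le> M j * l2norm V f"
    by metis
  show ?thesis
    using mpow_bound[OF T \<rho>(1) M] M(1) by (intro exI[of _ "\<Prod>j\<in>UNIV. M j"]) (auto intro: prod_nonneg)
qed

section \<open>Taylor coefficients of the model functions\<close>

definition "vcoeff \<alpha> f = orth_proj V E (adjoint V (mpow T \<alpha>) f)"

lemma adj_mpow_l2: "f \<in> l2 V \<Longrightarrow> adjoint V (mpow T \<alpha>) f \<in> l2 V"
  by (rule bounded_op_l2[OF bounded_op_adjoint[OF mpow_T]])

lemma coeff_E: "f \<in> l2 V \<Longrightarrow> vcoeff \<alpha> f \<in> E"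
  unfolding vcoeff_def by (intro orth_proj_in[OF E_subspace] adj_mpow_l2)

lemma coeff_l2: "f \<in> l2 V \<Longrightarrow> vcoeff \<alpha> f \<in> l2 V"
  by (rule E_l2[OF coeff_E])

text \<open>Projecting onto E is invisible to test vectors from E. Together with
  \<open>coeff_eqI\<close> this turns every identity between coefficients into one between inner
  products with T^\<alpha> e.\<close>

lemma coeff_inner:
  assumes f: "f \<in> l2 V" and e: "e \<in> E"
  shows "l2inner V (vcoeff \<alpha> f) e = l2inner V f (mpow T \<alpha> e)"
  unfolding vcoeff_def orth_proj_inner[OF E_subspace adj_mpow_l2[OF f] e]
  by (rule adjoint_inner'[OF mpow_T E_l2[OF e] f])

lemma coeff_eqI:
  assumes "f \<in> l2 V" "p \<in> E" "\<And>e. e \<in> E \<Longrightarrow> l2inner V f (mpow T \<alpha> e) = l2inner V p e"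
  shows "vcoeff \<alpha> f = p"
  by (rule E_eqI) (use assms in \<open>auto intro: coeff_E simp: coeff_inner\<close>)

lemma coeff_lincomb:
  assumes f: "f \<in> l2 V" and g: "g \<in> l2 V"
  shows "vcoeff \<alpha> (\<lambda>v. a * f v + b * g v) = (\<lambda>v. a * vcoeff \<alpha> f v + b * vcoeff \<alpha> g v)"
proof (rule coeff_eqI)
  fix e assume e: "e \<in> E"
  have m: "mpow T \<alpha> e \<in> l2 V"
    by (intro in_l2 E_l2 e)
  show "l2inner V (\<lambda>v. a * f v + b * g v) (mpow T \<alpha> e)
      = l2inner V (\<lambda>v. a * vcoeff \<alpha> f v + b * vcoeff \<alpha> g v) e"
    using f g m e by (simp add: l2inner_add_left l2inner_scale_left l2_scale coeff_l2 coeff_inner E_l2)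
qed (use f g in \<open>auto intro: l2_lincomb E_lincomb coeff_E\<close>)

text \<open>L_j is a backward shift on coefficients, while \<open>coeff_Suc_S\<close> and
  \<open>coeff_S_0\<close> make S j a forward shift, that is, multiplication by z_j.\<close>

lemma coeff_Suc: "f \<in> l2 V \<Longrightarrow> vcoeff (\<alpha>(j := Suc (\<alpha> j))) f = vcoeff \<alpha> (L j f)"
  by (rule coeff_eqI) (auto intro: coeff_E in_l2 E_l2 simp: coeff_inner in_l2 E_l2 mpow_T_Suc adjoint_inner'[OF T])

lemma coeff_Suc_S: "f \<in> l2 V \<Longrightarrow> vcoeff (\<alpha>(j := Suc (\<alpha> j))) (S j f) = vcoeff \<alpha> f"
  by (rule coeff_eqI) (auto intro: coeff_E in_l2 E_l2 simp: coeff_inner in_l2 E_l2 mpow_T_Suc S_inner_T)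

lemma coeff_S_0: "f \<in> l2 V \<Longrightarrow> \<alpha> j = 0 \<Longrightarrow> vcoeff \<alpha> (S j f) = (\<lambda>v. 0)"
  by (rule coeff_eqI) (auto intro: in_l2 zero_in_E simp: S_orth_mpow_E)

text \<open>By duality the squared norm of c = vcoeff \<alpha> f is <f, T^\<alpha> c>; the growth
  bound applies to T^\<alpha> c and one factor |c| cancels. M is the same for all f.\<close>

lemma coeff_growth:
  assumes "\<And>j. 0 < \<rho> j" "\<And>j. \<rho> j < r j"
  shows "\<exists>M\<ge>0. \<forall>\<alpha>. \<forall>f\<in>l2 V. l2norm V (vcoeff \<alpha> f) * (\<Prod>j\<in>UNIV. \<rho> j ^ \<alpha> j) \<le> M * l2norm V f"
proof -
  obtain M where M: "M \<ge> 0"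
    "\<And>\<alpha> f. f \<in> l2 V \<Longrightarrow> l2norm V (mpow T \<alpha> f) * (\<Prod>j\<in>UNIV. \<rho> j ^ \<alpha> j) \<le> M * l2norm V f"
    using mpow_growth[of \<rho>] assms by blast
  have "l2norm V (vcoeff \<alpha> f) * (\<Prod>j\<in>UNIV. \<rho> j ^ \<alpha> j) \<le> M * l2norm V f" if f: "f \<in> l2 V" for \<alpha> f
  proof (cases "l2norm V (vcoeff \<alpha> f) = 0")
    case True
    then show ?thesis
      using M(1) by simp
  next
    case False
    let ?c = "vcoeff \<alpha> f" and ?p = "\<Prod>j\<in>UNIV. \<rho> j ^ \<alpha> j"
    have p: "?p \<ge> 0"
      using assms(1) by (intro prod_nonneg) (simp add: less_imp_le)
    have c: "?c \<in> E" "?c \<in> l2 V"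
      using f coeff_E coeff_l2 by auto
    have "(l2norm V ?c)\<^sup>2 = cmod (l2inner V ?c ?c)"
      by (simp add: l2inner_self[OF c(2)] norm_power)
    also have "\<dots> = cmod (l2inner V f (mpow T \<alpha> ?c))"
      by (simp add: coeff_inner[OF f c(1)])
    also have "\<dots> \<le> l2norm V f * l2norm V (mpow T \<alpha> ?c)"
      by (intro l2_Cauchy_Schwarz f in_l2 c)
    finally have "(l2norm V ?c)\<^sup>2 * ?p \<le> l2norm V f * l2norm V (mpow T \<alpha> ?c) * ?p"
      by (rule mult_right_mono) (rule p)
    also have "\<dots> \<le> l2norm V f * (M * l2norm V ?c)"
      using mult_left_mono[OF M(2)[OF c(2)], of "l2norm V f" \<alpha>] by (simp add: mult.assoc)
    finally have "l2norm V ?c * (l2norm V ?c * ?p) \<le> l2norm V ?c * (M * l2norm V f)"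
      by (simp add: power2_eq_square mult_ac)
    with False show ?thesis
      by (simp add: mult_le_cancel_left order_less_le)
  qed
  then show ?thesis
    using M(1) by blast
qed

lemma polydisc_coeffs_coeff:
  assumes f: "f \<in> l2 V"
  shows "polydisc_coeffs V r (\<lambda>\<alpha>. vcoeff \<alpha> f)"
  unfolding polydisc_coeffs_def
proof (intro conjI allI impI)
  fix \<rho> assume "\<forall>j. 0 < \<rho> j \<and> \<rho> j < r j"
  then obtain M where "M \<ge> 0" "\<forall>\<alpha>. \<forall>f\<in>l2 V. l2norm V (vcoeff \<alpha> f) * (\<Prod>j\<in>UNIV. \<rho> j ^ \<alpha> j) \<le> M * l2norm V f"
    using coeff_growth[of \<rho>] by blast
  then show "\<exists>M\<ge>0. \<forall>\<alpha>. l2norm V (vcoeff \<alpha> f) * (\<Prod>j\<in>UNIV. \<rho> j ^ \<alpha> j) \<le> M"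
    using f by (intro exI[of _ "M * l2norm V f"]) auto
qed (rule coeff_l2[OF f])

lemma polydisc_coeffs_mpow:
  assumes f: "f \<in> l2 V"
  shows "polydisc_coeffs V r (\<lambda>\<alpha>. mpow T \<alpha> f)"
  unfolding polydisc_coeffs_def
proof (intro conjI allI impI)
  fix \<rho> assume "\<forall>j. 0 < \<rho> j \<and> \<rho> j < r j"
  then obtain M where "M \<ge> 0" "\<forall>\<alpha>. \<forall>f\<in>l2 V. l2norm V (mpow T \<alpha> f) * (\<Prod>j\<in>UNIV. \<rho> j ^ \<alpha> j) \<le> M * l2norm V f"
    using mpow_growth[of \<rho>] by blast
  then show "\<exists>M\<ge>0. \<forall>\<alpha>. l2norm V (mpow T \<alpha> f) * (\<Prod>j\<in>UNIV. \<rho> j ^ \<alpha> j) \<le> M"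
    using f by (intro exI[of _ "M * l2norm V f"]) auto
qed (intro in_l2 f)

subsection \<open>The analytic model\<close>

definition "model f = (\<lambda>z. if z \<in> polydisc r then power_series (\<lambda>\<alpha>. vcoeff \<alpha> f) z else (\<lambda>v. 0))"

lemma model_has_sum:
  "f \<in> l2 V \<Longrightarrow> z \<in> polydisc r \<Longrightarrow> ((\<lambda>\<alpha>. monom_at z \<alpha> * vcoeff \<alpha> f v) has_sum model f z v) UNIV"
  using power_series_has_sum[OF polydisc_coeffs_coeff] by (simp add: model_def)

lemma model_inner:
  "f \<in> l2 V \<Longrightarrow> z \<in> polydisc r \<Longrightarrow> h \<in> l2 V \<Longrightarrow>
    ((\<lambda>\<alpha>. monom_at z \<alpha> * l2inner V (vcoeff \<alpha> f) h) has_sum l2inner V (model f z) h) UNIV"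
  using power_series_inner[OF polydisc_coeffs_coeff] by (simp add: model_def)

text \<open>Every coefficient is orthogonal to the ranges of the S j, hence so is the sum of the
  series.\<close>

lemma model_E:
  assumes f: "f \<in> l2 V"
  shows "model f z \<in> E"
proof (cases "z \<in> polydisc r")
  case True
  have "l2inner V (model f z) (S j g) = 0" if g: "g \<in> l2 V" for j g
  proof -
    have "l2inner V (vcoeff \<alpha> f) (S j g) = 0" for \<alpha>
      using coeff_E[OF f] g by (auto simp: E_iff)
    then show ?thesis
      using has_sum_unique[OF model_inner[OF f True in_l2(1)[OF g]]] by simp
  qed
  moreover have "model f z \<in> l2 V"
    using power_series_in_l2[OF polydisc_coeffs_coeff[OF f] True] True by (simp add: model_def)
  ultimately show ?thesis
    by (simp add: E_iff)
qed (simp add: model_def zero_in_E)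

lemma model_lincomb:
  assumes f: "f \<in> l2 V" and g: "g \<in> l2 V"
  shows "model (\<lambda>v. a * f v + b * g v) = (\<lambda>z v. a * model f z v + b * model g z v)"
proof (intro ext)
  fix z v
  show "model (\<lambda>v. a * f v + b * g v) z v = a * model f z v + b * model g z v"
  proof (cases "z \<in> polydisc r")
    case True
    have "((\<lambda>\<alpha>. a * (monom_at z \<alpha> * vcoeff \<alpha> f v) + b * (monom_at z \<alpha> * vcoeff \<alpha> g v))
        has_sum (a * model f z v + b * model g z v)) UNIV"
      by (intro has_sum_add has_sum_cmult_right model_has_sum f g True)
    moreover have "a * (monom_at z \<alpha> * vcoeff \<alpha> f v) + b * (monom_at z \<alpha> * vcoeff \<alpha> g v)
        = monom_at z \<alpha> * vcoeff \<alpha> (\<lambda>v. a * f v + b * g v) v" for \<alpha>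
      by (simp add: coeff_lincomb[OF f g] algebra_simps)
    ultimately show ?thesis
      using has_sum_unique[OF model_has_sum[OF l2_lincomb[OF f g] True]] by simp
  qed (simp add: model_def)
qed

text \<open>The constant, M times a sum of geometric products, is independent of f; this becomes
  boundedness of point evaluations on the model space.\<close>

lemma model_bounded:
  assumes z: "z \<in> polydisc r"
  shows "\<exists>C. \<forall>f\<in>l2 V. l2norm V (model f z) \<le> C * l2norm V f"
proof -
  obtain \<rho> where \<rho>: "\<And>j. cmod (z $ j) < \<rho> j" "\<And>j. \<rho> j < r j" "\<And>j. 0 < \<rho> j"
    using exists_radius_between[of "\<lambda>j. cmod (z $ j)" r] z by (auto simp: polydisc_def)
  obtain M where M: "M \<ge> 0"
    "\<And>\<alpha> f. f \<in> l2 V \<Longrightarrow> l2norm V (vcoeff \<alpha> f) * (\<Prod>j\<in>UNIV. \<rho> j ^ \<alpha> j) \<le> M * l2norm V f"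
    using coeff_growth[of \<rho>] \<rho> by blast
  define q where "q = (\<lambda>j. cmod (z $ j) / \<rho> j)"
  have q: "0 \<le> q j" "q j < 1" for j
    using \<rho>[of j] by (auto simp: q_def)
  let ?Q = "\<lambda>\<alpha>. \<Prod>j\<in>UNIV. q j ^ \<alpha> j"
  have Qs: "?Q summable_on UNIV"
    by (rule summable_on_prod_geometric(2)[of q, OF q])
  have le: "cmod (monom_at z \<alpha>) * l2norm V (vcoeff \<alpha> f) \<le> (M * l2norm V f) * ?Q \<alpha>" if f: "f \<in> l2 V" for \<alpha> f
  proof -
    have "cmod (monom_at z \<alpha>) = ?Q \<alpha> * (\<Prod>j\<in>UNIV. \<rho> j ^ \<alpha> j)"
      unfolding norm_monom_at prod.distrib[symmetric]
      by (rule prod.cong) (use \<rho>(3) in \<open>auto simp: q_def power_divide less_imp_neq[THEN not_sym]\<close>)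
    moreover have "0 \<le> ?Q \<alpha>"
      using q by (intro prod_nonneg) auto
    ultimately show ?thesis
      using mult_left_mono[OF M(2)[OF f], of "?Q \<alpha>" \<alpha>] by (simp add: mult_ac)
  qed
  have "l2norm V (model f z) \<le> (M * infsum ?Q UNIV) * l2norm V f" if f: "f \<in> l2 V" for f
  proof -
    have "l2norm V (model f z) \<le> infsum (\<lambda>\<alpha>. cmod (monom_at z \<alpha>) * l2norm V (vcoeff \<alpha> f)) UNIV"
      using l2norm_power_series_le[OF polydisc_coeffs_coeff[OF f] z] z by (simp add: model_def)
    also have "\<dots> \<le> infsum (\<lambda>\<alpha>. (M * l2norm V f) * ?Q \<alpha>) UNIV"
    proof (rule infsum_mono)
      show "(\<lambda>\<alpha>. cmod (monom_at z \<alpha>) * l2norm V (vcoeff \<alpha> f)) summable_on UNIV"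
        using power_series_terms(2)[OF polydisc_coeffs_coeff[OF f] z] by (simp add: l2norm_scale)
      show "(\<lambda>\<alpha>. (M * l2norm V f) * ?Q \<alpha>) summable_on UNIV"
        by (rule summable_on_cmult_right[OF Qs])
    qed (rule le[OF f])
    also have "\<dots> = (M * l2norm V f) * infsum ?Q UNIV"
      by (rule infsum_cmult_right[OF Qs])
    finally show ?thesis
      by (simp add: mult_ac)
  qed
  then show ?thesis by blast
qed

lemma model_holomorphic:
  assumes f: "f \<in> l2 V"
  shows "l2_holomorphic_on V (model f) (polydisc r)"
  unfolding l2_holomorphic_on_def
proof
  fix w assume w: "w \<in> polydisc r"
  obtain D where D: "\<And>j. D j \<in> l2 V"
    and lim: "((\<lambda>z. l2norm V (\<lambda>v. power_series (\<lambda>\<alpha>. vcoeff \<alpha> f) z v - power_series (\<lambda>\<alpha>. vcoeff \<alpha> f) w v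
        - (\<Sum>j\<in>UNIV. (z $ j - w $ j) * D j v)) / norm (z - w)) \<longlongrightarrow> 0) (at w within polydisc r)"
    using power_series_holomorphic[OF polydisc_coeffs_coeff[OF f]] w unfolding l2_holomorphic_on_def by blast
  have "((\<lambda>z. l2norm V (\<lambda>v. model f z v - model f w v
        - (\<Sum>j\<in>UNIV. (z $ j - w $ j) * D j v)) / norm (z - w)) \<longlongrightarrow> 0) (at w within polydisc r)"
    by (rule Lim_transform_eventually[OF lim]) (use w in \<open>simp add: eventually_at_filter model_def\<close>)
  with D show "\<exists>D. (\<forall>j. D j \<in> l2 V) \<and> ((\<lambda>z. l2norm V (\<lambda>v. model f z v - model f w v
        - (\<Sum>j\<in>UNIV. (z $ j - w $ j) * D j v)) / norm (z - w)) \<longlongrightarrow> 0) (at w within polydisc r)"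
    by blast
qed

lemma model_S:
  assumes f: "f \<in> l2 V"
  shows "model (S j f) = (\<lambda>z v. z $ j * model f z v)"
proof (intro ext)
  fix z v
  show "model (S j f) z v = z $ j * model f z v"
  proof (cases "z \<in> polydisc r")
    case True
    have "((\<lambda>\<alpha>. monom_at z \<alpha> * vcoeff \<alpha> (S j f) v) has_sum (z $ j * model f z v + 0)) UNIV"
    proof (rule has_sum_multiindex_split)
      have "((\<lambda>\<alpha>. z $ j * (monom_at z \<alpha> * vcoeff \<alpha> f v)) has_sum (z $ j * model f z v)) UNIV"
        by (intro has_sum_cmult_right model_has_sum f True)
      then show "((\<lambda>\<alpha>. monom_at z (\<alpha>(j := Suc (\<alpha> j))) * vcoeff (\<alpha>(j := Suc (\<alpha> j))) (S j f) v)
          has_sum z $ j * model f z v) UNIV"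
        unfolding coeff_Suc_S[OF f] monom_at_Suc by (simp add: mult.assoc)
      show "((\<lambda>\<alpha>. if \<alpha> j = 0 then monom_at z \<alpha> * vcoeff \<alpha> (S j f) v else 0) has_sum 0) UNIV"
        by (rule has_sum_0) (simp add: coeff_S_0[OF f])
    qed
    then show ?thesis
      using has_sum_unique[OF model_has_sum[OF in_l2(1)[OF f] True]] by simp
  qed (simp add: model_def)
qed

text \<open>The part of the series divisible by z_j is z_j times the model of L_j f, and the rest is
  the value with z_j replaced by 0. So L_j becomes the difference quotient in z_j.\<close>

lemma model_L:
  assumes f: "f \<in> l2 V" and z: "z \<in> polydisc r"
  shows "model f z v = z $ j * model (L j f) z v + model f (\<chi> i. if i = j then 0 else z $ i) v"
proof -
  let ?w = "\<chi> i. if i = j then 0 else z $ i"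
  have w: "?w \<in> polydisc r"
    using z r_pos by (auto simp: polydisc_def)
  have "((\<lambda>\<alpha>. monom_at z \<alpha> * vcoeff \<alpha> f v) has_sum (z $ j * model (L j f) z v + model f ?w v)) UNIV"
  proof (rule has_sum_multiindex_split)
    have "((\<lambda>\<alpha>. z $ j * (monom_at z \<alpha> * vcoeff \<alpha> (L j f) v)) has_sum (z $ j * model (L j f) z v)) UNIV"
      by (intro has_sum_cmult_right model_has_sum in_l2 f z)
    then show "((\<lambda>\<alpha>. monom_at z (\<alpha>(j := Suc (\<alpha> j))) * vcoeff (\<alpha>(j := Suc (\<alpha> j))) f v)
        has_sum z $ j * model (L j f) z v) UNIV"
      unfolding coeff_Suc[OF f] monom_at_Suc by (simp add: mult.assoc)
    show "((\<lambda>\<alpha>. if \<alpha> j = 0 then monom_at z \<alpha> * vcoeff \<alpha> f v else 0) has_sum model f ?w v) UNIV"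
      using model_has_sum[OF f w, of v] unfolding monom_at_update_0 by (simp add: if_distrib[of "\<lambda>x. x * _"] cong: if_cong)
  qed
  then show ?thesis
    using has_sum_unique[OF model_has_sum[OF f z]] by blast
qed

lemma model_at_0:
  assumes f: "f \<in> l2 V"
  shows "model f 0 = vcoeff (\<lambda>_. 0) f"
proof
  fix v
  have 0: "0 \<in> polydisc r"
    using r_pos by (simp add: polydisc_def)
  have "((\<lambda>\<alpha>. monom_at 0 \<alpha> * vcoeff \<alpha> f v) has_sum vcoeff (\<lambda>_. 0) f v) UNIV"
    by (subst has_sum_cong_neutral[where T = "{\<lambda>_. 0}" and g = "\<lambda>\<alpha>. monom_at 0 \<alpha> * vcoeff \<alpha> f v"])
      (auto simp: monom_at_0 intro: has_sum_finiteI)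
  then show "model f 0 v = vcoeff (\<lambda>_. 0) f v"
    using has_sum_unique[OF model_has_sum[OF f 0]] by blast
qed

text \<open>Off the hyperplane z_j = 0 one divides by z_j in \<open>model_L\<close>; on the
  hyperplane the value follows by continuity.\<close>

lemma model_L_eq_0:
  assumes f: "f \<in> l2 V" and 0: "model f = (\<lambda>z v. 0)"
  shows "model (L j f) = (\<lambda>z v. 0)"
proof (intro ext)
  fix z v
  let ?g = "model (L j f)"
  have nz: "?g z v = 0" if "z $ j \<noteq> 0" for z
  proof (cases "z \<in> polydisc r")
    case True
    with model_L[OF f, of z v j] that show ?thesis
      by (simp add: 0)
  qed (simp add: model_def)
  show "?g z v = 0"
  proof (cases "z \<in> polydisc r \<and> z $ j = 0")
    case True
    \<comment> \<open>The points leave the hyperplane along the j-th axis. As z_j = 0, their j-th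
      coordinate is the offset itself, and n + 2 keeps it strictly below r_j even for n = 0.\<close>
    define y where "y = (\<lambda>n. z + (r j / real (n + 2)) *\<^sub>R axis j (1::complex))"
    have yj: "y n $ i = z $ i + (if i = j then of_real (r j / real (n + 2)) else 0)" for n i
      by (simp add: y_def axis_def of_real_def)
    have small: "0 < r j / real (n + 2)" "r j / real (n + 2) < r j" for n
      using r_pos[of j] by (auto simp: field_simps intro!: add_pos_nonneg)
    have y1: "y n \<in> polydisc r" "y n $ j \<noteq> 0" "y n \<noteq> z" for n
    proof -
      have "cmod (y n $ i) < r i" for i
      proof (cases "i = j")
        case i: True
        have "y n $ i = of_real (r j / real (n + 2))"
          unfolding yj using i True by simp
        then have "cmod (y n $ i) = r j / real (n + 2)"
          using small[of n] by (simp only: norm_of_real)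
        then show ?thesis
          using small i by simp
      next
        case False
        then show ?thesis
          using True yj by (simp add: polydisc_def)
      qed
      then show "y n \<in> polydisc r"
        by (simp add: polydisc_def)
      have "y n $ j = of_real (r j / real (n + 2))"
        unfolding yj using True by simp
      then show nz: "y n $ j \<noteq> 0"
        using small(1)[of n] by (metis of_real_eq_0_iff less_irrefl)
      show "y n \<noteq> z"
        using nz True by auto
    qed
    have "(\<lambda>n. r j / real (n + 2)) \<longlonglongrightarrow> 0"
      using LIMSEQ_ignore_initial_segment[OF lim_const_over_n, of "r j" 2] by simp
    then have "y \<longlonglongrightarrow> z + 0 *\<^sub>R axis j (1::complex)"
      unfolding y_def by (intro tendsto_intros)
    then have "filterlim y (at z within polydisc r) sequentially"
      using y1 by (auto simp: filterlim_at)
    moreover have "((\<lambda>z. ?g z v) \<longlongrightarrow> ?g z v) (at z within polydisc r)"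
      by (rule l2_holomorphic_on_pointwise_continuous[OF model_holomorphic])
        (use f True model_E E_l2 in \<open>auto intro: in_l2\<close>)
    ultimately have "(\<lambda>n. ?g (y n) v) \<longlonglongrightarrow> ?g z v"
      by (rule filterlim_compose[rotated])
    then show ?thesis
      using nz[OF y1(2)] LIMSEQ_unique[of "\<lambda>n. ?g (y n) v"] by simp
  next
    case False
    then show ?thesis
      using nz[of z] by (auto simp: model_def)
  qed
qed

text \<open>A uniqueness theorem with backward shifts in place of derivatives: the value at 0 is the
  constant coefficient, and L_j moves each higher coefficient down. Hence f varies in the
  induction.\<close>

lemma model_eq_0_imp_coeff_eq_0:
  assumes "f \<in> l2 V" "model f = (\<lambda>z v. 0)"
  shows "vcoeff \<alpha> f = (\<lambda>v. 0)"
  using assms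
proof (induction \<alpha> arbitrary: f rule: multiindex_induct)
  case zero
  then show ?case
    using model_at_0[of f] by simp
next
  case (Suc \<alpha> j)
  then show ?case
    by (simp only: coeff_Suc) (intro Suc.IH in_l2 model_L_eq_0)
qed

subsection \<open>The wandering subspace property\<close>

text \<open>Write P_A, P_B for the restrictions. Taking adjoints in P_B S = S P_A shows that the
  Gram operator commutes with P_A, and therefore so does its inverse.\<close>

lemma gram_inv_restrict:
  assumes com: "\<And>f. f \<in> l2 V \<Longrightarrow> restr B (S j f) = S j (restr A f)" and f: "f \<in> l2 V"
  shows "gram_inv j (restr A f) = restr A (gram_inv j f)"
proof -
  let ?D = "\<lambda>f. adjoint V (S j) (S j f)"
  have adj: "adjoint V (S j) (restr B g) = restr A (adjoint V (S j) g)" if g: "g \<in> l2 V" for g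
    by (rule l2_eqI)
      (use g in \<open>auto intro: in_l2 simp: adjoint_inner'[OF S] in_l2 l2inner_restrict com\<close>)
  let ?h = "restr A (gram_inv j f)"
  have h: "?h \<in> l2 V"
    by (intro in_l2 f)
  have "?D ?h = restr A (?D (gram_inv j f))"
    by (simp add: com[symmetric] adj in_l2 f)
  also have "\<dots> = restr A f"
    by (simp add: gram_inv_right f)
  finally show ?thesis
    using gram_inv_left[OF h, of j] by simp
qed

lemma T_restrict:
  assumes com: "\<And>f. f \<in> l2 V \<Longrightarrow> restr B (S j f) = S j (restr A f)" and f: "f \<in> l2 V"
  shows "restr B (T j f) = T j (restr A f)"
  unfolding T_eq by (simp add: com gram_inv_restrict[OF com f] in_l2 f)

abbreviation "level n \<equiv> {v. lev v = n}"

text \<open>The restriction of S j f to a level is 0 or again of the form S j g, so orthogonality to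
  the ranges survives: E is a graded subspace.\<close>

lemma E_restrict_level:
  assumes e: "e \<in> E"
  shows "restr (level n) e \<in> E"
  unfolding E_iff
proof (intro conjI allI ballI)
  show "restr (level n) e \<in> l2 V"
    by (intro in_l2 E_l2 e)
  fix j f assume f: "f \<in> l2 V"
  have "l2inner V (restr (level n) e) (S j f) = l2inner V e (restr (level n) (S j f))"
    by (rule l2inner_restrict)
  also have "\<dots> = 0"
  proof (cases n)
    case 0
    then show ?thesis
      by (simp add: S_lev_0[OF f])
  next
    case (Suc m)
    then show ?thesis
      using e f by (simp add: S_lev_Suc[OF f] E_iff in_l2)
  qed
  finally show "l2inner V (restr (level n) e) (S j f) = 0" .
qed

text \<open>T^\<alpha> raises the level by |\<alpha>|, so the part on level n comes from the part of
  e on level n - |\<alpha>|, and is 0 if there is no such level.\<close>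

lemma restrict_level_mpow:
  assumes e: "e \<in> E"
  shows "\<exists>e'\<in>E. restr (level n) (mpow T \<alpha> e) = mpow T \<alpha> e'"
proof (induction \<alpha> arbitrary: n rule: multiindex_induct)
  case zero
  show ?case
    using E_restrict_level[OF e] by (auto simp: mpow_0)
next
  case (Suc \<alpha> j)
  have m: "mpow T \<alpha> e \<in> l2 V"
    by (intro in_l2 E_l2 e)
  show ?case
  proof (cases n)
    case 0
    have "restr (level n) (mpow T (\<alpha>(j := Suc (\<alpha> j))) e) = (\<lambda>v. 0)"
      unfolding mpow_T_Suc[OF E_l2[OF e]] T_eq[of j "mpow T \<alpha> e"] 0 by (intro S_lev_0 in_l2 m)
    also have "\<dots> = mpow T (\<alpha>(j := Suc (\<alpha> j))) (\<lambda>v. 0)"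
      by (rule bounded_op_zero[OF mpow_T, symmetric])
    finally show ?thesis
      using zero_in_E by blast
  next
    case (Suc k)
    obtain e' where e': "e' \<in> E" "restr (level k) (mpow T \<alpha> e) = mpow T \<alpha> e'"
      using Suc.IH by blast
    have "restr (level n) (T j (mpow T \<alpha> e)) = T j (restr (level k) (mpow T \<alpha> e))"
      unfolding Suc by (rule T_restrict[OF S_lev_Suc m])
    then have "restr (level n) (mpow T (\<alpha>(j := Suc (\<alpha> j))) e) = mpow T (\<alpha>(j := Suc (\<alpha> j))) e'"
      unfolding mpow_T_Suc[OF E_l2[OF e]] mpow_T_Suc[OF E_l2[OF e'(1)]] e'(2) .
    with e'(1) show ?thesis
      by blast
  qed
qed

lemma restrict_levels_eq_0:
  assumes "\<And>n. restr (level n) f = (\<lambda>v. 0)"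
  shows "f = (\<lambda>v. 0)"
proof
  show "f v = 0" for v
    using fun_cong[OF assms[of "lev v"], of v] by (simp add: l2_restrict_def)
qed

lemma orthogonal_to_orbit_imp_zero:
  assumes "f \<in> l2 V" "\<And>\<alpha> e. e \<in> E \<Longrightarrow> l2inner V f (mpow T \<alpha> e) = 0"
  shows "f = (\<lambda>v. 0)"
proof -
  have "restr (level n) f = (\<lambda>v. 0)"
    if "f \<in> l2 V" "\<And>\<alpha> e. e \<in> E \<Longrightarrow> l2inner V f (mpow T \<alpha> e) = 0" for n f
    using that
  proof (induction n arbitrary: f rule: less_induct)
    case (less n)
    note f = less.prems(1) and orth = less.prems(2)
    let ?g = "restr (level n) f"
    have g: "?g \<in> l2 V"
      by (intro in_l2 f)
    have gorth: "l2inner V ?g (mpow T \<alpha> e) = 0" if e: "e \<in> E" for \<alpha> e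
    proof -
      obtain e' where "e' \<in> E" "restr (level n) (mpow T \<alpha> e) = mpow T \<alpha> e'"
        using restrict_level_mpow[OF e] by blast
      then show ?thesis
        using orth by (simp add: l2inner_restrict)
    qed
    have h0: "L j ?g = (\<lambda>v. 0)" for j
    proof -
      have h: "L j ?g \<in> l2 V"
        by (intro in_l2 g)
      \<comment> \<open>The only level that L j ?g can meet is n - 1, where the induction hypothesis
        applies. For n = 0 there is no such level, so no separate base case arises.\<close>
      have "restr (level m) (L j ?g) = (\<lambda>v. 0)" for m
      proof (cases "n = Suc m")
        case True
        show ?thesis
        proof (rule less.IH)
          fix \<alpha> e assume e: "e \<in> E"
          then show "l2inner V (L j ?g) (mpow T \<alpha> e) = 0"
            using gorth[OF e, of "\<alpha>(j := Suc (\<alpha> j))"]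
            by (simp add: mpow_T_Suc E_l2 adjoint_inner'[OF T] in_l2 g del: fun_upd_apply)
        qed (use True h in auto)
      next
        case False
        \<comment> \<open>T j maps level m into level m + 1, while ?g lives on level n \<noteq> m +
          1.\<close>
        have "l2inner V (restr (level m) (L j ?g)) x = l2inner V (\<lambda>v. 0) x" if x: "x \<in> l2 V" for x
        proof -
          have "l2inner V (restr (level m) (L j ?g)) x = l2inner V ?g (T j (restr (level m) x))"
            by (simp add: l2inner_restrict adjoint_inner'[OF T] in_l2 x g)
          also have "T j (restr (level m) x) = restr (level (Suc m)) (T j x)"
            by (rule T_restrict[OF S_lev_Suc x, symmetric])
          also have "l2inner V ?g (restr (level (Suc m)) (T j x)) = 0"
            by (rule l2inner_disjoint) (use False in \<open>auto simp: l2_restrict_def\<close>)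
          finally show ?thesis
            by simp
        qed
        then show ?thesis
          by (rule l2_eqI[rotated 2]) (auto intro: in_l2 h)
      qed
      then show ?thesis
        by (rule restrict_levels_eq_0)
    qed
    have "adjoint V (S j) ?g = (\<lambda>v. 0)" for j
      by (rule adjS_eq_0_if_adjT_eq_0[OF g h0])
    then have "?g \<in> E"
      using g by (auto simp: E_def op_kernel_def)
    from gorth[OF this, of "\<lambda>_. 0"] show ?case
      using l2inner_self_eq_0_iff[OF g] by (simp add: mpow_0)
  qed
  from this[OF assms] show ?thesis
    by (rule restrict_levels_eq_0)
qed

lemma model_eq_0_iff:
  assumes f: "f \<in> l2 V"
  shows "model f = (\<lambda>z v. 0) \<longleftrightarrow> f = (\<lambda>v. 0)"
proof
  assume 0: "model f = (\<lambda>z v. 0)"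
  show "f = (\<lambda>v. 0)"
  proof (rule orthogonal_to_orbit_imp_zero[OF f])
    fix \<alpha> e assume e: "e \<in> E"
    then show "l2inner V f (mpow T \<alpha> e) = 0"
      using coeff_inner[OF f e] model_eq_0_imp_coeff_eq_0[OF f 0] by (metis l2inner_zero(1))
  qed
next
  assume "f = (\<lambda>v. 0)"
  then show "model f = (\<lambda>z v. 0)"
    using model_lincomb[OF f f, of 0 0] by simp
qed

end

context left_invertible_tuple
begin

subsection \<open>The reproducing kernel Hilbert space\<close>

lemma inj_on_model: "inj_on model (l2 V)"
proof (rule inj_onI)
  fix f g assume f: "f \<in> l2 V" and g: "g \<in> l2 V" and eq: "model f = model g"
  have "model (\<lambda>v. f v - g v) = (\<lambda>z v. 0)"
    using model_lincomb[OF f g, of 1 "-1"] eq by simp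
  then have "(\<lambda>v. f v - g v) = (\<lambda>v. 0)"
    using model_eq_0_iff[OF l2_diff[OF f g]] by simp
  then show "f = g"
    by (simp add: fun_eq_iff)
qed

definition "model_space = model ` l2 V"
text \<open>Pulled back along \<open>model\<close>; injectivity turns \<open>inv_into\<close> into a
  true inverse, so that \<open>model\<close> is isometric by construction.\<close>

definition "model_inner_product F G = l2inner V (inv_into (l2 V) model F) (inv_into (l2 V) model G)"

lemma model_inner_product:
  "f \<in> l2 V \<Longrightarrow> g \<in> l2 V \<Longrightarrow> model_inner_product (model f) (model g) = l2inner V f g"
  by (simp add: model_inner_product_def inv_into_f_f[OF inj_on_model])

lemma hnorm_model: "f \<in> l2 V \<Longrightarrow> hnorm model_inner_product (model f) = l2norm V f"
  by (simp add: hnorm_def model_inner_product l2inner_self)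

lemma model_diff:
  "f \<in> l2 V \<Longrightarrow> g \<in> l2 V \<Longrightarrow> model (\<lambda>v. f v - g v) = (\<lambda>z v. model f z v - model g z v)"
  using model_lincomb[of f g 1 "-1"] by simp

lemma hnorm_model_diff:
  "f \<in> l2 V \<Longrightarrow> g \<in> l2 V \<Longrightarrow>
    hnorm model_inner_product (\<lambda>z v. model f z v - model g z v) = l2norm V (\<lambda>v. f v - g v)"
  by (simp only: model_diff[symmetric] hnorm_model l2_diff)

lemma model_space_complete:
  assumes X: "\<And>n. X n \<in> model_space"
    and Cauchy: "\<And>\<epsilon>. \<epsilon> > 0 \<Longrightarrow>
      \<exists>N::nat. \<forall>m\<ge>N. \<forall>n\<ge>N. hnorm model_inner_product (\<lambda>z v. X m z v - X n z v) < \<epsilon>"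
  shows "\<exists>L\<in>model_space. \<forall>\<epsilon>>0. \<exists>N::nat. \<forall>n\<ge>N. hnorm model_inner_product (\<lambda>z v. X n z v - L z v) < \<epsilon>"
proof -
  have "\<exists>x. \<forall>n. x n \<in> l2 V \<and> X n = model (x n)"
    using X unfolding model_space_def by (intro choice) blast
  then obtain x where x: "\<And>n. x n \<in> l2 V" and Xx: "\<And>n. X n = model (x n)"
    by blast
  have "\<exists>N::nat. \<forall>m\<ge>N. \<forall>n\<ge>N. l2norm V (\<lambda>v. x m v - x n v) < \<epsilon>" if "\<epsilon> > 0" for \<epsilon>
    using Cauchy[OF that] unfolding Xx hnorm_model_diff[OF x x] .
  from l2_complete[of x V, OF x this]
  obtain y where y: "y \<in> l2 V" and lim: "(\<lambda>n. l2norm V (\<lambda>v. x n v - y v)) \<longlonglongrightarrow> 0"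
    by blast
  have "\<exists>N. \<forall>n\<ge>N. hnorm model_inner_product (\<lambda>z v. X n z v - model y z v) < \<epsilon>" if "\<epsilon> > 0" for \<epsilon>
    using order_tendstoD(2)[OF lim that] unfolding Xx hnorm_model_diff[OF x y] eventually_sequentially .
  with y show ?thesis
    unfolding model_space_def by blast
qed

lemma rkhs_model: "rkhs V E (polydisc r) model_space model_inner_product"
  unfolding rkhs_def
proof (intro conjI ballI allI impI)
  fix F assume "F \<in> model_space"
  then obtain f where f: "f \<in> l2 V" "F = model f"
    by (auto simp: model_space_def)
  show "F z \<in> E" for z
    using f model_E by simp
  show "F z = (\<lambda>v. 0)" if "z \<notin> polydisc r" for z
    using that f by (simp add: model_def)
  show "l2_holomorphic_on V F (polydisc r)"
    using f model_holomorphic by simp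
  show "0 \<le> Re (model_inner_product F F)"
    using f by (simp add: model_inner_product l2inner_self)
  show "(model_inner_product F F = 0) = (F = (\<lambda>z v. 0))"
    using f by (simp add: model_inner_product l2inner_self_eq_0_iff model_eq_0_iff)
  fix G assume "G \<in> model_space"
  then obtain g where g: "g \<in> l2 V" "G = model g"
    by (auto simp: model_space_def)
  show "model_inner_product G F = cnj (model_inner_product F G)"
    using f g by (simp add: model_inner_product l2inner_cnj)
  fix a b
  have ab: "(\<lambda>z v. a * F z v + b * G z v) = model (\<lambda>v. a * f v + b * g v)"
    using f g model_lincomb by simp
  show "(\<lambda>z v. a * F z v + b * G z v) \<in> model_space"
    unfolding ab model_space_def using f g l2_lincomb by blast
  fix K assume "K \<in> model_space"
  then obtain k where k: "k \<in> l2 V" "K = model k"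
    by (auto simp: model_space_def)
  show "model_inner_product (\<lambda>z v. a * F z v + b * G z v) K = a * model_inner_product F K + b * model_inner_product G K"
    unfolding ab using f g k
    by (simp add: model_inner_product l2_lincomb l2inner_add_left l2_scale l2inner_scale_left)
next
  show "(\<lambda>z v. 0) \<in> model_space"
    using model_eq_0_iff[of "\<lambda>v. 0"] unfolding model_space_def by (metis image_eqI l2_zero(1))
next
  fix X :: "nat \<Rightarrow> _"
  assume "(\<forall>n. X n \<in> model_space) \<and>
    (\<forall>\<epsilon>>0. \<exists>N::nat. \<forall>m\<ge>N. \<forall>n\<ge>N. hnorm model_inner_product (\<lambda>z v. X m z v - X n z v) < \<epsilon>)"
  then show "\<exists>L\<in>model_space. \<forall>\<epsilon>>0. \<exists>N::nat. \<forall>n\<ge>N. hnorm model_inner_product (\<lambda>z v. X n z v - L z v) < \<epsilon>"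
    by (intro model_space_complete) blast+
next
  fix z assume "z \<in> polydisc r"
  then obtain C where "\<forall>f\<in>l2 V. l2norm V (model f z) \<le> C * l2norm V f"
    using model_bounded by blast
  then show "\<exists>C. \<forall>F\<in>model_space. l2norm V (F z) \<le> C * hnorm model_inner_product F"
    by (intro exI[of _ C]) (auto simp: model_space_def hnorm_model)
qed

lemma unitary_model: "unitary_onto V model model_space model_inner_product"
  unfolding unitary_onto_def by (auto simp: model_space_def model_lincomb model_inner_product)

subsection \<open>The reproducing kernel\<close>

text \<open>The vector representing f -> <model f w, e>. The inner product is antilinear in its
  second argument, hence the conjugate point.\<close>

definition "kernel_vec w e = power_series (\<lambda>\<beta>. mpow T \<beta> e) (\<chi> j. cnj (w $ j))"

lemma monom_at_cnj: "monom_at (\<chi> j. cnj (w $ j)) \<beta> = cnj (monom_at w \<beta>)"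
  by (simp add: monom_at_def)

lemma cnj_polydisc: "w \<in> polydisc r \<Longrightarrow> (\<chi> j. cnj (w $ j)) \<in> polydisc r"
  by (simp add: polydisc_def)

lemma kernel_vec_l2: "w \<in> polydisc r \<Longrightarrow> e \<in> l2 V \<Longrightarrow> kernel_vec w e \<in> l2 V"
  unfolding kernel_vec_def by (rule power_series_in_l2[OF polydisc_coeffs_mpow cnj_polydisc])

lemma kernel_vec_inner:
  "w \<in> polydisc r \<Longrightarrow> e \<in> l2 V \<Longrightarrow> h \<in> l2 V \<Longrightarrow>
    ((\<lambda>\<beta>. cnj (monom_at w \<beta>) * l2inner V (mpow T \<beta> e) h) has_sum l2inner V (kernel_vec w e) h) UNIV"
  unfolding kernel_vec_def monom_at_cnj[symmetric]
  by (rule power_series_inner[OF polydisc_coeffs_mpow cnj_polydisc])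

text \<open>Conjugating the series termwise gives w^\<beta> <f, T^\<beta> e>, and <f, T^\<beta> e>
  is the \<beta>-th coefficient of f paired with e.\<close>

lemma model_inner_kernel_vec:
  assumes w: "w \<in> polydisc r" and e: "e \<in> E" and f: "f \<in> l2 V"
  shows "l2inner V f (kernel_vec w e) = l2inner V (model f w) e"
proof -
  have "((\<lambda>\<beta>. cnj (cnj (monom_at w \<beta>) * l2inner V (mpow T \<beta> e) f)) has_sum cnj (l2inner V (kernel_vec w e) f)) UNIV"
    by (rule has_sum_bounded_linear[OF bounded_linear_cnj kernel_vec_inner[OF w E_l2[OF e] f]])
  then have "((\<lambda>\<beta>. monom_at w \<beta> * l2inner V (vcoeff \<beta> f) e) has_sum l2inner V f (kernel_vec w e)) UNIV"
    by (simp add: l2inner_cnj coeff_inner[OF f e])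
  then show ?thesis
    using has_sum_unique[OF model_inner[OF f w E_l2[OF e]]] by simp
qed

lemma reproducing_kernel_model:
  "reproducing_kernel V E (polydisc r) model_space model_inner_product (\<lambda>z w e. model (kernel_vec w e) z)"
  unfolding reproducing_kernel_def
proof (intro ballI conjI)
  fix w e assume w: "w \<in> polydisc r" and e: "e \<in> E"
  have eq: "(\<lambda>z. if z \<in> polydisc r then model (kernel_vec w e) z else (\<lambda>v. 0)) = model (kernel_vec w e)"
    by (auto simp: model_def)
  have k: "kernel_vec w e \<in> l2 V"
    by (rule kernel_vec_l2[OF w E_l2[OF e]])
  show "(\<lambda>z. if z \<in> polydisc r then model (kernel_vec w e) z else (\<lambda>v. 0)) \<in> model_space"
    unfolding eq model_space_def using k by blast
  fix F assume "F \<in> model_space"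
  then show "model_inner_product F (\<lambda>z. if z \<in> polydisc r then model (kernel_vec w e) z else (\<lambda>v. 0)) = l2inner V (F w) e"
    unfolding eq model_space_def by (auto simp: model_inner_product k model_inner_kernel_vec[OF w e])
qed

section \<open>The double series of the kernel\<close>

definition kernel_term where
  "kernel_term z w e = (\<lambda>(\<alpha>, \<beta>) v. monom_at z \<alpha> * cnj (monom_at w \<beta>) * vcoeff \<alpha> (mpow T \<beta> e) v)"

lemma kernel_term_l2: "e \<in> l2 V \<Longrightarrow> kernel_term z w e p \<in> l2 V"
  by (cases p) (auto simp: kernel_term_def intro!: l2_scale coeff_l2 in_l2)

text \<open>\<open>coeff_inner\<close> tests only with vectors of E; for general h the projection
  onto E may be inserted because the coefficient itself lies in E.\<close>

lemma vcoeff_inner_projection: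
  assumes x: "x \<in> l2 V" and h: "h \<in> l2 V"
  shows "l2inner V (vcoeff \<alpha> x) h = l2inner V x (mpow T \<alpha> (orth_proj V E h))"
proof -
  have "l2inner V (vcoeff \<alpha> x) h = l2inner V (vcoeff \<alpha> x) (orth_proj V E h)"
    using orth_proj_inner[OF E_subspace h coeff_E[OF x], of \<alpha>] by (metis l2inner_cnj)
  also have "\<dots> = l2inner V x (mpow T \<alpha> (orth_proj V E h))"
    by (rule coeff_inner[OF x orth_proj_in[OF E_subspace h]])
  finally show ?thesis .
qed

text \<open>The coefficient bound is uniform in the vector. Applied to T^\<beta> e, it majorises the
  terms by a function of \<alpha> times a function of \<beta>, each of them summable.\<close>

lemma kernel_term_summable:
  assumes z: "z \<in> polydisc r" and w: "w \<in> polydisc r" and e: "e \<in> l2 V"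
  shows "(\<lambda>p. l2norm V (kernel_term z w e p)) summable_on UNIV"
proof -
  obtain \<rho> where \<rho>: "\<And>j. cmod (z $ j) < \<rho> j" "\<And>j. \<rho> j < r j" "\<And>j. 0 < \<rho> j"
    using exists_radius_between[of "\<lambda>j. cmod (z $ j)" r] z by (auto simp: polydisc_def)
  obtain M where M: "M \<ge> 0"
    "\<And>\<alpha> f. f \<in> l2 V \<Longrightarrow> l2norm V (vcoeff \<alpha> f) * (\<Prod>j\<in>UNIV. \<rho> j ^ \<alpha> j) \<le> M * l2norm V f"
    using coeff_growth[of \<rho>] \<rho> by blast
  define q where "q = (\<lambda>j. cmod (z $ j) / \<rho> j)"
  have q: "0 \<le> q j" "q j < 1" for j
    using \<rho>[of j] by (auto simp: q_def)
  let ?Q = "\<lambda>\<alpha>. \<Prod>j\<in>UNIV. q j ^ \<alpha> j"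
  have Q0: "0 \<le> ?Q \<alpha>" for \<alpha>
    using q by (intro prod_nonneg) auto
  have Qs: "?Q summable_on UNIV"
    by (rule summable_on_prod_geometric(2)[of q, OF q])
  let ?W = "\<lambda>\<beta>. cmod (monom_at w \<beta>) * l2norm V (mpow T \<beta> e)"
  have Ws: "?W summable_on UNIV"
    using power_series_terms(2)[OF polydisc_coeffs_mpow[OF e] cnj_polydisc[OF w]]
    by (simp add: l2norm_scale monom_at_cnj)
  have le: "l2norm V (kernel_term z w e (\<alpha>, \<beta>)) \<le> (M * ?Q \<alpha>) * ?W \<beta>" for \<alpha> \<beta>
  proof -
    have "cmod (monom_at z \<alpha>) = ?Q \<alpha> * (\<Prod>j\<in>UNIV. \<rho> j ^ \<alpha> j)"
      unfolding norm_monom_at prod.distrib[symmetric]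
      by (rule prod.cong) (use \<rho>(3) in \<open>auto simp: q_def power_divide less_imp_neq[THEN not_sym]\<close>)
    then have "cmod (monom_at z \<alpha>) * l2norm V (vcoeff \<alpha> (mpow T \<beta> e)) \<le> ?Q \<alpha> * (M * l2norm V (mpow T \<beta> e))"
      using mult_left_mono[OF M(2)[OF in_l2(6)[OF e]] Q0, of \<alpha> \<alpha> \<beta>] by (simp add: mult_ac)
    from mult_left_mono[OF this norm_ge_zero[of "monom_at w \<beta>"]] show ?thesis
      by (simp add: kernel_term_def l2norm_scale norm_mult mult_ac)
  qed
  have "(\<lambda>(\<alpha>, \<beta>). (M * ?Q \<alpha>) * ?W \<beta>) summable_on Sigma UNIV (\<lambda>_. UNIV)"
  proof (rule summable_on_SigmaI)
    show "((\<lambda>\<beta>. case (\<alpha>, \<beta>) of (\<alpha>, \<beta>) \<Rightarrow> (M * ?Q \<alpha>) * ?W \<beta>) has_sum (M * ?Q \<alpha>) * infsum ?W UNIV) UNIV" for \<alpha>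
      unfolding prod.case by (intro has_sum_cmult_right has_sum_infsum Ws)
    show "(\<lambda>\<alpha>. (M * ?Q \<alpha>) * infsum ?W UNIV) summable_on UNIV"
      by (intro summable_on_cmult_left summable_on_cmult_right Qs)
  qed (use M(1) Q0 in auto)
  then have "(\<lambda>(\<alpha>, \<beta>). (M * ?Q \<alpha>) * ?W \<beta>) summable_on UNIV"
    by simp
  then show ?thesis
    by (rule summable_on_comparison_test) (use le in auto)
qed

text \<open>Tested against h, the double sum may be iterated: the inner sum over \<beta> produces
  the \<alpha>-th coefficient of \<open>kernel_vec w e\<close>, the outer one its model at
  z.\<close>

lemma kernel_term_infsum:
  assumes z: "z \<in> polydisc r" and w: "w \<in> polydisc r" and e: "e \<in> l2 V"
  shows "l2_infsum (kernel_term z w e) UNIV = model (kernel_vec w e) z"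
proof (rule l2_eqI)
  note ks = kernel_term_summable[OF z w e]
  have k: "kernel_vec w e \<in> l2 V"
    by (rule kernel_vec_l2[OF w e])
  show "l2_infsum (kernel_term z w e) UNIV \<in> l2 V"
    by (rule l2_infsum_in_l2[OF kernel_term_l2[OF e] ks])
  show "model (kernel_vec w e) z \<in> l2 V"
    by (rule E_l2[OF model_E[OF k]])
  fix h assume h: "h \<in> l2 V"
  let ?p = "orth_proj V E h"
  have p: "?p \<in> l2 V"
    by (rule E_l2[OF orth_proj_in[OF E_subspace h]])
  have "((\<lambda>p. l2inner V (kernel_term z w e p) h) has_sum l2inner V (l2_infsum (kernel_term z w e) UNIV) h)
      (Sigma UNIV (\<lambda>_. UNIV))"
    using l2_infsum_inner[OF kernel_term_l2[OF e] ks kernel_term_l2[OF e] kernel_term_l2[OF e] ks h] by simp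
  moreover have "((\<lambda>\<beta>. l2inner V (kernel_term z w e (\<alpha>, \<beta>)) h)
      has_sum monom_at z \<alpha> * l2inner V (vcoeff \<alpha> (kernel_vec w e)) h) UNIV" for \<alpha>
  proof -
    have "((\<lambda>\<beta>. monom_at z \<alpha> * (cnj (monom_at w \<beta>) * l2inner V (mpow T \<beta> e) (mpow T \<alpha> ?p)))
        has_sum monom_at z \<alpha> * l2inner V (kernel_vec w e) (mpow T \<alpha> ?p)) UNIV"
      by (intro has_sum_cmult_right kernel_vec_inner w e in_l2 p)
    then show ?thesis
      by (simp add: kernel_term_def l2inner_scale_left vcoeff_inner_projection in_l2 e k h mult.assoc)
  qed
  ultimately have "((\<lambda>\<alpha>. monom_at z \<alpha> * l2inner V (vcoeff \<alpha> (kernel_vec w e)) h)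
      has_sum l2inner V (l2_infsum (kernel_term z w e) UNIV) h) UNIV"
    by (rule has_sum_SigmaD)
  then show "l2inner V (l2_infsum (kernel_term z w e) UNIV) h = l2inner V (model (kernel_vec w e) z) h"
    using has_sum_unique[OF _ model_inner[OF k z h]] by blast
qed

text \<open>The coefficient of T^\<beta> e at \<alpha> is 0 once T^\<beta> e is orthogonal to
  T^\<alpha> E, so restricting the sum to I does not change its value.\<close>

lemma kernel_series:
  assumes z: "z \<in> polydisc r" and w: "w \<in> polydisc r" and e: "e \<in> E"
    and I: "\<And>\<alpha> \<beta> e'. (\<alpha>, \<beta>) \<notin> I \<Longrightarrow> e' \<in> E \<Longrightarrow> l2inner V (mpow T \<beta> e) (mpow T \<alpha> e') = 0"
  shows "l2_has_sum V (kernel_term z w e) (model (kernel_vec w e) z) I"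
proof -
  note el = E_l2[OF e]
  have zero: "kernel_term z w e p = (\<lambda>v. 0)" if "p \<notin> I" for p
  proof -
    obtain \<alpha> \<beta> where p: "p = (\<alpha>, \<beta>)"
      by (cases p)
    have "vcoeff \<alpha> (mpow T \<beta> e) = (\<lambda>v. 0)"
      by (rule coeff_eqI) (use that p I el zero_in_E in \<open>auto intro: in_l2\<close>)
    then show ?thesis
      by (simp add: p kernel_term_def)
  qed
  have "l2_infsum (kernel_term z w e) I = l2_infsum (kernel_term z w e) UNIV"
    unfolding l2_infsum_def by (intro ext infsum_cong_neutral) (auto simp: zero)
  moreover have "l2_has_sum V (kernel_term z w e) (l2_infsum (kernel_term z w e) I) I"
    by (rule l2_has_sum_l2_infsum)
      (auto intro: kernel_term_l2[OF el] summable_on_subset_banach[OF kernel_term_summable[OF z w el]])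
  ultimately show ?thesis
    by (simp add: kernel_term_infsum[OF z w el])
qed

end

subsection \<open>Multishifts\<close>

text \<open>S j f at w sees f only at the parent in direction j, so A and B have to match along
  parents. At a root coordinate both sides vanish.\<close>

lemma multishift_restrict:
  assumes "\<And>w. w \<in> prodV Vt \<Longrightarrow> w j \<noteq> tree_root (Vt j) (Et j) \<Longrightarrow>
      w \<in> B \<longleftrightarrow> w(j := tree_parent (Et j) (w j)) \<in> A"
  shows "l2_restrict B (multishift Vt Et lam j f) = multishift Vt Et lam j (l2_restrict A f)"
  using assms by (auto simp: multishift_def l2_restrict_def fun_eq_iff)

lemma tree_depth_parent:
  assumes "rooted_tree V E" "v \<in> V" "v \<noteq> tree_root V E"
  shows "tree_depth V E v = Suc (tree_depth V E (tree_parent E v))"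
  by (rule tree_depth_edge[OF assms(1) tree_parent_edge[OF assms]])

definition total_depth :: "('d::finite \<Rightarrow> 'a set) \<Rightarrow> ('d \<Rightarrow> ('a \<times> 'a) set) \<Rightarrow> ('d \<Rightarrow> 'a) \<Rightarrow> nat" where
  "total_depth Vt Et v = (\<Sum>i\<in>UNIV. tree_depth (Vt i) (Et i) (v i))"

lemma total_depth_parent:
  assumes "rooted_tree (Vt j) (Et j)" "w \<in> prodV Vt" "w j \<noteq> tree_root (Vt j) (Et j)"
  shows "total_depth Vt Et w = Suc (total_depth Vt Et (w(j := tree_parent (Et j) (w j))))"
proof -
  let ?p = "w(j := tree_parent (Et j) (w j))"
  have split: "total_depth Vt Et v = tree_depth (Vt j) (Et j) (v j)
      + (\<Sum>i\<in>UNIV - {j}. tree_depth (Vt i) (Et i) (v i))" for v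
    unfolding total_depth_def by (rule sum.remove) auto
  have "(\<Sum>i\<in>UNIV - {j}. tree_depth (Vt i) (Et i) (?p i)) = (\<Sum>i\<in>UNIV - {j}. tree_depth (Vt i) (Et i) (w i))"
    by (rule sum.cong) auto
  moreover have "w j \<in> Vt j"
    using assms(2) by (simp add: prodV_def)
  ultimately show ?thesis
    using tree_depth_parent[OF assms(1) _ assms(3)] by (simp add: split)
qed

text \<open>When w j is an only child, S j maps the unit vector at the parent of w to
  \<open>lam j w\<close> times the unit vector at w; orthogonality to the range then kills e
  w.\<close>

lemma joint_kernel_support:
  fixes Vt :: "'d \<Rightarrow> 'a set"
  assumes t: "rooted_tree (Vt j) (Et j)" and lf: "locally_finite_tree (Vt j) (Et j)"
    and pos: "\<And>w. w \<in> prodV Vt \<Longrightarrow> w j \<noteq> tree_root (Vt j) (Et j) \<Longrightarrow> lam j w > 0"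
    and e: "\<And>f. f \<in> l2 (prodV Vt) \<Longrightarrow> l2inner (prodV Vt) e (multishift Vt Et lam j f) = 0"
    and w: "w \<in> prodV Vt" and deep: "branching_index (Vt j) (Et j) < enat (tree_depth (Vt j) (Et j) (w j))"
  shows "e w = 0"
proof -
  have wj: "w j \<in> Vt j"
    using w by (simp add: prodV_def)
  note oc = only_child_below_branching_index[OF t lf wj deep]
  let ?par = "tree_parent (Et j)"
  let ?p = "w(j := ?par (w j))"
  have "?par (w j) \<in> Vt j"
    using tree_edge_in[OF t tree_parent_edge[OF t wj oc(1)]] by blast
  then have p: "?p \<in> prodV Vt"
    using w by (simp add: prodV_def)
  have eq: "u = w" if u: "u \<in> prodV Vt" "u j \<noteq> tree_root (Vt j) (Et j)" "u(j := ?par (u j)) = ?p" for u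
  proof
    fix i
    show "u i = w i"
    proof (cases "i = j")
      case True
      have "u j \<in> Vt j"
        using u(1) by (simp add: prodV_def)
      then have "(?par (u j), u j) \<in> Et j"
        by (rule tree_parent_edge[OF t _ u(2)])
      moreover have "?par (u j) = ?par (w j)"
        using fun_cong[OF u(3), of j] by simp
      ultimately have "u j \<in> Chi (Et j) (?par (w j))"
        by (simp add: Chi_def)
      then show ?thesis
        using oc(2) True by simp
    next
      case False
      then show ?thesis
        using fun_cong[OF u(3), of i] by simp
    qed
  qed
  have "multishift Vt Et lam j (unit_vec ?p) = (\<lambda>v. complex_of_real (lam j w) * unit_vec w v)"
  proof
    fix u
    show "multishift Vt Et lam j (unit_vec ?p) u = complex_of_real (lam j w) * unit_vec w u"
    proof (cases "u = w")
      case True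
      then show ?thesis
        using w oc(1) by (simp add: multishift_def unit_vec_def)
    next
      case False
      then have "u \<in> prodV Vt \<Longrightarrow> u j \<noteq> tree_root (Vt j) (Et j) \<Longrightarrow> u(j := ?par (u j)) \<noteq> ?p"
        using eq by blast
      with False show ?thesis
        by (simp add: multishift_def unit_vec_def)
    qed
  qed
  then have "complex_of_real (lam j w) * e w = 0"
    using e[OF unit_vec_l2[OF p]] by (simp add: l2inner_scale_right l2inner_unit_vec[OF w])
  then show ?thesis
    using pos[OF w oc(1)] by simp
qed

text \<open>By \<open>T_restrict\<close>, T j raises d by one and the other T i preserve it, so
  support in depths up to k moves into the window from \<alpha> j to \<alpha> j + k. Sets A of
  depths are arbitrary so that each successive window qualifies.\<close>

lemma (in left_invertible_tuple) mpow_support: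
  fixes d :: "'v \<Rightarrow> nat"
  assumes f: "f \<in> l2 V" "\<And>v. f v \<noteq> 0 \<Longrightarrow> d v \<le> k"
    and same: "\<And>i f A. i \<noteq> j \<Longrightarrow> f \<in> l2 V \<Longrightarrow> restr {v. d v \<in> A} (S i f) = S i (restr {v. d v \<in> A} f)"
    and shift: "\<And>f A. f \<in> l2 V \<Longrightarrow> restr {v. d v \<in> Suc ` A} (S j f) = S j (restr {v. d v \<in> A} f)"
  shows "restr {v. d v \<in> {\<alpha> j..\<alpha> j + k}} (mpow T \<alpha> f) = mpow T \<alpha> f"
proof (induction \<alpha> rule: multiindex_induct)
  case zero
  show ?case
    using f(2) by (auto simp: mpow_0 l2_restrict_def fun_eq_iff)
next
  case (Suc \<alpha> i)
  let ?x = "mpow T \<alpha> f"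
  have x: "?x \<in> l2 V"
    by (intro in_l2 f)
  show ?case
  proof (cases "i = j")
    case True
    have "restr {v. d v \<in> Suc ` {\<alpha> j..\<alpha> j + k}} (T j ?x) = T j (restr {v. d v \<in> {\<alpha> j..\<alpha> j + k}} ?x)"
      by (rule T_restrict[OF shift x])
    then show ?thesis
      unfolding mpow_T_Suc[OF f(1)] True Suc by (simp add: image_Suc_atLeastAtMost del: atLeastAtMost_iff)
  next
    case False
    have "restr {v. d v \<in> {\<alpha> j..\<alpha> j + k}} (T i ?x) = T i (restr {v. d v \<in> {\<alpha> j..\<alpha> j + k}} ?x)"
      by (rule T_restrict[OF same[OF False] x])
    then show ?thesis
      unfolding mpow_T_Suc[OF f(1)] Suc using False by simp
  qed
qed

theorem mainTheorem8:
  fixes Vt :: "'d::{finite,linorder} \<Rightarrow> 'a set"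
    and Et :: "'d \<Rightarrow> ('a \<times> 'a) set"
    and lam :: "'d \<Rightarrow> ('d \<Rightarrow> 'a) \<Rightarrow> real"
  defines "V \<equiv> prodV Vt"
    and "S \<equiv> multishift Vt Et lam"
  defines "St \<equiv> cauchy_dual V S"
    and "E \<equiv> (\<Inter>j. op_kernel V (adjoint V (S j)))"
  defines "\<Omega> \<equiv> polydisc (\<lambda>j. inverse (spectral_radius V (St j)))"
  assumes rooted: "\<And>j. rooted_tree (Vt j) (Et j)"
    and locfin: "\<And>j. locally_finite_tree (Vt j) (Et j)"
    and leafless: "\<And>j. leafless (Vt j) (Et j)"
    and pos: "\<And>j w. w \<in> V \<Longrightarrow> w j \<noteq> tree_root (Vt j) (Et j) \<Longrightarrow> lam j w > 0"
    and bdd: "\<And>j. bounded_op V (S j)"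
    and comm: "commuting V S"
    and linv: "\<And>j. invertible_op V (adjoint V (S j) \<circ> S j)"
    and dcomm: "commuting V St"
    and kcond: "\<And>j \<alpha>. E \<subseteq> op_kernel V (adjoint V (S j) \<circ> mpow St (\<alpha>(j := 0)))"
  shows "\<exists>H ip U. rkhs V E \<Omega> H ip \<and> unitary_onto V U H ip
     \<and> (\<forall>j. \<forall>f\<in>l2 V. U (S j f) = (\<lambda>z v. z $ j * U f z v))
     \<and> ((\<forall>j. branching_index (Vt j) (Et j) \<noteq> \<infinity>) \<longrightarrow>
         (\<exists>\<kappa>. reproducing_kernel V E \<Omega> H ip \<kappa> \<and>
           (\<forall>z\<in>\<Omega>. \<forall>w\<in>\<Omega>. \<forall>e\<in>E.
              l2_has_sum V
                (\<lambda>(\<alpha>, \<beta>) v. (\<Prod>j\<in>UNIV. z $ j ^ \<alpha> j) * cnj (\<Prod>j\<in>UNIV. w $ j ^ \<beta> j)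
                    * orth_proj V E (adjoint V (mpow St \<alpha>) (mpow St \<beta> e)) v)
                (\<kappa> z w e)
                {(\<alpha>, \<beta>). \<forall>j. enat (nat \<bar>int (\<alpha> j) - int (\<beta> j)\<bar>) \<le> branching_index (Vt j) (Et j)})))"
proof -
  have depth: "total_depth Vt Et w = Suc (total_depth Vt Et (w(j := tree_parent (Et j) (w j))))"
    if "w \<in> prodV Vt" "w j \<noteq> tree_root (Vt j) (Et j)" for w j
    by (rule total_depth_parent) (use rooted that in auto)
  interpret M: left_invertible_tuple V S "total_depth Vt Et"
  proof
    have "(\<lambda>j. tree_root (Vt j) (Et j)) \<in> V"
      using tree_root_props(1)[OF rooted] by (simp add: V_def prodV_def)
    then show "V \<noteq> {}"
      by blast
    show "bounded_op V (S j)" for j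
      by (rule bdd)
    show "invertible_op V (adjoint V (S j) \<circ> S j)" for j
      by (rule linv)
    show "commuting V (cauchy_dual V S)"
      using dcomm by (simp add: St_def)
    show "(\<Inter>j. op_kernel V (adjoint V (S j))) \<subseteq> op_kernel V (adjoint V (S j) \<circ> mpow (cauchy_dual V S) (\<alpha>(j := 0)))" for j \<alpha>
      using kcond[of j \<alpha>] unfolding E_def St_def .
    \<comment> \<open>A vertex whose j-th coordinate is not the root has positive total depth, and
      at all other vertices S j f is 0.\<close>
    show "l2_restrict {v. total_depth Vt Et v = 0} (S j f) = (\<lambda>v. 0)" for j f
      using depth by (auto simp: S_def multishift_def l2_restrict_def fun_eq_iff)
    show "l2_restrict {v. total_depth Vt Et v = Suc n} (S j f) = S j (l2_restrict {v. total_depth Vt Et v = n} f)" for j f n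
      unfolding S_def by (rule multishift_restrict) (simp add: depth)
  qed
  have E: "M.E = E" and T: "M.T = St"
    by (simp_all add: E_def M.E_def St_def M.T_def)
  have \<Omega>: "polydisc M.r = \<Omega>"
    by (simp add: \<Omega>_def M.r_def[abs_def] T)
  define I where "I = {(\<alpha>, \<beta>). \<forall>j. enat (nat \<bar>int (\<alpha> j) - int (\<beta> j)\<bar>) \<le> branching_index (Vt j) (Et j)}"
  \<comment> \<open>Finiteness turns the index in an offending direction j into a number k. The
    windows of j-depths carrying T^\<beta> e and T^\<alpha> e' both have length k and start at
    \<beta> j and \<alpha> j, so they are disjoint.\<close>
  have orth: "l2inner V (mpow M.T \<beta> e) (mpow M.T \<alpha> e') = 0"
    if fin: "\<forall>j. branching_index (Vt j) (Et j) \<noteq> \<infinity>" and notin: "(\<alpha>, \<beta>) \<notin> I" and e: "e \<in> M.E" and e': "e' \<in> M.E"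
    for \<alpha> \<beta> e e'
  proof -
    obtain j where j: "\<not> enat (nat \<bar>int (\<alpha> j) - int (\<beta> j)\<bar>) \<le> branching_index (Vt j) (Et j)"
      using notin by (auto simp: I_def)
    obtain k where k: "branching_index (Vt j) (Et j) = enat k"
      using fin by blast
    define d where "d v = tree_depth (Vt j) (Et j) (v j)" for v
    have supp: "l2_restrict {v. d v \<in> {\<gamma> j..\<gamma> j + k}} (mpow M.T \<gamma> g) = mpow M.T \<gamma> g" if g: "g \<in> M.E" for \<gamma> g
    proof (rule M.mpow_support[OF M.E_l2[OF g]])
      show "d v \<le> k" if "g v \<noteq> 0" for v
      proof (rule ccontr)
        assume "\<not> d v \<le> k"
        then have deep: "branching_index (Vt j) (Et j) < enat (tree_depth (Vt j) (Et j) (v j))"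
          by (simp add: k d_def)
        have vV: "v \<in> prodV Vt"
          using l2_D0[OF M.E_l2[OF g], of v] that by (auto simp: V_def)
        have ker: "l2inner (prodV Vt) g (multishift Vt Et lam j f) = 0" if "f \<in> l2 (prodV Vt)" for f
          using M.E_iff[of g] g that by (simp only: V_def S_def)
        have "g v = 0"
        proof (rule joint_kernel_support[where Vt = Vt and j = j and Et = Et and lam = lam])
          show "lam j w > 0" if "w \<in> prodV Vt" "w j \<noteq> tree_root (Vt j) (Et j)" for w
            using pos[of w j] that by (simp add: V_def)
        qed (fact rooted locfin ker vV deep)+
        with that show False
          by simp
      qed
      show "l2_restrict {v. d v \<in> A} (S i f) = S i (l2_restrict {v. d v \<in> A} f)" if "i \<noteq> j" for i f A
        unfolding S_def by (rule multishift_restrict) (use that in \<open>simp add: d_def\<close>)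
      show "l2_restrict {v. d v \<in> Suc ` A} (S j f) = S j (l2_restrict {v. d v \<in> A} f)" for f A
      proof (unfold S_def, rule multishift_restrict)
        fix w assume w: "w \<in> prodV Vt" "w j \<noteq> tree_root (Vt j) (Et j)"
        then have "d w = Suc (d (w(j := tree_parent (Et j) (w j))))"
          using tree_depth_parent[OF rooted, of "w j" j] by (simp add: d_def prodV_def)
        then show "w \<in> {v. d v \<in> Suc ` A} \<longleftrightarrow> w(j := tree_parent (Et j) (w j)) \<in> {v. d v \<in> A}"
          by auto
      qed
    qed
    have range: "\<gamma> j \<le> d v \<and> d v \<le> \<gamma> j + k" if "g \<in> M.E" "mpow M.T \<gamma> g v \<noteq> 0" for \<gamma> g v
      using fun_cong[OF supp[OF that(1), of \<gamma>], of v] that(2) by (auto simp: l2_restrict_def split: if_splits)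
    show ?thesis
    proof (rule l2inner_disjoint, rule ccontr)
      fix v assume "\<not> (mpow M.T \<beta> e v = 0 \<or> mpow M.T \<alpha> e' v = 0)"
      then have "\<beta> j \<le> d v \<and> d v \<le> \<beta> j + k" "\<alpha> j \<le> d v \<and> d v \<le> \<alpha> j + k"
        using range e e' by auto
      with j k show False
        by auto
    qed
  qed
  have kernel: "\<exists>\<kappa>. reproducing_kernel V E \<Omega> M.model_space M.model_inner_product \<kappa> \<and>
      (\<forall>z\<in>\<Omega>. \<forall>w\<in>\<Omega>. \<forall>e\<in>E. l2_has_sum V
        (\<lambda>(\<alpha>, \<beta>) v. (\<Prod>j\<in>UNIV. z $ j ^ \<alpha> j) * cnj (\<Prod>j\<in>UNIV. w $ j ^ \<beta> j)
          * orth_proj V E (adjoint V (mpow St \<alpha>) (mpow St \<beta> e)) v) (\<kappa> z w e) I)"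
    if fin: "\<forall>j. branching_index (Vt j) (Et j) \<noteq> \<infinity>"
  proof (intro exI conjI ballI)
    show "reproducing_kernel V E \<Omega> M.model_space M.model_inner_product (\<lambda>z w e. M.model (M.kernel_vec w e) z)"
      using M.reproducing_kernel_model unfolding E \<Omega> .
    fix z w e assume "z \<in> \<Omega>" "w \<in> \<Omega>" "e \<in> E"
    then have "l2_has_sum V (M.kernel_term z w e) (M.model (M.kernel_vec w e) z) I"
      using orth[OF fin] by (intro M.kernel_series) (auto simp: E \<Omega>)
    then show "l2_has_sum V
        (\<lambda>(\<alpha>, \<beta>) v. (\<Prod>j\<in>UNIV. z $ j ^ \<alpha> j) * cnj (\<Prod>j\<in>UNIV. w $ j ^ \<beta> j)
          * orth_proj V E (adjoint V (mpow St \<alpha>) (mpow St \<beta> e)) v) (M.model (M.kernel_vec w e) z) I"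
      unfolding M.kernel_term_def M.vcoeff_def monom_at_def E T .
  qed
  have model: "rkhs V E \<Omega> M.model_space M.model_inner_product"
    using M.rkhs_model unfolding E \<Omega> .
  show ?thesis
    by (rule exI[of _ M.model_space], rule exI[of _ M.model_inner_product], rule exI[of _ M.model])
      (use model M.unitary_model M.model_S kernel in \<open>simp add: I_def\<close>)
qed

end
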